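(* Let $\gamma\ge0$ and let $\{\theta^{\nu,\alpha}\}_{\nu,\alpha>0}$ (written $\theta$ for short) be a family of statistically stationary strong solutions of $$d\theta+(u\cdot\nabla\theta-\nu\Delta\theta+\alpha\Lambda^{-2\gamma}\theta)\,dt=\sum_{n\in\mathbb N}g_n^\lambda\,dW_n(t),\qquad u=\mathcal R^\perp\theta=(-\mathcal R_2\theta,\mathcal R_1\theta),$$ with $\theta^{\nu,\alpha}$ posed on $\mathbb T^2_\lambda=\mathbb R^2/(\lambda\mathbb Z)^2$, where $\lambda=\lambda(\nu,\alpha)\ge1$ and $\lambda(\nu,\alpha)\to\infty$ as $\nu,\alpha\to0$. Suppose that for some $s\in(0,1)$, $$\sup_{\nu,\alpha}\mathbb E\left[\|\theta\|^2_{L^3_\lambda}\left(\|\theta\|_{L^3_\lambda}+\|\theta\|^{\mathrm{low}}_{\dot B^{-s}_{3,\infty}(\mathbb T^2_\lambda)}\right)\right]<\infty .$$ Let, with $\psi=\Lambda^{-1}\theta$, $$S_H(\ell):=\mathbb E\fint_{\mathbb S^1}\fint_{\mathbb T^2_\lambda}\theta(x)\bigl[\psi(x+\ell\hat n)-\psi(x-\ell\hat n)\bigr](u(x)\cdot\hat n)\,dx\,dS(\hat n).$$ Then $$\lim_{\ell_I\to\infty}\ \limsup_{\nu,\alpha\to0}\ \sup_{\ell\in[\ell_I,\lambda)}\left|\frac{S_H(\ell)}{\ell}\right|=0 .$$ Consequently, along such a family that is uniformly regular at low frequencies no non-trivial inverse Hamiltonian flux law can hold: there are no constant $c\ne0$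 and no scale $\ell_\alpha\to\infty$ with $\ell_\alpha/\lambda\to0$ for which $\lim_{\ell_I\to\infty}\limsup_{\nu,\alpha\to0}\sup_{\ell\in[\ell_I,\ell_\alpha]}|S_H(\ell)/\ell-c|=0$.
   Context: Torus and Fourier conventions: $\mathbb T^2_\lambda=\mathbb R^2/(\lambda\mathbb Z)^2$, frequency lattice $\mathbb Z^2_\lambda=\frac{2\pi}{\lambda}\mathbb Z^2$, $\fint_A f=\frac1{|A|}\int_A f$, $\widehat f(k)=\fint_{\mathbb T^2_\lambda}f(x)e^{-ik\cdot x}dx$. $\|f\|_{L^p_\lambda}=(\fint_{\mathbb T^2_\lambda}|f|^pdx)^{1/p}$ is the averaged norm. $\Lambda^s=(-\Delta)^{s/2}$ is the multiplier $|k|^s$; $\mathcal R_j$ is the Riesz transform with multiplier $ik_j/|k|$, $k\ne0$. Negative-order multipliers act on zero-mean functions. $dS$ is arclength on the unit circle $\mathbb S^1$, and $\fint_{\mathbb S^1}$ is the normalized integral. Low-frequency Besov seminorm: fix a standard smooth cutoff $\varphi$ supported in an annulus with $\sum_{j\in\mathbb Z}\varphi(2^{-j}r)=1$ for $r>0$. For zero-mean $f$ and $j\in\mathbb Z$ set $\dot\Delta_jf=\sum_{k\in\mathbb Z^2_\lambda\setminus\{0\}}\varphi(2^{-j}|k|)\widehat f(k)e^{ik\cdot x}$. For $s>0$, $$\|f\|^{\mathrm{low}}_{\dot B^{-s}_{3,\infty}(\mathbb T^2_\lambda)}:=\sup_{j\le0}2^{-sj}\|\dot\Delta_jf\|_{L^3_\lambda}.$$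 Standing assumptions: $\nu,\alpha>0$; $\{W_n\}_{n\in\mathbb N}$ are i.i.d. standard Brownian motions on a filtered probability space $(\Omega,\mathcal F,(\mathcal F_t),\mathbb P)$ satisfying the usual conditions; for each $\lambda$, $\{g_n^\lambda\}_n$ are smooth deterministic scalar fields on $\mathbb T^2_\lambda$ with zero spatial mean, satisfying $\sup_{\lambda\ge1}\sum_n\|\Lambda^{1+\sigma}g_n^\lambda\|^2_{L^2_\lambda}<\infty$ for all $\sigma>0$ and $\lim_{\delta\to0}\sup_{\lambda\ge1}\sum_n\|(\Lambda^{-1/2}g_n^\lambda)_{\le\delta}\|^2_{L^2_\lambda}=0$, where $f_{\le\delta}=\sum_{|k|\le\delta}\widehat f(k)e^{ik\cdot x}$; $\theta$ has zero spatial mean. Statistically stationary strong solution (for fixed $\nu,\alpha>0$, $\lambda\ge1$ and a given stochastic basis): a process $\theta$ that (i) is $\mathcal F_t$-adapted and satisfies the equation pathwise (in time-integrated form, $\mathbb P$-a.s.); (ii) satisfies $\theta\in C([0,\infty);H^1(\mathbb T^2_\lambda))\cap L^2_{\rm loc}([0,\infty);H^2(\mathbb T^2_\lambda))$ $\mathbb P$-a.s.; (iii) has law on path space invariant under time translations. Expectations of functionals of $\theta$ are taken at a fixed time $t$, and are independent of $t$ by stationarity. The Hamiltonian is $\|\Lambda^{-1/2}\theta\|_{L^2}^2$. *)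

theory Defs
  imports "HOL-Probability.Probability"
begin

type_synonym plane = "real^2"


section \<open>Function spaces and Fourier analysis on the torus of side \<open>L\<close>\<close>

text \<open>
  Functions on the torus of side \<open>L > 0\<close> are \<open>L\<close>-periodic Borel functions on the plane; elements of
  \<open>L\<^sup>p\<close> are represented by such functions, and every notion below that is used on \<open>L\<^sup>p\<close> is invariant
  under changes on null sets. Norms take values in \<^typ>\<open>ennreal\<close>, with value \<open>\<infinity>\<close> outside the space.
\<close>

definition torus_periodic :: "real \<Rightarrow> (plane \<Rightarrow> 'b) \<Rightarrow> bool" where
  "torus_periodic L f \<longleftrightarrow> (\<forall>x (j::2). f (x + L *\<^sub>R axis j 1) = f x)"

definition torus_avg :: "real \<Rightarrow> (plane \<Rightarrow> 'b::{banach, second_countable_topology}) \<Rightarrow> 'b" where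
  "torus_avg L f = (LINT x:cbox 0 (vec L)|lborel. f x) /\<^sub>R L\<^sup>2"

definition freq_lattice :: "real \<Rightarrow> plane set" where
  "freq_lattice L = {k. \<forall>j. \<exists>m::int. k $ j = 2 * pi / L * real_of_int m}"

definition fourier_coeff :: "real \<Rightarrow> (plane \<Rightarrow> real) \<Rightarrow> plane \<Rightarrow> complex" where
  "fourier_coeff L f k = torus_avg L (\<lambda>x. complex_of_real (f x) * cis (- (k \<bullet> x)))"

definition ennreal_powr :: "ennreal \<Rightarrow> real \<Rightarrow> ennreal" where
  "ennreal_powr x p = (if x = \<infinity> then \<infinity> else ennreal (enn2real x powr p))"

definition Lp_norm :: "real \<Rightarrow> real \<Rightarrow> (plane \<Rightarrow> 'b::real_normed_vector) \<Rightarrow> ennreal" where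
  "Lp_norm L p f =
     ennreal_powr ((\<integral>\<^sup>+x\<in>cbox 0 (vec L). ennreal (norm (f x) powr p) \<partial>lborel) / ennreal (L\<^sup>2)) (1 / p)"

definition L2_space :: "real \<Rightarrow> (plane \<Rightarrow> real) set" where
  "L2_space L = {f. torus_periodic L f \<and> f \<in> borel_measurable borel \<and> Lp_norm L 2 f < \<infinity>}"

definition Hs_norm :: "real \<Rightarrow> real \<Rightarrow> (plane \<Rightarrow> real) \<Rightarrow> ennreal" where
  "Hs_norm L s f =
     ennreal_powr (\<Sum>\<^sub>\<infinity>k\<in>freq_lattice L.
       ennreal ((1 + (norm k)\<^sup>2) powr s * (cmod (fourier_coeff L f k))\<^sup>2)) (1 / 2)"

definition Hs_space :: "real \<Rightarrow> real \<Rightarrow> (plane \<Rightarrow> real) set" where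
  "Hs_space L s = {f \<in> L2_space L. Hs_norm L s f < \<infinity>}"

text \<open>The Borel \<open>\<sigma>\<close>-algebra of \<open>H\<^sup>s\<close>, generated by the norm-open sets.\<close>

definition Hs_borel :: "real \<Rightarrow> real \<Rightarrow> (plane \<Rightarrow> real) measure" where
  "Hs_borel L s = sigma (Hs_space L s)
     {U. U \<subseteq> Hs_space L s \<and>
         (\<forall>f\<in>U. \<exists>\<epsilon>>0. \<forall>h\<in>Hs_space L s. Hs_norm L s (\<lambda>x. h x - f x) < ennreal \<epsilon> \<longrightarrow> h \<in> U)}"

text \<open>
  The multiplier operator returns a representative of the real \<open>L\<^sup>2\<close> function with coefficients
  \<open>m(k) f^(k)\<close>. It is unique up to null sets, and it exists whenever these coefficients are
  square summable and \<open>m(-k)\<close> is the conjugate of \<open>m(k)\<close>, as for all symbols below.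
\<close>

definition fourier_multiplier :: "real \<Rightarrow> (plane \<Rightarrow> complex) \<Rightarrow> (plane \<Rightarrow> real) \<Rightarrow> plane \<Rightarrow> real" where
  "fourier_multiplier L m f =
     (SOME h. h \<in> L2_space L \<and> (\<forall>k\<in>freq_lattice L. fourier_coeff L h k = m k * fourier_coeff L f k))"

text \<open>
  Since \<open>0 powr s = 0\<close> and \<open>x / 0 = 0\<close>, the zero mode is annihilated in the next two definitions, for
  every \<open>s\<close>. On functions of zero mean, \<open>Lam L 0\<close> is therefore the identity.
\<close>

definition Lam :: "real \<Rightarrow> real \<Rightarrow> (plane \<Rightarrow> real) \<Rightarrow> plane \<Rightarrow> real" where
  "Lam L s = fourier_multiplier L (\<lambda>k. complex_of_real (norm k powr s))"

definition riesz :: "real \<Rightarrow> 2 \<Rightarrow> (plane \<Rightarrow> real) \<Rightarrow> plane \<Rightarrow> real" where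
  "riesz L j = fourier_multiplier L (\<lambda>k. \<i> * complex_of_real (k $ j / norm k))"

definition velocity :: "real \<Rightarrow> (plane \<Rightarrow> real) \<Rightarrow> plane \<Rightarrow> plane" where
  "velocity L f x = vector [- riesz L 2 f x, riesz L 1 f x]"

definition gradient :: "real \<Rightarrow> (plane \<Rightarrow> real) \<Rightarrow> plane \<Rightarrow> plane" where
  "gradient L f x = (\<chi> j. fourier_multiplier L (\<lambda>k. \<i> * complex_of_real (k $ j)) f x)"

definition laplacian :: "real \<Rightarrow> (plane \<Rightarrow> real) \<Rightarrow> plane \<Rightarrow> real" where
  "laplacian L = fourier_multiplier L (\<lambda>k. - complex_of_real ((norm k)\<^sup>2))"

definition low_pass :: "real \<Rightarrow> real \<Rightarrow> (plane \<Rightarrow> real) \<Rightarrow> plane \<Rightarrow> complex" where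
  "low_pass L \<delta> f x = (\<Sum>k | k \<in> freq_lattice L \<and> norm k \<le> \<delta>. fourier_coeff L f k * cis (k \<bullet> x))"


section \<open>Smoothness and the low-frequency Besov seminorm\<close>

primrec C_k :: "nat \<Rightarrow> ('a::euclidean_space \<Rightarrow> real) \<Rightarrow> bool" where
  "C_k 0 f \<longleftrightarrow> continuous_on UNIV f"
| "C_k (Suc n) f \<longleftrightarrow>
     (\<forall>x. f differentiable (at x)) \<and> (\<forall>b\<in>Basis. C_k n (\<lambda>x. frechet_derivative f (at x) b))"

definition smooth :: "('a::euclidean_space \<Rightarrow> real) \<Rightarrow> bool" where
  "smooth f \<longleftrightarrow> (\<forall>n. C_k n f)"

definition dyadic_cutoff :: "(real \<Rightarrow> real) \<Rightarrow> bool" where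
  "dyadic_cutoff \<phi> \<longleftrightarrow>
     smooth \<phi> \<and>
     (\<exists>a b. 0 < a \<and> a < b \<and> (\<forall>r. r \<notin> {a..b} \<longrightarrow> \<phi> r = 0)) \<and>
     (\<forall>r>0. ((\<lambda>j::int. \<phi> (2 powi (- j) * r)) has_sum 1) UNIV)"

definition dyadic_block ::
    "(real \<Rightarrow> real) \<Rightarrow> real \<Rightarrow> int \<Rightarrow> (plane \<Rightarrow> real) \<Rightarrow> plane \<Rightarrow> complex" where
  "dyadic_block \<phi> L j f x =
     (\<Sum>\<^sub>\<infinity>k\<in>freq_lattice L - {0}.
        complex_of_real (\<phi> (2 powi (- j) * norm k)) * fourier_coeff L f k * cis (k \<bullet> x))"

definition besov_low :: "(real \<Rightarrow> real) \<Rightarrow> real \<Rightarrow> real \<Rightarrow> (plane \<Rightarrow> real) \<Rightarrow> ennreal" where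
  "besov_low \<phi> L s f =
     (SUP j\<in>{..0::int}. ennreal (2 powr (- s * real_of_int j)) * Lp_norm L 3 (dyadic_block \<phi> L j f))"


section \<open>Stochastic basis, Brownian motions and forcing\<close>

text \<open>Time is \<open>[0,\<infinity>)\<close>; the values of filtrations and processes at negative times are irrelevant.\<close>

definition usual_filtration :: "'w measure \<Rightarrow> (real \<Rightarrow> 'w measure) \<Rightarrow> bool" where
  "usual_filtration M F \<longleftrightarrow>
     (\<forall>t\<ge>0. subalgebra M (F t)) \<and>
     (\<forall>s\<ge>0. \<forall>t\<ge>s. sets (F s) \<subseteq> sets (F t)) \<and>
     (\<forall>t\<ge>0. sets (F t) = (\<Inter>s\<in>{t<..}. sets (F s))) \<and>
     (\<forall>N\<in>null_sets M. \<forall>A\<subseteq>N. A \<in> sets (F 0))"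

definition brownian_motion ::
    "'w measure \<Rightarrow> (real \<Rightarrow> 'w measure) \<Rightarrow> (real \<Rightarrow> 'w \<Rightarrow> real) \<Rightarrow> bool" where
  "brownian_motion M F B \<longleftrightarrow>
     (\<forall>t\<ge>0. B t \<in> borel_measurable (F t)) \<and>
     (AE \<omega> in M. B 0 \<omega> = 0) \<and>
     (AE \<omega> in M. continuous_on {0..} (\<lambda>t. B t \<omega>)) \<and>
     (\<forall>s\<ge>0. \<forall>t>s.
        distributed M lborel (\<lambda>\<omega>. B t \<omega> - B s \<omega>) (normal_density 0 (sqrt (t - s))) \<and>
        prob_space.indep_set M (sets (F s))
          {(\<lambda>\<omega>. B t \<omega> - B s \<omega>) -` A \<inter> space M | A. A \<in> sets borel})"

definition iid_brownian_motions ::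
    "'w measure \<Rightarrow> (real \<Rightarrow> 'w measure) \<Rightarrow> (nat \<Rightarrow> real \<Rightarrow> 'w \<Rightarrow> real) \<Rightarrow> bool" where
  "iid_brownian_motions M F W \<longleftrightarrow>
     (\<forall>n. brownian_motion M F (W n)) \<and>
     prob_space.indep_vars M (\<lambda>_. PiM {0..} (\<lambda>_. borel)) (\<lambda>n \<omega>. \<lambda>t\<in>{0..}. W n t \<omega>) UNIV"

definition admissible_forcing :: "(real \<Rightarrow> nat \<Rightarrow> plane \<Rightarrow> real) \<Rightarrow> bool" where
  "admissible_forcing g \<longleftrightarrow>
     (\<forall>L\<ge>1. \<forall>n. torus_periodic L (g L n) \<and> smooth (g L n) \<and> torus_avg L (g L n) = 0) \<and>
     (\<forall>\<sigma>>0. (SUP L\<in>{1..}. \<Sum>n. (Lp_norm L 2 (Lam L (1 + \<sigma>) (g L n)))\<^sup>2) < \<infinity>) \<and>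
     ((\<lambda>\<delta>. SUP L\<in>{1..}. \<Sum>n. (Lp_norm L 2 (low_pass L \<delta> (Lam L (- 1 / 2) (g L n))))\<^sup>2) \<longlongrightarrow> 0)
       (at_right 0)"


section \<open>Statistically stationary strong solutions\<close>

text \<open>
  \<open>I\<close> is the \<open>L\<^sup>2\<close>-valued Bochner integral of \<open>v\<close> over \<open>[0,t]\<close>. As \<open>L\<^sup>2\<close> is a separable Hilbert space,
  strong measurability is weak measurability (Pettis) and the integral is determined by its
  pairings.
\<close>

definition has_L2_integral ::
    "real \<Rightarrow> (real \<Rightarrow> plane \<Rightarrow> real) \<Rightarrow> real \<Rightarrow> (plane \<Rightarrow> real) \<Rightarrow> bool" where
  "has_L2_integral L v t I \<longleftrightarrow>
     I \<in> L2_space L \<and>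
     (AE r in lebesgue. r \<in> {0..t} \<longrightarrow> v r \<in> L2_space L) \<and>
     (\<integral>\<^sup>+r\<in>{0..t}. Lp_norm L 2 (v r) \<partial>lebesgue) < \<infinity> \<and>
     (\<forall>h\<in>L2_space L.
        set_integrable lebesgue {0..t} (\<lambda>r. torus_avg L (\<lambda>x. v r x * h x)) \<and>
        torus_avg L (\<lambda>x. I x * h x) = (LINT r:{0..t}|lebesgue. torus_avg L (\<lambda>x. v r x * h x)))"

definition drift :: "real \<Rightarrow> real \<Rightarrow> real \<Rightarrow> real \<Rightarrow> (plane \<Rightarrow> real) \<Rightarrow> plane \<Rightarrow> real" where
  "drift L \<nu> \<alpha> \<gamma> f x =
     velocity L f x \<bullet> gradient L f x - \<nu> * laplacian L f x + \<alpha> * Lam L (- 2 * \<gamma>) f x"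

text \<open>
  For almost every \<open>\<omega>\<close> the noise series \<open>\<Sum>n. g n * W n t \<omega>\<close> converges in \<open>L\<^sup>2\<close> for all \<open>t\<close>; the equation
  identifies its sum with \<open>\<theta>(t) - \<theta>(0) + \<integral>\<^sub>0\<^sup>t drift\<close>.
\<close>

definition solves_pathwise ::
    "'w measure \<Rightarrow> (nat \<Rightarrow> real \<Rightarrow> 'w \<Rightarrow> real) \<Rightarrow> (nat \<Rightarrow> plane \<Rightarrow> real) \<Rightarrow> real \<Rightarrow> real \<Rightarrow> real \<Rightarrow> real \<Rightarrow>
     (real \<Rightarrow> 'w \<Rightarrow> plane \<Rightarrow> real) \<Rightarrow> bool" where
  "solves_pathwise M W g L \<nu> \<alpha> \<gamma> \<theta> \<longleftrightarrow>
     (AE \<omega> in M. \<forall>t\<ge>0. \<exists>I. has_L2_integral L (\<lambda>r. drift L \<nu> \<alpha> \<gamma> (\<theta> r \<omega>)) t I \<and>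
        (\<lambda>N. Lp_norm L 2 (\<lambda>x. \<theta> t \<omega> x - \<theta> 0 \<omega> x + I x - (\<Sum>n<N. g n x * W n t \<omega>))) \<longlonglongrightarrow> 0)"

definition path_regular :: "real \<Rightarrow> (real \<Rightarrow> plane \<Rightarrow> real) \<Rightarrow> bool" where
  "path_regular L v \<longleftrightarrow>
     (\<forall>t\<ge>0. v t \<in> Hs_space L 1 \<and>
        ((\<lambda>r. Hs_norm L 1 (\<lambda>x. v r x - v t x)) \<longlongrightarrow> 0) (at t within {0..})) \<and>
     (\<forall>T>0. (\<integral>\<^sup>+t\<in>{0..T}. (Hs_norm L 2 (v t))\<^sup>2 \<partial>lebesgue) < \<infinity>)"

text \<open>
  Laws are compared on the \<open>\<sigma>\<close>-algebra generated by the coordinates, whose trace on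
  \<open>C([0,\<infinity>); H\<^sup>1)\<close> is the Borel \<open>\<sigma>\<close>-algebra, because \<open>H\<^sup>1\<close> is separable.
\<close>

definition stationary_process ::
    "'w measure \<Rightarrow> real \<Rightarrow> (real \<Rightarrow> 'w \<Rightarrow> plane \<Rightarrow> real) \<Rightarrow> bool" where
  "stationary_process M L \<theta> \<longleftrightarrow>
     (\<forall>h\<ge>0. distr M (PiM {0..} (\<lambda>_. Hs_borel L 1)) (\<lambda>\<omega>. \<lambda>t\<in>{0..}. \<theta> (t + h) \<omega>) =
            distr M (PiM {0..} (\<lambda>_. Hs_borel L 1)) (\<lambda>\<omega>. \<lambda>t\<in>{0..}. \<theta> t \<omega>))"

definition stationary_strong_solution ::
    "'w measure \<Rightarrow> (real \<Rightarrow> 'w measure) \<Rightarrow> (nat \<Rightarrow> real \<Rightarrow> 'w \<Rightarrow> real) \<Rightarrow> (nat \<Rightarrow> plane \<Rightarrow> real) \<Rightarrow>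
     real \<Rightarrow> real \<Rightarrow> real \<Rightarrow> real \<Rightarrow> (real \<Rightarrow> 'w \<Rightarrow> plane \<Rightarrow> real) \<Rightarrow> bool" where
  "stationary_strong_solution M F W g L \<nu> \<alpha> \<gamma> \<theta> \<longleftrightarrow>
     (\<forall>t\<ge>0. \<theta> t \<in> measurable (F t) (Hs_borel L 1)) \<and>
     (AE \<omega> in M. \<forall>t\<ge>0. torus_avg L (\<theta> t \<omega>) = 0) \<and>
     solves_pathwise M W g L \<nu> \<alpha> \<gamma> \<theta> \<and>
     (AE \<omega> in M. path_regular L (\<lambda>t. \<theta> t \<omega>)) \<and>
     stationary_process M L \<theta>"


section \<open>The third-order Hamiltonian structure function\<close>

definition circle_avg :: "(plane \<Rightarrow> real) \<Rightarrow> real" where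
  "circle_avg f = (LINT a:{0..2 * pi}|lborel. f (vector [cos a, sin a])) / (2 * pi)"

text \<open>Here \<open>\<theta>\<close> is the random field at one fixed time.\<close>

definition S_H :: "'w measure \<Rightarrow> real \<Rightarrow> ('w \<Rightarrow> plane \<Rightarrow> real) \<Rightarrow> real \<Rightarrow> real" where
  "S_H M L \<theta> l =
     (LINT \<omega>|M. circle_avg (\<lambda>n. torus_avg L (\<lambda>x.
        \<theta> \<omega> x * (Lam L (- 1) (\<theta> \<omega>) (x + l *\<^sub>R n) - Lam L (- 1) (\<theta> \<omega>) (x - l *\<^sub>R n)) *
        (velocity L (\<theta> \<omega>) x \<bullet> n))))"

text \<open>The limit \<open>\<nu>, \<alpha> \<rightarrow> 0\<close> over positive \<open>\<nu>\<close> and \<open>\<alpha>\<close>, with no relation imposed between them.\<close>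

definition zero_lim :: "(real \<times> real) filter" where
  "zero_lim = at_right 0 \<times>\<^sub>F at_right 0"

end

theory Submission
  imports Defs
begin

text \<open>
  Let \<open>A\<close> and \<open>B\<close> be the cubic norm and the low-frequency Besov seminorm of a mean-zero field \<open>\<theta>\<close>, and let
  \<open>P \<tau>\<close> be the heat multiplier \<open>exp (- \<tau>\<^sup>2 |k|\<^sup>2 / 2)\<close>. The low blocks are controlled by \<open>B\<close>, the remaining
  part by a spectral gap, so that \<open>P \<tau> \<theta>\<close> has cubic norm \<open>O(\<tau> powr (- \<kappa>)) sqrt (A (A + B))\<close> with \<open>\<kappa> = s / 4\<close>.
  Since \<open>1 / |k| = 2 / sqrt pi * (\<integral>\<tau>. exp (- \<tau>\<^sup>2 |k|\<^sup>2))\<close> over \<open>\<tau> > 0\<close>, the potential \<open>\<psi>\<close> is Hoelder continuous of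
  exponent \<open>1 - \<kappa>\<close> in the cubic norm. Writing the velocity by the same integral avoids the
  boundedness of the Riesz transforms: scales \<open>\<tau> > l\<close> are estimated by Hoelder's inequality, and for \<open>\<tau> < l\<close>
  the oddness of the kernel moves the singularity onto an increment of \<open>\<psi>\<close>. Hence the flux at scale \<open>l\<close> divided by \<open>l\<close>
  is at most a constant times \<open>l powr (- \<kappa>) A\<^sup>2 (A + B)\<close>. This holds first for trigonometric
  polynomials, and passes to the limit along Jackson means, which increase neither \<open>A\<close> nor \<open>B\<close>.
\<close>

text \<open>The hypothesis bounds the expectation of \<open>A^2 * (A + B)\<close>, which is linear
  in \<open>B\<close>, and this dictates the exponents. The trilinear estimate spends the decay of
  the heat flow up to twice, so a decay constant proportional to \<open>A + B\<close> would yield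
  the square of \<open>B\<close>. The geometric mean of the trivial bound \<open>A\<close> and of
  the decaying bound is used instead; its square is linear in \<open>B\<close>. The price is an
  exponent: the sum over the low blocks converges only below \<open>s\<close>, \<open>s / 2\<close>
  is chosen, and the geometric mean leaves \<open>s / 4\<close>.

  The other constraint is uniformity in the side of the torus, which tends to infinity. Multipliers
  are therefore estimated not through sums over frequencies but as averages of translations against
  explicit kernels, by Minkowski's inequality: Gaussians for the smoothing, and for the spectral gap
  a positive trigonometric kernel whose mean distance from the lattice is comparable to the
  reciprocal of its largest frequency. Only the passage to the limit uses the \<open>H^1\<close>
  regularity; the constants there may depend on the field and on the torus.\<close>

definition torus_measure :: "real \<Rightarrow> plane measure" where
  "torus_measure L = uniform_measure lborel (cbox 0 (vec L))"

lemma inner2: "x \<bullet> y = x $ 1 * y $ 1 + x $ 2 * y $ 2" for x y :: plane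
  by (simp add: inner_vec_def sum_2)

lemma norm2_sq: "(norm (x::plane))\<^sup>2 = (x $ 1)\<^sup>2 + (x $ 2)\<^sup>2"
  unfolding power2_norm_eq_inner inner2 by (simp add: power2_eq_square)

lemma borel_measurable_nth2 [measurable]: "(\<lambda>x::plane. x $ i) \<in> borel_measurable borel"
  by (intro borel_measurable_continuous_onI continuous_intros)

lemma borel_measurable_vector2 [measurable]:
  assumes [measurable]: "f \<in> borel_measurable M" "g \<in> borel_measurable M"
  shows "(\<lambda>x. vector [f x, g x] :: plane) \<in> borel_measurable M"
proof -
  have "(\<lambda>x. vector [f x, g x] :: plane) = (\<lambda>x. f x *\<^sub>R axis 1 1 + g x *\<^sub>R axis 2 1)"
    by (simp add: vec_eq_iff forall_2 vector_2 axis_def fun_eq_iff)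
  then show ?thesis by simp
qed

lemma sets_torus_measure [simp, measurable_cong]: "sets (torus_measure L) = sets borel"
  by (simp add: torus_measure_def)

lemma space_torus_measure [simp]: "space (torus_measure L) = UNIV"
  by (simp add: torus_measure_def)

lemma emeasure_cell:
  assumes "L > 0"
  shows "emeasure lborel (cbox 0 (vec L) :: plane set) = ennreal (L\<^sup>2)"
proof -
  have "emeasure lborel (cbox 0 (vec L) :: plane set) = ennreal (\<Prod>b\<in>Basis. (vec L - 0 :: plane) \<bullet> b)"
    using assms by (intro emeasure_lborel_cbox) (auto simp: Basis_vec_def inner_axis)
  also have "(\<Prod>b\<in>(Basis::plane set). (vec L - 0 :: plane) \<bullet> b) = (\<Prod>b\<in>(Basis::plane set). L)"
    by (intro prod.cong) (auto simp: Basis_vec_def inner_axis)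
  finally show ?thesis by simp
qed

lemma prob_space_torus_measure: "L > 0 \<Longrightarrow> prob_space (torus_measure L)"
  unfolding torus_measure_def by (intro prob_space_uniform_measure) (auto simp: emeasure_cell)

lemma torus_measure_density:
  assumes "L > 0"
  shows "torus_measure L = density lborel (\<lambda>x. ennreal (indicator (cbox 0 (vec L)) x / L\<^sup>2))"
  unfolding torus_measure_def uniform_measure_def
  using assms
  by (intro density_cong) (auto simp: emeasure_cell divide_ennreal[symmetric] split: split_indicator)

lemma nn_integral_torus:
  assumes "L > 0" "f \<in> borel_measurable borel"
  shows "(\<integral>\<^sup>+x. f x \<partial>torus_measure L) = (\<integral>\<^sup>+x\<in>cbox 0 (vec L). f x \<partial>lborel) / ennreal (L\<^sup>2)"
  using assms unfolding torus_measure_def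
  by (subst nn_integral_uniform_measure) (auto simp: emeasure_cell)

lemma torus_avg_eq:
  fixes f :: "plane \<Rightarrow> 'b::{banach, second_countable_topology}"
  assumes "L > 0" "f \<in> borel_measurable borel"
  shows "torus_avg L f = (\<integral>x. f x \<partial>torus_measure L)"
proof -
  have "(\<integral>x. f x \<partial>torus_measure L) = (\<integral>x. (indicator (cbox 0 (vec L)) x / L\<^sup>2) *\<^sub>R f x \<partial>lborel)"
    using assms unfolding torus_measure_density[OF assms(1)]
    by (subst integral_density) auto
  also have "\<dots> = (\<integral>x. (1 / L\<^sup>2) *\<^sub>R (indicator (cbox 0 (vec L)) x *\<^sub>R f x) \<partial>lborel)"
    by (intro Bochner_Integration.integral_cong) auto
  also have "\<dots> = (1 / L\<^sup>2) *\<^sub>R (\<integral>x. indicator (cbox 0 (vec L)) x *\<^sub>R f x \<partial>lborel)"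
    by (rule integral_scaleR_right)
  finally show ?thesis
    by (simp add: torus_avg_def set_lebesgue_integral_def divide_inverse)
qed

definition lat :: "real \<Rightarrow> int \<times> int \<Rightarrow> plane" where
  "lat L p = vector [L * of_int (fst p), L * of_int (snd p)]"

lemma lat_nth [simp]: "lat L p $ 1 = L * of_int (fst p)" "lat L p $ 2 = L * of_int (snd p)"
  by (simp_all add: lat_def)

lemma torus_periodic_int:
  assumes "torus_periodic L f"
  shows "f (x + (L * of_int n) *\<^sub>R axis j 1) = f x"
proof (induction n arbitrary: x rule: int_induct[where k=0])
  case base then show ?case by simp
next
  case (step1 i)
  have "f (x + (L * of_int (i + 1)) *\<^sub>R axis j 1) = f (x + (L * of_int i) *\<^sub>R axis j 1 + L *\<^sub>R axis j 1)"
    by (simp add: algebra_simps)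
  then show ?case using step1 assms by (simp add: torus_periodic_def)
next
  case (step2 i)
  have "f (x + (L * of_int (i - 1)) *\<^sub>R axis j 1)
      = f (x + (L * of_int (i - 1)) *\<^sub>R axis j 1 + L *\<^sub>R axis j 1)"
    using assms by (simp add: torus_periodic_def)
  also have "\<dots> = f (x + (L * of_int i) *\<^sub>R axis j 1)"
    by (simp add: algebra_simps)
  finally show ?case using step2 by simp
qed

lemma lat_axis: "lat L p = (L * of_int (fst p)) *\<^sub>R axis 1 1 + (L * of_int (snd p)) *\<^sub>R axis 2 1"
  by (simp add: vec_eq_iff forall_2 axis_def)

lemma torus_periodic_lat:
  assumes "torus_periodic L f"
  shows "f (x + lat L p) = f x"
  using torus_periodic_int[OF assms] unfolding lat_axis by (simp flip: add.assoc)

text \<open>Half-open, so that its lattice translates cover every point exactly once; the closed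
  cell behind \<open>torus_avg\<close> differs from it by a null set.\<close>

definition cell :: "real \<Rightarrow> plane set" where
  "cell L = {x. \<forall>i. 0 \<le> x $ i \<and> x $ i < L}"

lemma cell_borel [measurable]: "cell L \<in> sets borel"
proof -
  have "cell L = {x\<in>space borel. 0 \<le> x $ 1 \<and> x $ 1 < L \<and> 0 \<le> x $ 2 \<and> x $ 2 < L}"
    by (auto simp: cell_def forall_2)
  also have "\<dots> \<in> sets borel" by measurable
  finally show ?thesis .
qed

lemma AE_cell_cbox: "AE x in lborel. x \<in> cbox 0 (vec L) \<longleftrightarrow> x \<in> cell L"
proof -
  have "cbox 0 (vec L) - box 0 (vec L) \<in> null_sets (lborel::plane measure)"
    using negligible_frontier_interval[of 0 "vec L :: plane"]
    by (simp add: negligible_iff_null_sets null_sets_def)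
  moreover have "cell L \<subseteq> cbox 0 (vec L)" "box 0 (vec L) \<subseteq> cell L"
    by (auto simp: cell_def mem_box_cart less_imp_le)
  ultimately show ?thesis
    by (intro AE_I[where N="cbox 0 (vec L) - box 0 (vec L)"]) (auto simp: null_sets_def)
qed

lemma nn_integral_torus_cell:
  assumes "L > 0" "f \<in> borel_measurable borel"
  shows "(\<integral>\<^sup>+x. f x \<partial>torus_measure L) = (\<integral>\<^sup>+x\<in>cell L. f x \<partial>lborel) / ennreal (L\<^sup>2)"
  unfolding nn_integral_torus[OF assms]
  using AE_cell_cbox[of L]
  by (intro arg_cong2[where f="(/)"] nn_integral_cong_AE refl) (auto split: split_indicator)

text \<open>In each coordinate the only admissible shift is
  \<open>- \<lfloor>a / L\<rfloor>\<close>. The sum over translates is written as an integral over a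
  counting measure so that it can be exchanged with the integral over the plane.\<close>

lemma cell_tiling:
  assumes "L > 0"
  shows "(\<integral>\<^sup>+p. indicator (cell L) (x + lat L p) \<partial>count_space UNIV) = 1"
proof -
  define q where "q = (- \<lfloor>x $ 1 / L\<rfloor>, - \<lfloor>x $ 2 / L\<rfloor>)"
  have *: "0 \<le> a + L * of_int m \<and> a + L * of_int m < L \<longleftrightarrow> m = - \<lfloor>a / L\<rfloor>" for a m
  proof -
    have "0 \<le> a + L * of_int m \<and> a + L * of_int m < L \<longleftrightarrow> of_int (-m) \<le> a / L \<and> a / L < of_int (-m) + 1"
      using assms by (auto simp: field_simps)
    also have "\<dots> \<longleftrightarrow> \<lfloor>a / L\<rfloor> = - m"
      by (simp add: floor_eq_iff)
    finally show ?thesis by auto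
  qed
  have "indicator (cell L) (x + lat L p) = (indicator {q} p :: ennreal)" for p
    using *[of "x $ 1" "fst p"] *[of "x $ 2" "snd p"]
    by (auto simp: cell_def forall_2 q_def prod_eq_iff split: split_indicator)
  then show ?thesis by simp
qed

lemma lborel_shift_nn: 
  fixes f :: "plane \<Rightarrow> ennreal"
  assumes [measurable]: "f \<in> borel_measurable borel"
  shows "(\<integral>\<^sup>+x. f (x + y) \<partial>lborel) = (\<integral>\<^sup>+x. f x \<partial>lborel)"
proof -
  have "(\<integral>\<^sup>+x. f x \<partial>lborel) = (\<integral>\<^sup>+x. f x \<partial>distr lborel borel ((+) y))"
    by (simp add: lborel_distr_plus)
  also have "\<dots> = (\<integral>\<^sup>+x. f (x + y) \<partial>lborel)"
    by (subst nn_integral_distr) (auto simp: add.commute)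
  finally show ?thesis by simp
qed

text \<open>The shifted cell is cut along the lattice translates of \<open>cell L\<close>. Each
  piece is moved by its lattice vector, which a periodic \<open>f\<close> does not notice, and the
  moved pieces tile \<open>cell L\<close> again.\<close>

lemma nn_integral_torus_shift:
  assumes L: "L > 0" and [measurable]: "f \<in> borel_measurable borel" and per: "torus_periodic L f"
  shows "(\<integral>\<^sup>+x. f (x + y) \<partial>torus_measure L) = (\<integral>\<^sup>+x. f x \<partial>torus_measure L)"
proof -
  let ?I = "indicator (cell L) :: plane \<Rightarrow> ennreal"
  have neg: "lat L (- p) = - lat L p" for p
    by (simp add: vec_eq_iff forall_2)
  have "(\<integral>\<^sup>+x. f (x + y) * ?I x \<partial>lborel) = (\<integral>\<^sup>+x. f (x + y + -y) * 0 + f (x + y) * ?I (x + y + - y) \<partial>lborel)"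
    by simp
  also have "\<dots> = (\<integral>\<^sup>+x. f x * ?I (x - y) \<partial>lborel)"
    using lborel_shift_nn[of "\<lambda>x. f x * ?I (x - y)" y] by simp
  also have "\<dots> = (\<integral>\<^sup>+x. (\<integral>\<^sup>+p. f x * ?I (x - y) * ?I (x + lat L p) \<partial>count_space UNIV) \<partial>lborel)"
    by (subst nn_integral_cmult) (auto simp: cell_tiling[OF L])
  also have "\<dots> = (\<integral>\<^sup>+p. (\<integral>\<^sup>+x. f x * ?I (x - y) * ?I (x + lat L p) \<partial>lborel) \<partial>count_space UNIV)"
    by (rule nn_integral_count_space_nn_integral) auto
  also have "\<dots> = (\<integral>\<^sup>+p. (\<integral>\<^sup>+x. f x * ?I x * ?I (x - y + lat L (- p)) \<partial>lborel) \<partial>count_space UNIV)"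
  proof (rule nn_integral_cong)
    fix p
    have "(\<integral>\<^sup>+x. f x * ?I (x - y) * ?I (x + lat L p) \<partial>lborel)
       = (\<integral>\<^sup>+x. f (x + lat L p) * ?I (x + lat L p - y + lat L (- p)) * ?I (x + lat L p) \<partial>lborel)"
      using torus_periodic_lat[OF per] by (simp add: neg)
    also have "\<dots> = (\<integral>\<^sup>+x. f x * ?I (x - y + lat L (- p)) * ?I x \<partial>lborel)"
      using lborel_shift_nn[of "\<lambda>x. f x * ?I (x - y + lat L (- p)) * ?I x" "lat L p"] by simp
    finally show "(\<integral>\<^sup>+x. f x * ?I (x - y) * ?I (x + lat L p) \<partial>lborel)
       = (\<integral>\<^sup>+x. f x * ?I x * ?I (x - y + lat L (- p)) \<partial>lborel)" by (simp add: mult_ac)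
  qed
  also have "\<dots> = (\<integral>\<^sup>+p. (\<integral>\<^sup>+x. f x * ?I x * ?I (x - y + lat L p) \<partial>lborel) \<partial>count_space UNIV)"
    by (rule nn_integral_bij_count_space[where f="\<lambda>p. \<integral>\<^sup>+x. f x * ?I x * ?I (x - y + lat L p) \<partial>lborel"])
       (rule bij_uminus)
  also have "\<dots> = (\<integral>\<^sup>+x. (\<integral>\<^sup>+p. f x * ?I x * ?I (x - y + lat L p) \<partial>count_space UNIV) \<partial>lborel)"
    by (rule nn_integral_count_space_nn_integral[symmetric]) auto
  also have "\<dots> = (\<integral>\<^sup>+x. f x * ?I x \<partial>lborel)"
    by (subst nn_integral_cmult) (auto simp: cell_tiling[OF L])
  finally show ?thesis
    by (simp add: nn_integral_torus_cell[OF L])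
qed

definition wrap :: "real \<Rightarrow> plane \<Rightarrow> plane" where
  "wrap L x = x + lat L (- \<lfloor>x $ 1 / L\<rfloor>, - \<lfloor>x $ 2 / L\<rfloor>)"

lemma wrap_vec: "wrap L x = vector [x $ 1 - L * of_int \<lfloor>x $ 1 / L\<rfloor>, x $ 2 - L * of_int \<lfloor>x $ 2 / L\<rfloor>]"
  by (simp add: wrap_def vec_eq_iff forall_2)

lemma wrap_measurable [measurable]: "wrap L \<in> borel_measurable borel"
  unfolding wrap_vec[abs_def] by measurable

lemma wrap_periodic: "L > 0 \<Longrightarrow> torus_periodic L (wrap L)"
  by (simp add: torus_periodic_def wrap_vec forall_2 axis_def add_divide_distrib vec_eq_iff algebra_simps)

lemma torus_periodic_compose: "torus_periodic L f \<Longrightarrow> torus_periodic L (\<lambda>x. h (f x))"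
  by (simp add: torus_periodic_def)

lemma torus_periodic_wrap: "torus_periodic L f \<Longrightarrow> f (wrap L x) = f x"
  by (simp add: wrap_def torus_periodic_lat)

text \<open>A periodic function factors through its representative \<open>wrap L x\<close> in the
  cell. Once the law of that representative is known to be translation invariant, the shift rule for
  Banach-valued integrands follows by a change of variables, without decomposing them into
  nonnegative parts.\<close>

lemma distr_wrap_shift:
  assumes L: "L > 0"
  shows "distr (torus_measure L) borel (\<lambda>x. wrap L (x + y)) = distr (torus_measure L) borel (wrap L)"
proof (rule measure_eqI)
  fix A assume "A \<in> sets (distr (torus_measure L) borel (\<lambda>x. wrap L (x + y)))"
  then have [measurable]: "A \<in> sets borel" by simp
  have "(\<integral>\<^sup>+x. indicator A (wrap L (x + y)) \<partial>torus_measure L) = (\<integral>\<^sup>+x. indicator A (wrap L x) \<partial>torus_measure L)"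
    by (rule nn_integral_torus_shift[OF L _ torus_periodic_compose[OF wrap_periodic[OF L]]]) measurable
  then have "(\<integral>\<^sup>+x. indicator A x \<partial>distr (torus_measure L) borel (\<lambda>x. wrap L (x + y)))
      = (\<integral>\<^sup>+x. indicator A x \<partial>distr (torus_measure L) borel (wrap L))"
    by (subst (1 2) nn_integral_distr) auto
  then show "emeasure (distr (torus_measure L) borel (\<lambda>x. wrap L (x + y))) A
    = emeasure (distr (torus_measure L) borel (wrap L)) A"
    by simp
qed simp

lemma integral_torus_shift:
  fixes f :: "plane \<Rightarrow> 'b::{banach, second_countable_topology}"
  assumes L: "L > 0" and [measurable]: "f \<in> borel_measurable borel" and per: "torus_periodic L f"
  shows "(\<integral>x. f (x + y) \<partial>torus_measure L) = (\<integral>x. f x \<partial>torus_measure L)"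
proof -
  have "(\<integral>x. f (x + y) \<partial>torus_measure L) = (\<integral>x. f (wrap L (x + y)) \<partial>torus_measure L)"
    by (simp add: torus_periodic_wrap[OF per])
  also have "\<dots> = (\<integral>x. f x \<partial>distr (torus_measure L) borel (\<lambda>x. wrap L (x + y)))"
    by (subst integral_distr) auto
  also have "\<dots> = (\<integral>x. f (wrap L x) \<partial>torus_measure L)"
    unfolding distr_wrap_shift[OF L] by (subst integral_distr) auto
  finally show ?thesis by (simp add: torus_periodic_wrap[OF per])
qed

section \<open>Frequencies and characters of the torus\<close>

lemma freq_lattice_iff: "k \<in> freq_lattice L \<longleftrightarrow> (\<exists>m n :: int. k = (2 * pi / L) *\<^sub>R vector [of_int m, of_int n])"
  by (auto simp: freq_lattice_def forall_2 vec_eq_iff)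

definition freq :: "real \<Rightarrow> int \<Rightarrow> int \<Rightarrow> plane" where
  "freq L m n = (2 * pi / L) *\<^sub>R vector [of_int m, of_int n]"

lemma freq_nth [simp]: "freq L m n $ 1 = 2 * pi / L * m" "freq L m n $ 2 = 2 * pi / L * n"
  by (simp_all add: freq_def)

lemma freq_in [simp]: "freq L m n \<in> freq_lattice L"
  by (auto simp: freq_lattice_iff freq_def)

lemma freq_latticeE:
  assumes "k \<in> freq_lattice L" obtains m n where "k = freq L m n"
  using assms by (auto simp: freq_lattice_iff freq_def)

lemma freq_inj: "L \<noteq> 0 \<Longrightarrow> freq L m n = freq L m' n' \<longleftrightarrow> m = m' \<and> n = n'"
  by (auto simp: vec_eq_iff forall_2)

lemma freq_0: "L \<noteq> 0 \<Longrightarrow> freq L m n = 0 \<longleftrightarrow> m = 0 \<and> n = 0"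
  by (auto simp: vec_eq_iff forall_2)

lemma freq_add: "freq L m n + freq L m' n' = freq L (m + m') (n + n')"
  by (simp add: vec_eq_iff forall_2 algebra_simps add_divide_distrib)

lemma freq_minus: "- freq L m n = freq L (- m) (- n)"
  by (simp add: vec_eq_iff forall_2)

lemma freq_lattice_uminus [simp]: "- k \<in> freq_lattice L \<longleftrightarrow> k \<in> freq_lattice L"
  by (metis freq_latticeE freq_in freq_minus minus_minus)

lemma freq_lattice_add: "k \<in> freq_lattice L \<Longrightarrow> k' \<in> freq_lattice L \<Longrightarrow> k + k' \<in> freq_lattice L"
  by (metis freq_latticeE freq_in freq_add)

lemma freq_lattice_diff: "k \<in> freq_lattice L \<Longrightarrow> k' \<in> freq_lattice L \<Longrightarrow> k - k' \<in> freq_lattice L"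
  using freq_lattice_add[of k L "- k'"] by simp

lemma zero_freq_lattice [simp]: "0 \<in> freq_lattice L"
  by (auto simp: freq_lattice_def intro: exI[of _ 0])

lemma cis_measurable [measurable]: "(\<lambda>x::plane. cis (k \<bullet> x)) \<in> borel_measurable borel"
  by (intro borel_measurable_continuous_onI continuous_intros)

lemma cis_torus_periodic:
  assumes "k \<in> freq_lattice L" "L > 0"
  shows "torus_periodic L (\<lambda>x. cis (k \<bullet> x))"
proof -
  have "cis (k \<bullet> (x + L *\<^sub>R axis j 1)) = cis (k \<bullet> x)" for x and j :: 2
  proof -
    obtain m :: int where m: "k $ j = 2 * pi / L * m"
      using assms by (auto simp: freq_lattice_def)
    have "k \<bullet> (x + L *\<^sub>R axis j 1) = k \<bullet> x + 2 * pi * m"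
      using m assms by (simp add: inner_add_right inner_axis)
    then show ?thesis
      by (simp flip: cis_mult add: cis_multiple_2pi)
  qed
  then show ?thesis by (simp add: torus_periodic_def)
qed

text \<open>For \<open>k \<noteq> 0\<close> a translation by half a period in the direction of
  \<open>k\<close> changes the sign of the character, so its integral equals its own
  negative.\<close>

lemma integral_cis_torus:
  assumes "k \<in> freq_lattice L" "L > 0"
  shows "(\<integral>x. cis (k \<bullet> x) \<partial>torus_measure L) = (if k = 0 then 1 else 0)"
proof (cases "k = 0")
  case True
  interpret prob_space "torus_measure L" by (rule prob_space_torus_measure) fact
  show ?thesis using True prob_space by (simp add: measure_def)
next
  case False
  define y where "y = (pi / (norm k)\<^sup>2) *\<^sub>R k"
  have y: "k \<bullet> y = pi" using False by (simp add: y_def power2_norm_eq_inner)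
  have "(\<integral>x. cis (k \<bullet> x) \<partial>torus_measure L) = (\<integral>x. cis (k \<bullet> (x + y)) \<partial>torus_measure L)"
    by (rule integral_torus_shift[symmetric]) (use assms cis_torus_periodic in auto)
  also have "\<dots> = (\<integral>x. - cis (k \<bullet> x) \<partial>torus_measure L)"
    by (simp add: inner_add_right y flip: cis_mult)
  also have "\<dots> = - (\<integral>x. cis (k \<bullet> x) \<partial>torus_measure L)" by simp
  finally show ?thesis using False by simp
qed

subsection \<open>Cubic norms\<close>

lemma amgm3_real:
  fixes x y z :: real
  assumes "x \<ge> 0" "y \<ge> 0" "z \<ge> 0"
  shows "3 * (x * y * z) \<le> x ^ 3 + y ^ 3 + z ^ 3"
proof -
  have "x ^ 3 + y ^ 3 + z ^ 3 - 3 * (x * y * z) = (x + y + z) * ((x - y)\<^sup>2 + (y - z)\<^sup>2 + (z - x)\<^sup>2) / 2"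
    by (simp add: power2_eq_square power3_eq_cube algebra_simps)
  also have "\<dots> \<ge> 0" using assms by simp
  finally show ?thesis by simp
qed

lemma amgm3_ennreal:
  fixes x y z :: ennreal
  shows "3 * (x * y * z) \<le> x ^ 3 + y ^ 3 + z ^ 3"
proof (cases "x = top \<or> y = top \<or> z = top")
  case True then show ?thesis by (auto simp: power3_eq_cube ennreal_mult_top ennreal_top_mult top_unique)
next
  case False
  then obtain a b c where *: "x = ennreal a" "y = ennreal b" "z = ennreal c" "a \<ge> 0" "b \<ge> 0" "c \<ge> 0"
    by (metis ennreal_cases)
  have "ennreal (3 * (a * b * c)) \<le> ennreal (a ^ 3 + b ^ 3 + c ^ 3)"
    using amgm3_real[of a b c] * by (intro ennreal_leI) auto
  then show ?thesis using * by (simp add: ennreal_mult ennreal_power)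
qed

text \<open>After division by the bounds the inequality is the pointwise one of
  \<open>amgm3_ennreal\<close>, integrated. The bounds \<open>a\<close>, \<open>b\<close>,
  \<open>c\<close> stand for cubic norms and are given through their cubes, so no root is taken. The
  values 0 and \<open>top\<close> are treated apart because they do not allow the division.\<close>

lemma hoelder3_ennreal:
  fixes f g h :: "'a \<Rightarrow> ennreal"
  assumes [measurable]: "f \<in> borel_measurable M" "g \<in> borel_measurable M" "h \<in> borel_measurable M"
    and f: "(\<integral>\<^sup>+x. f x ^ 3 \<partial>M) \<le> a ^ 3" and g: "(\<integral>\<^sup>+x. g x ^ 3 \<partial>M) \<le> b ^ 3"
    and h: "(\<integral>\<^sup>+x. h x ^ 3 \<partial>M) \<le> c ^ 3"
  shows "(\<integral>\<^sup>+x. f x * g x * h x \<partial>M) \<le> a * b * c"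
proof -
  have zero: "(\<integral>\<^sup>+x. f x * g x * h x \<partial>M) = 0"
    if "u \<in> borel_measurable M" "(\<integral>\<^sup>+x. u x ^ 3 \<partial>M) \<le> 0 ^ 3" "\<And>x. u x = 0 \<Longrightarrow> f x * g x * h x = 0"
    for u :: "'a \<Rightarrow> ennreal"
  proof -
    have "AE x in M. u x ^ 3 = 0"
      using that by (subst (asm) power3_eq_cube) (auto simp: nn_integral_0_iff_AE)
    then have "AE x in M. f x * g x * h x = 0"
      by eventually_elim (use that(3) in auto)
    then show ?thesis by (simp add: nn_integral_0_iff_AE)
  qed
  consider "a = 0 \<or> b = 0 \<or> c = 0" | "a \<noteq> 0" "b \<noteq> 0" "c \<noteq> 0" "a = top \<or> b = top \<or> c = top"
    | "a \<noteq> 0" "b \<noteq> 0" "c \<noteq> 0" "a \<noteq> top" "b \<noteq> top" "c \<noteq> top" by blast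
  then show ?thesis
  proof cases
    case 1
    then show ?thesis using zero[of f] zero[of g] zero[of h] f g h by auto
  next
    case 2
    then have "a * b * c = top" by (auto simp: ennreal_mult_top ennreal_top_mult)
    then show ?thesis by simp
  next
    case 3
    have inv: "u / p * p = u" if "p \<noteq> 0" "p \<noteq> top" for u p :: ennreal
      using that by (simp add: ennreal_divide_times ennreal_divide_self less_top)
    have scale: "(\<integral>\<^sup>+x. (u x / p) ^ 3 \<partial>M) \<le> 1"
      if [measurable]: "u \<in> borel_measurable M" and "(\<integral>\<^sup>+x. u x ^ 3 \<partial>M) \<le> p ^ 3" "p \<noteq> 0" "p \<noteq> top"
      for u :: "'a \<Rightarrow> ennreal" and p
    proof -
      have "(\<integral>\<^sup>+x. (u x / p) ^ 3 \<partial>M) = (\<integral>\<^sup>+x. u x ^ 3 * (inverse p) ^ 3 \<partial>M)"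
        by (simp add: divide_ennreal_def power_mult_distrib)
      also have "\<dots> = (\<integral>\<^sup>+x. u x ^ 3 \<partial>M) * inverse p ^ 3"
        by (rule nn_integral_multc) measurable
      also have "\<dots> \<le> p ^ 3 * inverse p ^ 3"
        by (intro mult_right_mono that) auto
      also have "\<dots> = (p * inverse p) ^ 3" by (simp add: power_mult_distrib)
      also have "p * inverse p = 1" using that
        by (simp add: ennreal_divide_self less_top flip: divide_ennreal_def)
      finally show ?thesis by simp
    qed
    have "3 * (\<integral>\<^sup>+x. (f x / a) * (g x / b) * (h x / c) \<partial>M)
        = (\<integral>\<^sup>+x. 3 * ((f x / a) * (g x / b) * (h x / c)) \<partial>M)"
      by (rule nn_integral_cmult[symmetric]) measurable
    also have "\<dots> \<le> (\<integral>\<^sup>+x. (f x / a) ^ 3 + (g x / b) ^ 3 + (h x / c) ^ 3 \<partial>M)"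
      by (intro nn_integral_mono amgm3_ennreal)
    also have "\<dots> = (\<integral>\<^sup>+x. (f x / a) ^ 3 \<partial>M) + (\<integral>\<^sup>+x. (g x / b) ^ 3 \<partial>M) + (\<integral>\<^sup>+x. (h x / c) ^ 3 \<partial>M)"
      by (simp add: nn_integral_add)
    also have "\<dots> \<le> 1 + 1 + 1"
      using 3 f g h by (intro add_mono scale) auto
    finally have "3 * (\<integral>\<^sup>+x. (f x / a) * (g x / b) * (h x / c) \<partial>M) \<le> 3 * 1" by simp
    then have le1: "(\<integral>\<^sup>+x. (f x / a) * (g x / b) * (h x / c) \<partial>M) \<le> 1"
      by (subst (asm) ennreal_mult_le_mult_iff) auto
    have "(\<integral>\<^sup>+x. f x * g x * h x \<partial>M) = (\<integral>\<^sup>+x. (a * b * c) * ((f x / a) * (g x / b) * (h x / c)) \<partial>M)"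
    proof (intro nn_integral_cong)
      fix x
      have "f x * g x * h x = (f x / a * a) * (g x / b * b) * (h x / c * c)"
        using 3 by (simp add: inv)
      then show "f x * g x * h x = (a * b * c) * ((f x / a) * (g x / b) * (h x / c))"
        by (simp add: mult_ac)
    qed
    also have "\<dots> = (a * b * c) * (\<integral>\<^sup>+x. (f x / a) * (g x / b) * (h x / c) \<partial>M)"
      by (rule nn_integral_cmult) measurable
    also have "\<dots> \<le> (a * b * c) * 1" by (intro mult_left_mono le1) auto
    finally show ?thesis by simp
  qed
qed

text \<open>The exponent is an integer, so the cube of the inner integral is a triple integral over
  \<open>w1\<close>, \<open>w2\<close>, \<open>w3\<close>. Fubini moves the integral over
  \<open>x\<close> to the innermost place, where Hoelder's inequality gives
  \<open>b w1 * b w2 * b w3\<close>.\<close>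

lemma minkowski3_ennreal:
  fixes F :: "'a \<Rightarrow> 'b \<Rightarrow> ennreal"
  assumes "sigma_finite_measure M" "sigma_finite_measure N"
    and F [measurable]: "(\<lambda>(x, w). F x w) \<in> borel_measurable (M \<Otimes>\<^sub>M N)"
    and [measurable]: "b \<in> borel_measurable N"
    and le: "\<And>w. w \<in> space N \<Longrightarrow> (\<integral>\<^sup>+x. F x w ^ 3 \<partial>M) \<le> b w ^ 3"
  shows "(\<integral>\<^sup>+x. (\<integral>\<^sup>+w. F x w \<partial>N) ^ 3 \<partial>M) \<le> (\<integral>\<^sup>+w. b w \<partial>N) ^ 3"
proof -
  interpret M: sigma_finite_measure M by fact
  interpret N: sigma_finite_measure N by fact
  interpret MN: pair_sigma_finite M N ..
  have F1 [measurable]: "(\<lambda>x. F x w) \<in> borel_measurable M" if "w \<in> space N" for w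
    using measurable_compose[OF measurable_Pair[OF measurable_id measurable_const[OF that]] F] by simp
  have F2: "(\<lambda>w. F x w) \<in> borel_measurable N" if "x \<in> space M" for x
    using measurable_compose[OF measurable_Pair[OF measurable_const[OF that] measurable_id] F] by simp
  define G where "G x = (\<integral>\<^sup>+w. F x w \<partial>N)" for x
  have G [measurable]: "G \<in> borel_measurable M"
    unfolding G_def by (intro N.borel_measurable_nn_integral) (use F in simp)
  have fub: "(\<integral>\<^sup>+x. H x * G x \<partial>M) = (\<integral>\<^sup>+w. (\<integral>\<^sup>+x. H x * F x w \<partial>M) \<partial>N)"
    if [measurable]: "H \<in> borel_measurable M" for H :: "'a \<Rightarrow> ennreal"
  proof -
    have "(\<integral>\<^sup>+x. H x * G x \<partial>M) = (\<integral>\<^sup>+x. (\<integral>\<^sup>+w. H x * F x w \<partial>N) \<partial>M)"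
      unfolding G_def by (intro nn_integral_cong) (simp add: nn_integral_cmult F2)
    also have "\<dots> = (\<integral>\<^sup>+w. (\<integral>\<^sup>+x. H x * F x w \<partial>M) \<partial>N)"
    proof (rule MN.Fubini'[symmetric])
      have "(\<lambda>p. H (fst p) * (case p of (x, w) \<Rightarrow> F x w)) \<in> borel_measurable (M \<Otimes>\<^sub>M N)"
        by (intro borel_measurable_times_ennreal measurable_compose[OF measurable_fst that] F)
      then show "(\<lambda>(x, w). H x * F x w) \<in> borel_measurable (M \<Otimes>\<^sub>M N)"
        by (simp add: case_prod_unfold)
    qed
    finally show ?thesis .
  qed
  have "(\<integral>\<^sup>+x. G x ^ 3 \<partial>M) = (\<integral>\<^sup>+x. G x * G x * G x \<partial>M)" by (simp add: power3_eq_cube)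
  also have "\<dots> = (\<integral>\<^sup>+w1. (\<integral>\<^sup>+x. (G x * G x) * F x w1 \<partial>M) \<partial>N)"
    by (intro fub) measurable
  also have "\<dots> \<le> (\<integral>\<^sup>+w1. b w1 * (\<integral>\<^sup>+w. b w \<partial>N) * (\<integral>\<^sup>+w. b w \<partial>N) \<partial>N)"
  proof (rule nn_integral_mono)
    fix w1 assume w1: "w1 \<in> space N"
    note F1[OF w1, measurable]
    have "(\<integral>\<^sup>+x. (G x * G x) * F x w1 \<partial>M) = (\<integral>\<^sup>+x. (F x w1 * G x) * G x \<partial>M)"
      by (simp add: mult_ac)
    also have "\<dots> = (\<integral>\<^sup>+w2. (\<integral>\<^sup>+x. (F x w1 * G x) * F x w2 \<partial>M) \<partial>N)"
      by (intro fub) measurable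
    also have "\<dots> \<le> (\<integral>\<^sup>+w2. b w2 * (b w1 * (\<integral>\<^sup>+w. b w \<partial>N)) \<partial>N)"
    proof (rule nn_integral_mono)
      fix w2 assume w2: "w2 \<in> space N"
      note F1[OF w2, measurable]
      have "(\<integral>\<^sup>+x. (F x w1 * G x) * F x w2 \<partial>M) = (\<integral>\<^sup>+x. (F x w1 * F x w2) * G x \<partial>M)"
        by (simp add: mult_ac)
      also have "\<dots> = (\<integral>\<^sup>+w3. (\<integral>\<^sup>+x. (F x w1 * F x w2) * F x w3 \<partial>M) \<partial>N)"
        by (intro fub) measurable
      also have "\<dots> \<le> (\<integral>\<^sup>+w3. b w1 * b w2 * b w3 \<partial>N)"
        by (intro nn_integral_mono hoelder3_ennreal le F1 w1 w2)
      also have "\<dots> = b w1 * b w2 * (\<integral>\<^sup>+w. b w \<partial>N)"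
        by (rule nn_integral_cmult) measurable
      finally show "(\<integral>\<^sup>+x. (F x w1 * G x) * F x w2 \<partial>M) \<le> b w2 * (b w1 * (\<integral>\<^sup>+w. b w \<partial>N))"
        by (simp add: mult_ac)
    qed
    also have "\<dots> = (\<integral>\<^sup>+w. b w \<partial>N) * (b w1 * (\<integral>\<^sup>+w. b w \<partial>N))"
      by (rule nn_integral_multc) measurable
    finally show "(\<integral>\<^sup>+x. (G x * G x) * F x w1 \<partial>M) \<le> b w1 * (\<integral>\<^sup>+w. b w \<partial>N) * (\<integral>\<^sup>+w. b w \<partial>N)"
      by (simp add: mult_ac)
  qed
  also have "\<dots> = (\<integral>\<^sup>+w. b w \<partial>N) * (\<integral>\<^sup>+w. b w \<partial>N) * (\<integral>\<^sup>+w. b w \<partial>N)"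
    by (subst nn_integral_multc, measurable, subst nn_integral_multc, measurable)
  finally show ?thesis by (simp add: G_def power3_eq_cube)
qed

section \<open>Trigonometric polynomials and bounds on their cubic norms\<close>

definition trig :: "plane set \<Rightarrow> (plane \<Rightarrow> complex) \<Rightarrow> plane \<Rightarrow> complex" where
  "trig F c x = (\<Sum>k\<in>F. c k * cis (k \<bullet> x))"

text \<open>The number \<open>b\<close> bounds the cubic norm with respect to normalised measure. A
  relation in place of a norm keeps cube roots out of the estimates, and \<open>b = top\<close> is
  always admissible.\<close>

definition le3 :: "real \<Rightarrow> (plane \<Rightarrow> complex) \<Rightarrow> ennreal \<Rightarrow> bool" where
  "le3 L f b \<longleftrightarrow> (\<integral>\<^sup>+x. ennreal (norm (f x)) ^ 3 \<partial>torus_measure L) \<le> b ^ 3"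

lemma trig_measurable [measurable]: "trig F c \<in> borel_measurable borel"
  unfolding trig_def[abs_def] by measurable

lemma trig_bound: "norm (trig F c x) \<le> (\<Sum>k\<in>F. norm (c k))"
  unfolding trig_def by (rule order_trans[OF norm_sum]) (simp add: norm_mult)

lemma torus_periodic_sum: "(\<And>i. i \<in> I \<Longrightarrow> torus_periodic L (f i)) \<Longrightarrow> torus_periodic L (\<lambda>x. \<Sum>i\<in>I. f i x)"
  by (simp add: torus_periodic_def)

lemma torus_periodic_mult:
  "torus_periodic L f \<Longrightarrow> torus_periodic L g \<Longrightarrow> torus_periodic L (\<lambda>x. f x * g x :: 'a::times)"
  by (simp add: torus_periodic_def)

lemma torus_periodic_shift:
  assumes "torus_periodic L f" shows "torus_periodic L (\<lambda>x. f (x + y))"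
  unfolding torus_periodic_def
proof (intro allI)
  fix x and j :: 2
  have "f (x + L *\<^sub>R axis j 1 + y) = f ((x + y) + L *\<^sub>R axis j 1)" by (simp add: algebra_simps)
  then show "f (x + L *\<^sub>R axis j 1 + y) = f (x + y)" using assms by (simp add: torus_periodic_def)
qed

lemma trig_periodic:
  assumes "F \<subseteq> freq_lattice L" "L > 0"
  shows "torus_periodic L (trig F c)"
  unfolding trig_def[abs_def]
  by (intro torus_periodic_sum torus_periodic_mult cis_torus_periodic)
     (use assms in \<open>auto simp: torus_periodic_def\<close>)

lemma trig_shift: "trig F c (x + y) = trig F (\<lambda>k. c k * cis (k \<bullet> y)) x"
  unfolding trig_def by (simp add: inner_add_right mult_ac flip: cis_mult)

lemma trig_add: "trig F c x + trig F d x = trig F (\<lambda>k. c k + d k) x"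
  by (simp add: trig_def sum.distrib algebra_simps)

lemma trig_diff: "trig F c x - trig F d x = trig F (\<lambda>k. c k - d k) x"
  by (simp add: trig_def sum_subtractf algebra_simps)

lemma trig_cmult: "a * trig F c x = trig F (\<lambda>k. a * c k) x"
  by (simp add: trig_def sum_distrib_left mult_ac)

lemma integrable_trig [simp]:
  assumes "L > 0" shows "integrable (torus_measure L) (trig F c)"
proof -
  interpret prob_space "torus_measure L" by (rule prob_space_torus_measure) fact
  show ?thesis
    by (rule integrable_const_bound[where B="\<Sum>k\<in>F. norm (c k)"]) (auto intro: trig_bound)
qed

lemma le3_mono: "le3 L f b \<Longrightarrow> b \<le> b' \<Longrightarrow> le3 L f b'"
  unfolding le3_def by (meson order_trans power_mono zero_le)

lemma le3_shift:
  assumes "L > 0" "f \<in> borel_measurable borel" "torus_periodic L f" "le3 L f b"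
  shows "le3 L (\<lambda>x. f (x + y)) b"
  using assms unfolding le3_def
  by (subst nn_integral_torus_shift[where f="\<lambda>x. ennreal (norm (f x)) ^ 3"])
     (auto intro: torus_periodic_compose)

lemma le3_cmult:
  assumes "f \<in> borel_measurable borel" "le3 L f b"
  shows "le3 L (\<lambda>x. a * f x) (ennreal (norm a) * b)"
proof -
  have "(\<integral>\<^sup>+x. ennreal (norm (a * f x)) ^ 3 \<partial>torus_measure L)
      = (\<integral>\<^sup>+x. ennreal (norm a) ^ 3 * ennreal (norm (f x)) ^ 3 \<partial>torus_measure L)"
    by (simp add: norm_mult ennreal_mult power_mult_distrib)
  also have "\<dots> = ennreal (norm a) ^ 3 * (\<integral>\<^sup>+x. ennreal (norm (f x)) ^ 3 \<partial>torus_measure L)"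
    using assms by (intro nn_integral_cmult) measurable
  also have "\<dots> \<le> ennreal (norm a) ^ 3 * b ^ 3"
    using assms by (intro mult_left_mono) (auto simp: le3_def)
  finally show ?thesis by (simp add: le3_def power_mult_distrib)
qed

lemma sigma_finite_torus: "L > 0 \<Longrightarrow> sigma_finite_measure (torus_measure L)"
  using prob_space_torus_measure prob_space_imp_sigma_finite by blast

text \<open>The function \<open>h\<close> is only compared pointwise with an integral of norms; in
  this form one statement covers finite sums, convolutions and superpositions over scales.\<close>

lemma le3_minkowski:
  assumes "L > 0" "sigma_finite_measure N"
    and [measurable]: "(\<lambda>(x, w). G x w) \<in> borel_measurable (torus_measure L \<Otimes>\<^sub>M N)"
    and "b \<in> borel_measurable N"
    and "\<And>x. ennreal (norm (h x)) \<le> (\<integral>\<^sup>+w. ennreal (norm (G x w)) \<partial>N)"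
    and "\<And>w. w \<in> space N \<Longrightarrow> le3 L (\<lambda>x. G x w) (b w)"
  shows "le3 L h (\<integral>\<^sup>+w. b w \<partial>N)"
proof -
  have "(\<lambda>p. ennreal (norm (case p of (x, w) \<Rightarrow> G x w))) \<in> borel_measurable (torus_measure L \<Otimes>\<^sub>M N)"
    by measurable
  then have m: "(\<lambda>(x, w). ennreal (norm (G x w))) \<in> borel_measurable (torus_measure L \<Otimes>\<^sub>M N)"
    by (simp add: case_prod_unfold)
  have "(\<integral>\<^sup>+x. ennreal (norm (h x)) ^ 3 \<partial>torus_measure L)
      \<le> (\<integral>\<^sup>+x. (\<integral>\<^sup>+w. ennreal (norm (G x w)) \<partial>N) ^ 3 \<partial>torus_measure L)"
    by (intro nn_integral_mono power_mono assms) auto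
  also have "\<dots> \<le> (\<integral>\<^sup>+w. b w \<partial>N) ^ 3"
    by (intro minkowski3_ennreal sigma_finite_torus assms m) (use assms in \<open>simp add: le3_def\<close>)
  finally show ?thesis by (simp add: le3_def)
qed

lemma le3_add:
  assumes "L > 0" and [measurable]: "f \<in> borel_measurable borel" "g \<in> borel_measurable borel"
    and "le3 L f a" "le3 L g b"
  shows "le3 L (\<lambda>x. f x + g x) (a + b)"
proof -
  \<comment> \<open>The triangle inequality is Minkowski's inequality over a two-point index
    set.\<close>
  have "le3 L (\<lambda>x. f x + g x) (\<integral>\<^sup>+w. (if w then a else b) \<partial>count_space UNIV)"
  proof (rule le3_minkowski[where G="\<lambda>x w. if w then f x else g x"])
    show "sigma_finite_measure (count_space (UNIV :: bool set))"
      by (rule sigma_finite_measure_count_space_finite) simp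
    show "(\<lambda>(x, w). if w then f x else g x) \<in> borel_measurable (torus_measure L \<Otimes>\<^sub>M count_space UNIV)"
      unfolding case_prod_unfold by measurable
    show "ennreal (norm (f x + g x)) \<le> (\<integral>\<^sup>+ w. ennreal (norm (if w then f x else g x)) \<partial>count_space UNIV)" for x
      by (subst nn_integral_count_space_finite)
         (auto simp: UNIV_bool norm_triangle_ineq add.commute simp flip: ennreal_plus intro!: ennreal_leI)
  qed (use assms in \<open>auto\<close>)
  then show ?thesis
    by (subst (asm) nn_integral_count_space_finite) (auto simp: UNIV_bool add.commute)
qed

lemma le3_sum:
  assumes "L > 0" "finite I" "\<And>i. i \<in> I \<Longrightarrow> f i \<in> borel_measurable borel" "\<And>i. i \<in> I \<Longrightarrow> le3 L (f i) (b i)"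
  shows "le3 L (\<lambda>x. \<Sum>i\<in>I. f i x) (\<Sum>i\<in>I. b i)"
  using assms(2-)
proof (induction I rule: finite_induct)
  case empty then show ?case by (simp add: le3_def)
next
  case (insert i I)
  then show ?case using le3_add[OF \<open>L > 0\<close>, of "f i" "\<lambda>x. \<Sum>i\<in>I. f i x"] by simp
qed

lemma le3_hoelder:
  assumes [measurable]: "f \<in> borel_measurable borel" "g \<in> borel_measurable borel" "h \<in> borel_measurable borel"
    and "le3 L f a" "le3 L g b" "le3 L h c"
  shows "(\<integral>\<^sup>+x. ennreal (norm (f x * g x * h x)) \<partial>torus_measure L) \<le> a * b * c"
proof -
  have "(\<integral>\<^sup>+x. ennreal (norm (f x)) * ennreal (norm (g x)) * ennreal (norm (h x)) \<partial>torus_measure L) \<le> a * b * c"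
    using assms(4-) by (intro hoelder3_ennreal) (auto simp: le3_def)
  then show ?thesis by (simp add: norm_mult ennreal_mult)
qed

text \<open>This covers integrands that are not integrable as well, because the Bochner integral is
  then 0.\<close>

lemma norm_integral_le_nn:
  fixes f :: "'a \<Rightarrow> 'b::{banach, second_countable_topology}"
  shows "ennreal (norm (integral\<^sup>L M f)) \<le> (\<integral>\<^sup>+x. ennreal (norm (f x)) \<partial>M)"
  by (cases "integrable M f") (simp_all add: integral_norm_bound_ennreal not_integrable_integral_eq)

text \<open>A multiplier that is on \<open>F\<close> a superposition of characters
  \<open>cis (k \<bullet> \<zeta> w)\<close> acts as an average of translations by
  \<open>\<zeta> w\<close>. Translations preserve the cubic norm, so the cost is at most the total
  mass of the weight, whatever the side \<open>L\<close>.\<close>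

lemma le3_convolution:
  fixes wt :: "'w \<Rightarrow> complex"
  assumes L: "L > 0" and F: "F \<subseteq> freq_lattice L" and N: "sigma_finite_measure N"
    and wt: "integrable N wt" and z [measurable]: "\<zeta> \<in> borel_measurable N"
    and m: "\<And>k. k \<in> F \<Longrightarrow> m k = (\<integral>w. wt w * cis (k \<bullet> \<zeta> w) \<partial>N)"
    and le: "le3 L (trig F c) b"
  shows "le3 L (trig F (\<lambda>k. c k * m k)) ((\<integral>\<^sup>+w. ennreal (norm (wt w)) \<partial>N) * b)"
    and "trig F (\<lambda>k. c k * m k) x = (\<integral>w. wt w * trig F c (x + \<zeta> w) \<partial>N)"
proof -
  have [measurable]: "wt \<in> borel_measurable N" using wt by auto
  have int: "integrable N (\<lambda>w. wt w * cis (k \<bullet> \<zeta> w))" for k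
    by (rule Bochner_Integration.integrable_bound[OF wt]) (auto simp: norm_mult)
  show eq: "trig F (\<lambda>k. c k * m k) x = (\<integral>w. wt w * trig F c (x + \<zeta> w) \<partial>N)" for x
  proof -
    have "(\<integral>w. wt w * trig F c (x + \<zeta> w) \<partial>N)
        = (\<integral>w. (\<Sum>k\<in>F. (c k * cis (k \<bullet> x)) * (wt w * cis (k \<bullet> \<zeta> w))) \<partial>N)"
      unfolding trig_def sum_distrib_left
      by (intro Bochner_Integration.integral_cong refl sum.cong)
         (simp add: inner_add_right mult_ac flip: cis_mult)
    also have "\<dots> = (\<Sum>k\<in>F. (c k * cis (k \<bullet> x)) * (\<integral>w. wt w * cis (k \<bullet> \<zeta> w) \<partial>N))"
      by (subst Bochner_Integration.integral_sum) (use int in auto)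
    also have "\<dots> = trig F (\<lambda>k. c k * m k) x"
      unfolding trig_def by (intro sum.cong refl) (simp add: m mult_ac)
    finally show ?thesis by simp
  qed
  have "le3 L (trig F (\<lambda>k. c k * m k)) (\<integral>\<^sup>+w. ennreal (norm (wt w)) * b \<partial>N)"
  proof (rule le3_minkowski[OF L N, where G="\<lambda>x w. wt w * trig F c (x + \<zeta> w)"])
    show "(\<lambda>(x, w). wt w * trig F c (x + \<zeta> w)) \<in> borel_measurable (torus_measure L \<Otimes>\<^sub>M N)"
      unfolding case_prod_unfold by measurable
    show "ennreal (norm (trig F (\<lambda>k. c k * m k) x)) \<le> (\<integral>\<^sup>+ w. ennreal (norm (wt w * trig F c (x + \<zeta> w))) \<partial>N)" for x
      unfolding eq by (rule norm_integral_le_nn)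
    show "le3 L (\<lambda>x. wt w * trig F c (x + \<zeta> w)) (ennreal (norm (wt w)) * b)" for w
      by (intro le3_cmult le3_shift L le trig_periodic F) measurable
  qed measurable
  then show "le3 L (trig F (\<lambda>k. c k * m k)) ((\<integral>\<^sup>+w. ennreal (norm (wt w)) \<partial>N) * b)"
    by (subst (asm) nn_integral_multc) auto
qed

subsection \<open>Gaussian averages\<close>

abbreviation "gauss \<equiv> density lborel std_normal_density"

definition gauss2 :: "(real \<times> real) measure" where "gauss2 = gauss \<Otimes>\<^sub>M gauss"

definition pt :: "real \<times> real \<Rightarrow> plane" where "pt w = vector [fst w, snd w]"

lemma pt_nth [simp]: "pt w $ 1 = fst w" "pt w $ 2 = snd w" by (simp_all add: pt_def)

lemma prob_space_gauss: "prob_space gauss"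
  using real_dist_normal_dist by (simp add: real_distribution_def)

interpretation gauss: prob_space gauss by (rule prob_space_gauss)
interpretation gauss_pair: pair_prob_space gauss gauss ..

lemma prob_space_gauss2: "prob_space gauss2"
  unfolding gauss2_def by (rule gauss_pair.prob_space_axioms)

lemma sets_gauss2 [simp, measurable_cong]: "sets gauss2 = sets borel"
  unfolding gauss2_def by (simp add: borel_prod[symmetric] cong: sets_pair_measure_cong)

lemma pt_measurable [measurable]: "pt \<in> borel_measurable borel"
  unfolding pt_def[abs_def] by (simp add: borel_prod[symmetric])

lemma gauss_char: "(\<integral>a. cis (u * a) \<partial>gauss) = of_real (exp (- u\<^sup>2 / 2))"
  using char_std_normal_distribution unfolding char_def fun_eq_iff by (simp add: cis_conv_exp)

lemma gauss_abs: "(\<integral>\<^sup>+a. ennreal \<bar>a\<bar> \<partial>gauss) \<le> 1" 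
  and integrable_gauss_id: "integrable gauss (\<lambda>a. a)"
  and integrable_gauss_sq: "integrable gauss (\<lambda>a. a\<^sup>2)"
  and gauss_sq: "(\<integral>\<^sup>+a. ennreal (a\<^sup>2) \<partial>gauss) = 1"
proof -
  show i: "integrable gauss (\<lambda>a. a)" using integrable_std_normal_distribution_moment[of 1] by simp
  show i2: "integrable gauss (\<lambda>a. a\<^sup>2)" using integrable_std_normal_distribution_moment[of 2] by simp
  have "(\<integral>a. \<bar>a\<bar> \<partial>gauss) = sqrt (2 / pi)" using std_normal_distribution_odd_moments_abs[of 0] by simp
  also have "\<dots> \<le> 1" using pi_gt3 by simp
  finally show "(\<integral>\<^sup>+a. ennreal \<bar>a\<bar> \<partial>gauss) \<le> 1"
    using i by (subst nn_integral_eq_integral) auto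
  have "(\<integral>a. a\<^sup>2 \<partial>gauss) = 1" using std_normal_distribution_even_moments(1)[of 1] by simp
  then show "(\<integral>\<^sup>+a. ennreal (a\<^sup>2) \<partial>gauss) = 1"
    using i2 by (subst nn_integral_eq_integral) auto
qed

text \<open>The weighted integral is, up to the factor \<open>\<i>\<close>, the derivative of the
  characteristic function. Differentiation under the integral is carried out by hand and compared
  with the derivative of \<open>exp (- u^2 / 2)\<close>.\<close>

lemma gauss_char_weight: "(\<integral>a. of_real a * cis (u * a) \<partial>gauss) = \<i> * of_real (u * exp (- u\<^sup>2 / 2))"
proof -
  let ?E = "\<lambda>u. (\<integral>a. cis (u * a) \<partial>gauss)"
  let ?W = "(\<integral>a. of_real a * cis (u * a) \<partial>gauss)"
  have intc: "integrable gauss (\<lambda>a. cis (v * a))" for v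
    by (rule gauss.integrable_const_bound[where B=1]) (auto intro!: borel_measurable_continuous_onI continuous_intros)
  have intw: "integrable gauss (\<lambda>a. complex_of_real a * cis (u * a))"
    by (rule Bochner_Integration.integrable_bound[OF integrable_gauss_id])
       (auto simp: norm_mult intro!: borel_measurable_continuous_onI continuous_intros)
  \<comment> \<open>The second-order remainder of the exponential is at most
    \<open>(h * a)^2\<close>, and the second moment of the Gaussian is 1; a remainder quadratic in
    \<open>h\<close> is what differentiability needs.\<close>
  have bound: "norm (?E (u + h) - ?E u - h *\<^sub>R (\<i> * ?W)) \<le> h\<^sup>2" for h
  proof -
    have "?E (u + h) - ?E u - h *\<^sub>R (\<i> * ?W)
        = (\<integral>a. cis ((u + h) * a) - cis (u * a) - (h * \<i>) * (of_real a * cis (u * a)) \<partial>gauss)"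
      using intc intw by (simp add: scaleR_conv_of_real mult.assoc)
    also have "norm \<dots> \<le> (\<integral>a. h\<^sup>2 * a\<^sup>2 \<partial>gauss)"
    proof (rule order_trans[OF integral_norm_bound], rule integral_mono, rule integrable_norm)
      show "integrable gauss (\<lambda>a. cis ((u + h) * a) - cis (u * a) - (h * \<i>) * (of_real a * cis (u * a)))"
        using intc intw by auto
      show "integrable gauss (\<lambda>a. h\<^sup>2 * a\<^sup>2)" using integrable_gauss_sq by simp
      fix a
      have eq: "cis ((u + h) * a) - cis (u * a) - (h * \<i>) * (of_real a * cis (u * a))
          = cis (u * a) * (cis (h * a) - (1 + \<i> * of_real (h * a)))"
        by (simp add: algebra_simps flip: cis_mult)
      have "cmod (cis (h * a) - (1 + \<i> * of_real (h * a))) \<le> \<bar>h * a\<bar> ^ 2 / 2"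
        using iexp_approx1[of "h * a" 1] by (simp add: cis_conv_exp numeral_2_eq_2)
      also have "\<dots> \<le> h\<^sup>2 * a\<^sup>2" by (simp add: power_mult_distrib)
      finally show "norm (cis ((u + h) * a) - cis (u * a) - (h * \<i>) * (of_real a * cis (u * a))) \<le> h\<^sup>2 * a\<^sup>2"
        unfolding eq by (simp add: norm_mult)
    qed
    also have "\<dots> = h\<^sup>2"
      using std_normal_distribution_even_moments(1)[of 1] by simp
    finally show ?thesis .
  qed
  have "((\<lambda>h. norm (?E (u + h) - ?E u - h *\<^sub>R (\<i> * ?W)) / norm h) \<longlongrightarrow> 0) (at 0)"
  proof (rule Lim_null_comparison)
    show "\<forall>\<^sub>F h in at 0. norm (norm (?E (u + h) - ?E u - h *\<^sub>R (\<i> * ?W)) / norm h) \<le> norm h"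
    proof (intro always_eventually allI)
      fix h :: real
      have "norm (?E (u + h) - ?E u - h *\<^sub>R (\<i> * ?W)) / norm h \<le> h\<^sup>2 / norm h"
        by (intro divide_right_mono bound) simp
      also have "\<dots> = norm h" by (simp add: power2_eq_square abs_if)
      finally show "norm (norm (?E (u + h) - ?E u - h *\<^sub>R (\<i> * ?W)) / norm h) \<le> norm h"
        unfolding real_norm_def[of "norm _ / _"] by simp
    qed
    show "((\<lambda>h::real. norm h) \<longlongrightarrow> 0) (at 0)"
      using tendsto_norm_zero[OF tendsto_ident_at[of "0::real" UNIV]] .
  qed
  then have "(?E has_vector_derivative \<i> * ?W) (at u)"
    unfolding has_vector_derivative_def has_derivative_at
    by (intro conjI bounded_linear_scaleR_left)
  moreover have "(?E has_vector_derivative of_real (- u * exp (- u\<^sup>2 / 2))) (at u)"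
    unfolding gauss_char[abs_def]
    by (intro has_vector_derivative_of_real has_real_derivative_iff_has_vector_derivative[THEN iffD1])
       (auto intro!: derivative_eq_intros)
  ultimately have "\<i> * ?W = of_real (- u * exp (- u\<^sup>2 / 2))"
    by (rule vector_derivative_unique_at)
  then have "\<i> * (\<i> * ?W) = \<i> * of_real (- u * exp (- u\<^sup>2 / 2))" by simp
  then have "- ?W = \<i> * of_real (- u * exp (- u\<^sup>2 / 2))" by (simp flip: mult.assoc)
  then show ?thesis by (simp add: minus_equation_iff[of ?W] )
qed

lemma gauss2_product:
  fixes f g :: "real \<Rightarrow> complex"
  assumes "integrable gauss f" "integrable gauss g"
  shows "(\<integral>w. f (fst w) * g (snd w) \<partial>gauss2) = (\<integral>a. f a \<partial>gauss) * (\<integral>a. g a \<partial>gauss)"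
    and "integrable gauss2 (\<lambda>w. f (fst w) * g (snd w))"
proof -
  have [measurable]: "f \<in> borel_measurable gauss" "g \<in> borel_measurable gauss" using assms by auto
  have i: "integrable (gauss \<Otimes>\<^sub>M gauss) (\<lambda>w. f (fst w) * g (snd w))"
  proof (rule gauss_pair.Fubini_integrable)
    have "integrable gauss (\<lambda>x. norm (f x) * (\<integral>y. norm (g y) \<partial>gauss))"
      using assms by simp
    then show "integrable gauss (\<lambda>x. \<integral>y. norm (f (fst (x, y)) * g (snd (x, y))) \<partial>gauss)"
      by (simp add: norm_mult)
  qed (use assms in auto)
  then show "integrable gauss2 (\<lambda>w. f (fst w) * g (snd w))" by (simp add: gauss2_def)
  have "(\<integral>w. f (fst w) * g (snd w) \<partial>gauss2) = (\<integral>a. (\<integral>b. f a * g b \<partial>gauss) \<partial>gauss)"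
    unfolding gauss2_def using gauss_pair.integral_fst'[OF i] by simp
  then show "(\<integral>w. f (fst w) * g (snd w) \<partial>gauss2) = (\<integral>a. f a \<partial>gauss) * (\<integral>a. g a \<partial>gauss)"
    by simp
qed

lemma integrable_gauss_cis: "integrable gauss (\<lambda>a. cis (v * a))"
  by (rule gauss.integrable_const_bound[where B=1]) (auto intro!: borel_measurable_continuous_onI continuous_intros)

lemma integrable_gauss_cis_weight: "integrable gauss (\<lambda>a. complex_of_real a * cis (u * a))"
  by (rule Bochner_Integration.integrable_bound[OF integrable_gauss_id])
     (auto simp: norm_mult intro!: borel_measurable_continuous_onI continuous_intros)

lemma gauss_factor: "exp (- (\<tau> * k $ 1)\<^sup>2 / 2) * exp (- (\<tau> * k $ 2)\<^sup>2 / 2) = exp (- (\<tau>\<^sup>2 * (norm (k::plane))\<^sup>2) / 2)"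
  by (simp add: norm2_sq power_mult_distrib distrib_left add_divide_distrib diff_divide_distrib flip: exp_add)

lemma gauss2_char: "(\<integral>w. cis (k \<bullet> (\<tau> *\<^sub>R pt w)) \<partial>gauss2) = of_real (exp (- (\<tau>\<^sup>2 * (norm k)\<^sup>2) / 2))"
proof -
  have "(\<integral>w. cis (k \<bullet> (\<tau> *\<^sub>R pt w)) \<partial>gauss2) = (\<integral>w. cis ((\<tau> * k $ 1) * fst w) * cis ((\<tau> * k $ 2) * snd w) \<partial>gauss2)"
    by (simp add: inner2 cis_mult algebra_simps)
  also have "\<dots> = of_real (exp (- (\<tau>\<^sup>2 * (norm k)\<^sup>2) / 2))"
    by (subst gauss2_product[OF integrable_gauss_cis integrable_gauss_cis])
       (simp add: gauss_char norm2_sq power_mult_distrib distrib_left add_divide_distrib flip: exp_add of_real_mult)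
  finally show ?thesis .
qed

text \<open>The weight by a coordinate produces the multiplier of \<open>\<tau>\<close> times a
  partial derivative after Gaussian smoothing. Its kernel has mass bounded independently of
  \<open>\<tau>\<close> and is odd; the oddness returns in \<open>commutator_bound\<close>.\<close>

lemma gauss2_char_weight:
  "(\<integral>w. of_real (pt w $ i) * cis (k \<bullet> (\<tau> *\<^sub>R pt w)) \<partial>gauss2)
    = \<i> * of_real (\<tau> * k $ i * exp (- (\<tau>\<^sup>2 * (norm k)\<^sup>2) / 2))"
proof -
  consider "i = 1" | "i = 2" using exhaust_2 by blast
  then show ?thesis
  proof cases
    case 1
    have "(\<integral>w. of_real (pt w $ i) * cis (k \<bullet> (\<tau> *\<^sub>R pt w)) \<partial>gauss2)
       = (\<integral>w. (of_real (fst w) * cis ((\<tau> * k $ 1) * fst w)) * cis ((\<tau> * k $ 2) * snd w) \<partial>gauss2)"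
      by (simp add: 1 inner2 cis_mult algebra_simps)
    also have "\<dots> = \<i> * of_real (\<tau> * k $ i * exp (- (\<tau>\<^sup>2 * (norm k)\<^sup>2) / 2))"
      by (subst gauss2_product[OF integrable_gauss_cis_weight integrable_gauss_cis])
         (unfold gauss_char gauss_char_weight gauss_factor[symmetric], simp add: 1 mult_ac)
    finally show ?thesis .
  next
    case 2
    have "(\<integral>w. of_real (pt w $ i) * cis (k \<bullet> (\<tau> *\<^sub>R pt w)) \<partial>gauss2)
       = (\<integral>w. cis ((\<tau> * k $ 1) * fst w) * (of_real (snd w) * cis ((\<tau> * k $ 2) * snd w)) \<partial>gauss2)"
      by (simp add: 2 inner2 cis_mult algebra_simps)
    also have "\<dots> = \<i> * of_real (\<tau> * k $ i * exp (- (\<tau>\<^sup>2 * (norm k)\<^sup>2) / 2))"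
      by (subst gauss2_product[OF integrable_gauss_cis integrable_gauss_cis_weight])
         (unfold gauss_char gauss_char_weight gauss_factor[symmetric], simp add: 2 mult_ac)
    finally show ?thesis .
  qed
qed

lemma nn_integral_gauss2_nth:
  assumes [measurable]: "f \<in> borel_measurable borel"
  shows "(\<integral>\<^sup>+w. f (pt w $ i) \<partial>gauss2) = (\<integral>\<^sup>+a. f a \<partial>gauss)"
proof -
  consider "i = 1" | "i = 2" using exhaust_2 by blast
  then show ?thesis
  proof cases
    case 1
    then have "(\<integral>\<^sup>+w. f (pt w $ i) \<partial>gauss2) = (\<integral>\<^sup>+a. (\<integral>\<^sup>+b. f a \<partial>gauss) \<partial>gauss)"
      unfolding gauss2_def by (subst gauss.nn_integral_fst[symmetric]) auto
    then show ?thesis by (simp add: gauss.emeasure_space_1[simplified])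
  next
    case 2
    then have "(\<integral>\<^sup>+w. f (pt w $ i) \<partial>gauss2) = (\<integral>\<^sup>+a. (\<integral>\<^sup>+b. f b \<partial>gauss) \<partial>gauss)"
      unfolding gauss2_def by (subst gauss.nn_integral_fst[symmetric]) auto
    then show ?thesis by (simp add: gauss.emeasure_space_1[simplified])
  qed
qed

text \<open>The parameter \<open>\<tau>\<close> is a length and not a time: the kernel is a Gaussian
  of standard deviation \<open>\<tau>\<close> in each coordinate.\<close>

abbreviation heat :: "real \<Rightarrow> plane \<Rightarrow> complex" where
  "heat \<tau> k \<equiv> complex_of_real (exp (- (\<tau>\<^sup>2 * (norm k)\<^sup>2) / 2))"

lemma trig_cong: "(\<And>k. k \<in> F \<Longrightarrow> c k = d k) \<Longrightarrow> trig F c = trig F d"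
  by (simp add: trig_def[abs_def] cong: sum.cong)

interpretation gauss2: prob_space gauss2 by (rule prob_space_gauss2)

lemma le3_heat:
  assumes "L > 0" "F \<subseteq> freq_lattice L" "le3 L (trig F c) b"
  shows "le3 L (trig F (\<lambda>k. c k * heat \<tau> k)) b"
proof -
  have "le3 L (trig F (\<lambda>k. c k * heat \<tau> k)) ((\<integral>\<^sup>+w. ennreal (norm (1::complex)) \<partial>gauss2) * b)"
  proof (rule le3_convolution(1)[OF assms(1,2) gauss2.sigma_finite_measure_axioms _ _ _ assms(3), where \<zeta>="\<lambda>w. \<tau> *\<^sub>R pt w"])
    show "heat \<tau> k = (\<integral>w. 1 * cis (k \<bullet> (\<tau> *\<^sub>R pt w)) \<partial>gauss2)" for k
      by (simp only: mult_1_left gauss2_char)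
  qed auto
  then show ?thesis by (simp add: gauss2.emeasure_space_1[simplified])
qed

lemma integrable_pt: "integrable gauss2 (\<lambda>w. complex_of_real (pt w $ i))"
proof (rule integrableI_bounded)
  show "(\<integral>\<^sup>+ w. ennreal (cmod (complex_of_real (pt w $ i))) \<partial>gauss2) < \<infinity>"
    using nn_integral_gauss2_nth[of "\<lambda>a. ennreal \<bar>a\<bar>" i] gauss_abs by (auto simp: le_less_trans)
qed measurable

lemma gauss2_abs: "(\<integral>\<^sup>+w. ennreal (norm (complex_of_real (pt w $ i))) \<partial>gauss2) \<le> 1"
  using nn_integral_gauss2_nth[of "\<lambda>a. ennreal \<bar>a\<bar>" i] gauss_abs by simp

lemma trig_grad_gauss:
  assumes "L > 0" "F \<subseteq> freq_lattice L"
  shows "trig F (\<lambda>k. c k * (\<i> * of_real (\<tau> * k $ i) * heat \<tau> k)) x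
    = (\<integral>w. of_real (pt w $ i) * trig F c (x + \<tau> *\<^sub>R pt w) \<partial>gauss2)"
\<comment> \<open>Only the pointwise formula is wanted here, so the bound on the cubic norm is the
  vacuous \<open>top\<close>.\<close>
proof (rule le3_convolution(2)[OF assms gauss2.sigma_finite_measure_axioms integrable_pt, where b=top])
  show "\<i> * of_real (\<tau> * k $ i) * heat \<tau> k = (\<integral>w. of_real (pt w $ i) * cis (k \<bullet> (\<tau> *\<^sub>R pt w)) \<partial>gauss2)" for k
    unfolding gauss2_char_weight by simp
qed (auto simp: le3_def power3_eq_cube ennreal_mult_top)

lemma le3_grad:
  assumes "L > 0" "F \<subseteq> freq_lattice L" "le3 L (trig F c) b"
  shows "le3 L (trig F (\<lambda>k. c k * (\<i> * of_real (\<tau> * k $ i) * heat \<tau> k))) b"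
proof (rule le3_mono[OF le3_convolution(1)[OF assms(1,2) gauss2.sigma_finite_measure_axioms integrable_pt _ _ assms(3), where \<zeta>="\<lambda>w. \<tau> *\<^sub>R pt w"]])
  show "\<i> * of_real (\<tau> * k $ i) * heat \<tau> k = (\<integral>w. of_real (pt w $ i) * cis (k \<bullet> (\<tau> *\<^sub>R pt w)) \<partial>gauss2)" for k
    unfolding gauss2_char_weight by simp
  show "(\<integral>\<^sup>+ w. ennreal (cmod (complex_of_real (pt w $ i))) \<partial>gauss2) * b \<le> b"
    using mult_right_mono[OF gauss2_abs[of i], of b] by simp
qed measurable

text \<open>Multiplication by \<open>\<i> * of_real u\<close> in place of a division keeps
  \<open>u = 0\<close> included.\<close>

lemma integral_cis_unit: "(\<integral>\<sigma>. cis (\<sigma> * u) \<partial>restrict_space lborel {0..1}) * (\<i> * of_real u) = cis u - 1"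
proof -
  have "(\<integral>\<sigma>. cis (\<sigma> * u) \<partial>restrict_space lborel {0..1::real}) * (\<i> * of_real u)
     = (\<integral>\<sigma>. indicator {0..1} \<sigma> *\<^sub>R cis (\<sigma> * u) \<partial>lborel) * (\<i> * of_real u)"
    by (subst integral_restrict_space) auto
  also have "\<dots> = (\<integral>\<sigma>. indicator {0..1} \<sigma> *\<^sub>R (cis (\<sigma> * u) * (\<i> * of_real u)) \<partial>lborel)"
    by (subst integral_mult_left_zero[symmetric]) (simp add: mult.assoc)
  also have "\<dots> = cis (1 * u) - cis (0 * u)"
  proof (rule integral_FTC_atLeastAtMost)
    fix x :: real
    have "((\<lambda>z. exp (\<i> * (z * of_real u))) has_field_derivative (exp (\<i> * (of_real x * of_real u)) * (\<i> * of_real u))) (at (of_real x))"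
      by (auto intro!: derivative_eq_intros)
    from has_vector_derivative_real_field[OF this, of "{0..1}"] show "((\<lambda>x. cis (x * u)) has_vector_derivative cis (x * u) * (\<i> * of_real u)) (at x within {0..1})"
      by (simp add: cis_conv_exp)
  qed (auto intro!: continuous_intros)
  finally show ?thesis by simp
qed

text \<open>By the fundamental theorem of calculus along the segment from 0 to \<open>y\<close>, an
  increment is an average of translates of the derivative in the direction \<open>y\<close>. The
  partial derivatives are bounded separately, whence the sum of the absolute coordinates.\<close>

lemma le3_increment:
  assumes L: "L > 0" and F: "F \<subseteq> freq_lattice L"
    and b: "\<And>i. le3 L (trig F (\<lambda>k. c k * (\<i> * of_real (k $ i)))) b"
  shows "le3 L (trig F (\<lambda>k. c k * (cis (k \<bullet> y) - 1))) (ennreal (\<bar>y $ 1\<bar> + \<bar>y $ 2\<bar>) * b)"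
proof -
  let ?N = "restrict_space lborel {0..1::real}"
  interpret N: finite_measure ?N
    by (rule finite_measureI) (simp add: emeasure_restrict_space space_restrict_space)
  have "le3 L (\<lambda>x. of_real (y $ 1) * trig F (\<lambda>k. c k * (\<i> * of_real (k $ 1))) x
      + of_real (y $ 2) * trig F (\<lambda>k. c k * (\<i> * of_real (k $ 2))) x)
      (ennreal (norm (complex_of_real (y $ 1))) * b + ennreal (norm (complex_of_real (y $ 2))) * b)"
    by (intro le3_add le3_cmult b L) measurable
  also have "(\<lambda>x. of_real (y $ 1) * trig F (\<lambda>k. c k * (\<i> * of_real (k $ 1))) x
      + of_real (y $ 2) * trig F (\<lambda>k. c k * (\<i> * of_real (k $ 2))) x)
      = trig F (\<lambda>k. c k * (\<i> * of_real (k \<bullet> y)))"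
    by (simp add: trig_cmult trig_add inner2 algebra_simps fun_eq_iff)
  also have "ennreal (norm (complex_of_real (y $ 1))) * b + ennreal (norm (complex_of_real (y $ 2))) * b
      = ennreal (\<bar>y $ 1\<bar> + \<bar>y $ 2\<bar>) * b"
    by (subst ennreal_plus) (auto simp: distrib_right)
  finally have base: "le3 L (trig F (\<lambda>k. c k * (\<i> * of_real (k \<bullet> y)))) (ennreal (\<bar>y $ 1\<bar> + \<bar>y $ 2\<bar>) * b)" .
  have "le3 L (trig F (\<lambda>k. c k * (\<i> * of_real (k \<bullet> y)) * (\<integral>\<sigma>. 1 * cis (k \<bullet> (\<sigma> *\<^sub>R y)) \<partial>?N)))
      ((\<integral>\<^sup>+\<sigma>. ennreal (norm (1::complex)) \<partial>?N) * (ennreal (\<bar>y $ 1\<bar> + \<bar>y $ 2\<bar>) * b))"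
  proof (rule le3_convolution(1)[OF L F N.sigma_finite_measure_axioms _ _ _ base])
    show "(\<lambda>\<sigma>. \<sigma> *\<^sub>R y) \<in> borel_measurable ?N"
      by (intro measurable_restrict_space1) measurable
  qed auto
  moreover have eq: "trig F (\<lambda>k. c k * (cis (k \<bullet> y) - 1))
      = trig F (\<lambda>k. c k * (\<i> * of_real (k \<bullet> y)) * (\<integral>\<sigma>. 1 * cis (k \<bullet> (\<sigma> *\<^sub>R y)) \<partial>?N))"
    by (intro trig_cong) (unfold integral_cis_unit[symmetric], simp)
  ultimately show ?thesis
    unfolding eq by (simp add: emeasure_restrict_space space_restrict_space)
qed

text \<open>The Gaussian factor is spent on the derivative: smoothing at length
  \<open>\<tau>\<close> makes a partial derivative cost \<open>1 / \<tau>\<close>.\<close>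

lemma le3_heat_increment:
  assumes L: "L > 0" and F: "F \<subseteq> freq_lattice L" and \<tau>: "\<tau> > 0"
    and b: "le3 L (trig F c) b"
  shows "le3 L (trig F (\<lambda>k. c k * heat \<tau> k * (cis (k \<bullet> y) - 1))) (ennreal ((\<bar>y $ 1\<bar> + \<bar>y $ 2\<bar>) / \<tau>) * b)"
proof -
  have "le3 L (trig F (\<lambda>k. c k * heat \<tau> k * (\<i> * of_real (k $ i)))) (ennreal (1 / \<tau>) * b)" for i
  proof -
    have "le3 L (\<lambda>x. of_real (1 / \<tau>) * trig F (\<lambda>k. c k * (\<i> * of_real (\<tau> * k $ i) * heat \<tau> k)) x)
        (ennreal (norm (complex_of_real (1 / \<tau>))) * b)"
      by (intro le3_cmult le3_grad L F b) measurable
    also have "(\<lambda>x. of_real (1 / \<tau>) * trig F (\<lambda>k. c k * (\<i> * of_real (\<tau> * k $ i) * heat \<tau> k)) x)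
        = trig F (\<lambda>k. c k * heat \<tau> k * (\<i> * of_real (k $ i)))"
      unfolding trig_cmult using \<tau> by (intro ext arg_cong2[where f="trig F"] refl) (simp add: mult_ac)
    also have "norm (complex_of_real (1 / \<tau>)) = 1 / \<tau>" using \<tau> by (simp add: norm_divide)
    finally show ?thesis .
  qed
  from le3_increment[OF L F this, of y]
  have "le3 L (trig F (\<lambda>k. c k * heat \<tau> k * (cis (k \<bullet> y) - 1))) (ennreal (\<bar>y $ 1\<bar> + \<bar>y $ 2\<bar>) * ennreal (1 / \<tau>) * b)"
    by (simp only: mult.assoc)
  also have "ennreal (\<bar>y $ 1\<bar> + \<bar>y $ 2\<bar>) * ennreal (1 / \<tau>) = ennreal ((\<bar>y $ 1\<bar> + \<bar>y $ 2\<bar>) / \<tau>)"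
    using \<tau> by (subst ennreal_mult[symmetric]) auto
  finally show ?thesis .
qed

subsection \<open>A positive kernel with small support in frequency\<close>

text \<open>
  The vector \<open>(sin (\<pi> j / M))\<^sub>j\<close> is the principal eigenvector of the path with \<open>M - 1\<close> vertices; this is what
  makes the second moment of the kernel of order \<open>M\<^sup>-\<^sup>2\<close>.
\<close>

definition sinc2 :: "nat \<Rightarrow> int \<Rightarrow> real" where
  "sinc2 M m = (\<Sum>p \<in> {p \<in> {..<M} \<times> {..<M}. int (fst p) - int (snd p) = m}.
       sin (pi * real (fst p) / real M) * sin (pi * real (snd p) / real M)) / (\<Sum>j<M. (sin (pi * real j / real M))\<^sup>2)"

lemma sin_sum_pos:
  assumes "M \<ge> 2" shows "(\<Sum>j<M. (sin (pi * real j / M))\<^sup>2) > 0"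
proof (rule sum_pos2[where i=1])
  have "0 < pi * real 1 / M" "pi * real 1 / M < pi" using assms by (auto simp: field_simps)
  then have "sin (pi * real 1 / M) > 0" by (rule sin_gt_zero)
  then show "0 < (sin (pi * real 1 / M))\<^sup>2" by simp
qed (use assms in auto)

lemma sinc2_0: "M \<ge> 2 \<Longrightarrow> sinc2 M 0 = 1"
proof -
  assume M: "M \<ge> 2"
  have "(\<Sum>p \<in> {p \<in> {..<M} \<times> {..<M}. int (fst p) - int (snd p) = 0}. sin (pi * real (fst p) / real M) * sin (pi * real (snd p) / real M))
     = (\<Sum>j<M. (sin (pi * real j / real M))\<^sup>2)"
    by (rule sum.reindex_bij_witness[of _ "\<lambda>j. (j, j)" fst]) (auto simp: power2_eq_square)
  then show ?thesis using sin_sum_pos[OF M] by (simp add: sinc2_def)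
qed

lemma sinc2_uminus: "sinc2 M (- m) = sinc2 M m"
  unfolding sinc2_def
  by (intro arg_cong2[where f="(/)"] refl sum.reindex_bij_witness[of _ prod.swap prod.swap]) auto

lemma sinc2_zero:
  assumes "\<bar>m\<bar> \<ge> int M - 1" "M \<ge> 2" shows "sinc2 M m = 0"
proof -
  have "sin (pi * real (fst p) / real M) * sin (pi * real (snd p) / real M) = 0"
    if "p \<in> {p \<in> {..<M} \<times> {..<M}. int (fst p) - int (snd p) = m}" for p
  proof -
    \<comment> \<open>Two indices below \<open>M\<close> that differ by at least
      \<open>M - 1\<close> include the index 0, where the sine vanishes. So the coefficients vanish
      from \<open>M - 1\<close> on, which the choice of \<open>M\<close> in \<open>le3_gap\<close>
      exploits.\<close>
    have "fst p = 0 \<or> snd p = 0" using that assms by auto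
    then show ?thesis by auto
  qed
  then show ?thesis unfolding sinc2_def by (subst sum.neutral) auto
qed

text \<open>Twice the sum at lag one is the quadratic form of the adjacency matrix of a path,
  evaluated at an eigenvector with eigenvalue \<open>2 * cos (pi / M)\<close>; division by the
  squared length of the eigenvector leaves half of the eigenvalue.\<close>

lemma sinc2_1:
  assumes "M \<ge> 2" shows "sinc2 M 1 = cos (pi / M)"
proof -
  define a where "a j = sin (pi * real j / M)" for j
  have aM: "a M = 0" using assms by (simp add: a_def)
  have "(\<Sum>p \<in> {p \<in> {..<M} \<times> {..<M}. int (fst p) - int (snd p) = 1}. a (fst p) * a (snd p))
     = (\<Sum>j<M - 1. a (Suc j) * a j)"
  proof -
    have "int i - int j = 1 \<longleftrightarrow> i = Suc j" for i j by auto
    then show ?thesis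
      by (intro sum.reindex_bij_witness[of _ "\<lambda>j. (Suc j, j)" snd]) auto
  qed
  \<comment> \<open>The last term vanishes because \<open>a M = 0\<close>. With the full range the
    two one-sided sums combine into \<open>a (j + 1) + a (j - 1)\<close>, to which the addition
    theorem applies.\<close>
  moreover have "(\<Sum>j<M. a (Suc j) * a j) = (\<Sum>j<M - 1. a (Suc j) * a j)"
    using assms aM by (cases M) auto
  moreover have "(\<Sum>j<M - 1. a (Suc j) * a j) = (\<Sum>j<M. a j * (if j = 0 then 0 else a (j - 1)))"
  proof -
    obtain M' where M': "M = Suc M'" using assms by (cases M) auto
    show ?thesis unfolding M' by (subst sum.lessThan_Suc_shift) simp
  qed
  ultimately have "2 * (\<Sum>p \<in> {p \<in> {..<M} \<times> {..<M}. int (fst p) - int (snd p) = 1}. a (fst p) * a (snd p))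
     = (\<Sum>j<M. a (Suc j) * a j + a j * (if j = 0 then 0 else a (j - 1)))"
    by (simp add: sum.distrib)
  also have "\<dots> = (\<Sum>j<M. 2 * cos (pi / M) * (a j)\<^sup>2)"
  proof (rule sum.cong[OF refl])
    fix j
    show "a (Suc j) * a j + a j * (if j = 0 then 0 else a (j - 1)) = 2 * cos (pi / M) * (a j)\<^sup>2"
    proof (cases j)
      case 0 then show ?thesis
        by (simp add: a_def)
    next
      case (Suc i)
      have "pi * real (Suc j) / M = pi * real j / M + pi / M" "pi * real (j - 1) / M = pi * real j / M - pi / M"
        using Suc assms by (auto simp: field_simps)
      then have "a (Suc j) + a (j - 1) = 2 * cos (pi / M) * a j"
        unfolding a_def by (simp add: sin_add sin_diff)
      moreover have "a (Suc j) * a j + a j * (if j = 0 then 0 else a (j - 1)) = (a (Suc j) + a (j - 1)) * a j"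
        using Suc by (simp add: algebra_simps)
      ultimately show ?thesis by (simp add: power2_eq_square)
    qed
  qed
  also have "\<dots> = 2 * cos (pi / M) * (\<Sum>j<M. (a j)\<^sup>2)" by (simp add: sum_distrib_left)
  finally show ?thesis
    using sin_sum_pos[OF assms] by (simp add: sinc2_def a_def)
qed

text \<open>This is the Fejer-Korovkin kernel of degree \<open>M - 2\<close>: nonnegative as a
  squared modulus, with Fourier coefficients \<open>sinc2 M m\<close>, and of mean one for
  \<open>M \<ge> 2\<close>.\<close>

definition jackson1 :: "nat \<Rightarrow> real \<Rightarrow> real" where
  "jackson1 M u = (cmod (\<Sum>j<M. of_real (sin (pi * real j / real M)) * cis (real j * u)))\<^sup>2 / (\<Sum>j<M. (sin (pi * real j / real M))\<^sup>2)"

lemma jackson1_nonneg: "jackson1 M u \<ge> 0"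
  unfolding jackson1_def by (intro divide_nonneg_nonneg sum_nonneg) auto

lemma jackson1_eq: "complex_of_real (jackson1 M u) = (\<Sum>m\<in>{- int M..int M}. of_real (sinc2 M m) * cis (real_of_int m * u))"
  for u :: real
proof -
  define a where "a j = sin (pi * real j / M)" for j
  have "complex_of_real ((cmod (\<Sum>j<M. of_real (a j) * cis (real j * u)))\<^sup>2)
     = (\<Sum>j<M. of_real (a j) * cis (real j * u)) * cnj (\<Sum>j<M. of_real (a j) * cis (real j * u))"
    by (rule complex_norm_square)
  also have "\<dots> = (\<Sum>j<M. \<Sum>l<M. of_real (a j * a l) * cis (real_of_int (int j - int l) * u))"
    unfolding cnj_sum sum_product
    by (intro sum.cong refl) (simp add: cis_cnj cis_mult algebra_simps)
  also have "\<dots> = (\<Sum>p\<in>{..<M} \<times> {..<M}. of_real (a (fst p) * a (snd p)) * cis (real_of_int (int (fst p) - int (snd p)) * u))"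
    by (simp add: sum.cartesian_product case_prod_unfold)
  also have "\<dots> = (\<Sum>m\<in>{- int M..int M}. \<Sum>p\<in>{p \<in> {..<M} \<times> {..<M}. int (fst p) - int (snd p) = m}.
       of_real (a (fst p) * a (snd p)) * cis (real_of_int (int (fst p) - int (snd p)) * u))"
    by (rule sum.group[symmetric]) auto
  also have "\<dots> = (\<Sum>m\<in>{- int M..int M}. (\<Sum>p\<in>{p \<in> {..<M} \<times> {..<M}. int (fst p) - int (snd p) = m}.
       of_real (a (fst p) * a (snd p))) * cis (real_of_int m * u))"
    unfolding sum_distrib_right by (intro sum.cong refl) auto
  finally have "complex_of_real (jackson1 M u) = (\<Sum>m\<in>{- int M..int M}. (\<Sum>p\<in>{p \<in> {..<M} \<times> {..<M}. int (fst p) - int (snd p) = m}.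
       of_real (a (fst p) * a (snd p))) * cis (real_of_int m * u)) / of_real (\<Sum>j<M. (a j)\<^sup>2)"
    by (simp add: jackson1_def a_def)
  also have "\<dots> = (\<Sum>m\<in>{- int M..int M}. of_real (sinc2 M m) * cis (real_of_int m * u))"
    unfolding sinc2_def a_def[symmetric] of_real_divide of_real_sum
    by (subst sum_divide_distrib) simp
  finally show ?thesis .
qed

definition jackson :: "real \<Rightarrow> nat \<Rightarrow> plane \<Rightarrow> real" where
  "jackson L M y = jackson1 M (2 * pi / L * y $ 1) * jackson1 M (2 * pi / L * y $ 2)"

definition jackson_freqs :: "real \<Rightarrow> nat \<Rightarrow> plane set" where
  "jackson_freqs L M = (\<lambda>(m, n). freq L m n) ` ({- int M..int M} \<times> {- int M..int M})"

text \<open>The rounding recovers the integer indices of a lattice frequency, where it is exact; the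
  coefficient thereby becomes a function of the frequency itself.\<close>

definition jackson_coeff :: "real \<Rightarrow> nat \<Rightarrow> plane \<Rightarrow> real" where
  "jackson_coeff L M k = sinc2 M (round (L * k $ 1 / (2 * pi))) * sinc2 M (round (L * k $ 2 / (2 * pi)))"

lemma jackson_coeff_freq: "L > 0 \<Longrightarrow> jackson_coeff L M (freq L m n) = sinc2 M m * sinc2 M n"
  by (simp add: jackson_coeff_def)

lemma jackson_coeff_uminus: "L > 0 \<Longrightarrow> k \<in> freq_lattice L \<Longrightarrow> jackson_coeff L M (- k) = jackson_coeff L M k"
  by (elim freq_latticeE) (simp add: freq_minus jackson_coeff_freq sinc2_uminus)

lemma jackson_nonneg: "jackson L M y \<ge> 0"
  by (simp add: jackson_def jackson1_nonneg)

lemma finite_jackson_freqs [simp]: "finite (jackson_freqs L M)"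
  by (simp add: jackson_freqs_def)

lemma jackson_freqs_lattice: "jackson_freqs L M \<subseteq> freq_lattice L"
  by (auto simp: jackson_freqs_def)

lemma jackson_coeff_eq_0:
  assumes "L > 0" "M \<ge> 2" "k \<in> freq_lattice L - jackson_freqs L M" shows "jackson_coeff L M k = 0"
proof -
  obtain m n where k: "k = freq L m n" using assms by (auto elim: freq_latticeE)
  have "\<bar>m\<bar> > int M \<or> \<bar>n\<bar> > int M" by (rule ccontr) (use assms k in \<open>force simp: jackson_freqs_def\<close>)
  then show ?thesis using assms k by (auto simp: jackson_coeff_freq sinc2_zero)
qed

lemma jackson_eq_trig:
  assumes "L > 0"
  shows "complex_of_real (jackson L M y) = trig (jackson_freqs L M) (\<lambda>k. of_real (jackson_coeff L M k)) y"
proof -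
  have inj: "inj_on (\<lambda>(m, n). freq L m n) A" for A
    using assms by (auto simp: inj_on_def freq_inj)
  have "complex_of_real (jackson L M y) = (\<Sum>m\<in>{- int M..int M}. \<Sum>n\<in>{- int M..int M}.
     (of_real (sinc2 M m) * cis (real_of_int m * (2 * pi / L * y $ 1))) * (of_real (sinc2 M n) * cis (real_of_int n * (2 * pi / L * y $ 2))))"
    by (simp only: jackson_def of_real_mult jackson1_eq sum_product)
  also have "\<dots> = (\<Sum>m\<in>{- int M..int M}. \<Sum>n\<in>{- int M..int M}.
     of_real (sinc2 M m * sinc2 M n) * cis (freq L m n \<bullet> y))"
    by (intro sum.cong refl) (simp add: inner2 mult_ac flip: cis_mult)
  also have "\<dots> = (\<Sum>p\<in>{- int M..int M} \<times> {- int M..int M}.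
     of_real (jackson_coeff L M (freq L (fst p) (snd p))) * cis (freq L (fst p) (snd p) \<bullet> y))"
    using assms by (simp add: sum.cartesian_product case_prod_unfold jackson_coeff_freq)
  also have "\<dots> = trig (jackson_freqs L M) (\<lambda>k. of_real (jackson_coeff L M k)) y"
    unfolding trig_def jackson_freqs_def
    by (subst sum.reindex[OF inj]) (simp add: case_prod_unfold)
  finally show ?thesis .
qed

lemma jackson1_measurable [measurable]: "jackson1 M \<in> borel_measurable borel"
  unfolding jackson1_def[abs_def]
  by (intro borel_measurable_divide borel_measurable_const borel_measurable_continuous_onI continuous_intros)

lemma jackson_measurable [measurable]: "jackson L M \<in> borel_measurable borel"
  unfolding jackson_def[abs_def] by measurable

lemma jackson_coeff_integral:
  assumes L: "L > 0" and M: "M \<ge> 2" and k: "k \<in> freq_lattice L"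
  shows "(\<integral>y. of_real (jackson L M y) * cis (k \<bullet> y) \<partial>torus_measure L) = of_real (jackson_coeff L M k)"
    and "integrable (torus_measure L) (\<lambda>y. complex_of_real (jackson L M y) * cis (k \<bullet> y))"
proof -
  let ?F = "jackson_freqs L M"
  interpret prob_space "torus_measure L" by (rule prob_space_torus_measure[OF L])
  have ic: "integrable (torus_measure L) (\<lambda>y. cis (q \<bullet> y))" for q
    by (rule integrable_const_bound[where B=1]) auto
  have eq: "of_real (jackson L M y) * cis (k \<bullet> y) = (\<Sum>q\<in>?F. of_real (jackson_coeff L M q) * cis ((q + k) \<bullet> y))" for y
    unfolding jackson_eq_trig[OF L] trig_def sum_distrib_right
    by (intro sum.cong refl) (simp add: inner_add_left flip: cis_mult)
  show "integrable (torus_measure L) (\<lambda>y. complex_of_real (jackson L M y) * cis (k \<bullet> y))"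
    unfolding eq using ic by auto
  have "(\<integral>y. of_real (jackson L M y) * cis (k \<bullet> y) \<partial>torus_measure L)
     = (\<Sum>q\<in>?F. of_real (jackson_coeff L M q) * (\<integral>y. cis ((q + k) \<bullet> y) \<partial>torus_measure L))"
    unfolding eq by (subst Bochner_Integration.integral_sum) (use ic in auto)
  also have "\<dots> = (\<Sum>q\<in>?F. if q = - k then of_real (jackson_coeff L M q) else 0)"
  proof (intro sum.cong refl)
    fix q assume "q \<in> ?F"
    then have "q + k \<in> freq_lattice L" using jackson_freqs_lattice k by (auto intro: freq_lattice_add)
    then show "of_real (jackson_coeff L M q) * (\<integral>y. cis ((q + k) \<bullet> y) \<partial>torus_measure L)
        = (if q = - k then complex_of_real (jackson_coeff L M q) else 0)"
      using L by (subst integral_cis_torus) (auto simp: add_eq_0_iff2)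
  qed
  also have "\<dots> = of_real (jackson_coeff L M k)"
    using jackson_coeff_eq_0[OF L M, of "- k"] k
    by (auto simp: sum.delta jackson_coeff_uminus[OF L k])
  finally show "(\<integral>y. of_real (jackson L M y) * cis (k \<bullet> y) \<partial>torus_measure L) = of_real (jackson_coeff L M k)" .
qed

lemma jackson_integral_1:
  assumes "L > 0" "M \<ge> 2"
  shows "integrable (torus_measure L) (jackson L M)" "(\<integral>y. jackson L M y \<partial>torus_measure L) = 1"
    "(\<integral>\<^sup>+y. ennreal (jackson L M y) \<partial>torus_measure L) = 1"
proof -
  have c: "jackson_coeff L M 0 = 1"
  proof -
    have "freq L 0 0 = 0" by (simp add: vec_eq_iff forall_2)
    then show ?thesis using jackson_coeff_freq[of L M 0 0] assms by (simp add: sinc2_0)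
  qed
  note * = jackson_coeff_integral[OF assms zero_freq_lattice]
  show i: "integrable (torus_measure L) (jackson L M)"
    using *(2) by (simp add: complex_of_real_integrable_eq)
  show I: "(\<integral>y. jackson L M y \<partial>torus_measure L) = 1"
    using *(1) c by (simp add: of_real_eq_1_iff)
  show "(\<integral>\<^sup>+y. ennreal (jackson L M y) \<partial>torus_measure L) = 1"
    using i I by (subst nn_integral_eq_integral) (auto simp: jackson_nonneg)
qed

text \<open>The representative modulo the lattice with coordinates between \<open>- L / 2\<close>
  and \<open>L / 2\<close>. The kernel concentrates near lattice points, among them all corners of
  the cell, so its moments have to be measured by this vector and not by \<open>y\<close>.\<close>

definition cwrap :: "real \<Rightarrow> plane \<Rightarrow> plane" where
  "cwrap L y = y + lat L (- round (y $ 1 / L), - round (y $ 2 / L))"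

lemma cwrap_nth: "cwrap L y $ i = y $ i - L * of_int (round (y $ i / L))"
proof -
  consider "i = 1" | "i = 2" using exhaust_2 by blast
  then show ?thesis by cases (simp_all add: cwrap_def)
qed

lemma cwrap_measurable [measurable]: "cwrap L \<in> borel_measurable borel"
proof -
  have "cwrap L = (\<lambda>y. vector [y $ 1 - L * of_int (round (y $ 1 / L)), y $ 2 - L * of_int (round (y $ 2 / L))])"
    by (auto simp: fun_eq_iff vec_eq_iff forall_2 cwrap_nth)
  then show ?thesis unfolding round_def by simp
qed

lemma cis_cwrap: "L > 0 \<Longrightarrow> k \<in> freq_lattice L \<Longrightarrow> cis (k \<bullet> cwrap L y) = cis (k \<bullet> y)"
  unfolding cwrap_def using torus_periodic_lat[OF cis_torus_periodic, of k L] by blast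

text \<open>On this range \<open>u * u \<le> 3\<close>, so the Taylor bound
  \<open>u - u ^ 3 / 6\<close> is at least \<open>u / 2\<close>.\<close>

lemma sin_ge_half:
  fixes u :: real assumes "0 \<le> u" "u \<le> pi / 2" shows "u / 2 \<le> sin u"
proof -
  have "\<bar>sin u - (\<Sum>m<3. sin_coeff m * u ^ m)\<bar> \<le> inverse (fact 3) * \<bar>u\<bar> ^ 3"
    by (rule Maclaurin_sin_bound)
  then have "\<bar>sin u - u\<bar> \<le> u ^ 3 / 6"
    using assms by (simp add: numeral_3_eq_3 sin_coeff_def fact_numeral)
  moreover have "u ^ 3 \<le> 3 * u"
  proof -
    have "u \<le> 1.6" using assms pi_approx by simp
    then have "u * u \<le> 1.6 * 1.6" using assms by (intro mult_mono) auto
    then have "u * u * u \<le> 3 * u" using assms by (intro mult_right_mono) auto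
    then show ?thesis by (simp add: power3_eq_cube)
  qed
  ultimately show ?thesis by linarith
qed

text \<open>The squared distance to the lattice is replaced by a trigonometric polynomial of degree
  one, whose mean against the kernel is known exactly from the coefficient at lag one.\<close>

lemma cwrap_sq_le:
  assumes L: "L > 0"
  shows "(cwrap L y $ i)\<^sup>2 \<le> 2 * L\<^sup>2 / pi\<^sup>2 * (1 - cos (2 * pi / L * y $ i))"
proof -
  define v where "v = pi / L * cwrap L y $ i"
  have "\<bar>cwrap L y $ i\<bar> \<le> L / 2"
  proof -
    have "cwrap L y $ i = L * (y $ i / L - of_int (round (y $ i / L)))"
      using L by (simp add: cwrap_nth field_simps)
    moreover have "\<bar>y $ i / L - of_int (round (y $ i / L))\<bar> \<le> 1 / 2"
      using of_int_round_abs_le[of "y $ i / L"] by (simp add: abs_minus_commute)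
    ultimately show ?thesis
      using L by (simp add: abs_mult mult_left_mono[of _ "1/2" L, simplified])
  qed
  then have "\<bar>v\<bar> \<le> pi / 2" using L by (simp add: v_def abs_mult field_simps)
  then have "\<bar>v\<bar> / 2 \<le> sin \<bar>v\<bar>" by (intro sin_ge_half) auto
  then have "(\<bar>v\<bar> / 2)\<^sup>2 \<le> (sin \<bar>v\<bar>)\<^sup>2" by (intro power_mono) auto
  then have "v\<^sup>2 / 4 \<le> (sin v)\<^sup>2" by (auto simp: power_divide abs_if split: if_splits)
  also have "(sin v)\<^sup>2 = (1 - cos (2 * v)) / 2" by (simp add: cos_double_sin)
  also have "cos (2 * v) = cos (2 * pi / L * y $ i)"
  proof -
    have "2 * v = 2 * pi / L * y $ i + 2 * pi * of_int (- round (y $ i / L))"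
      using L by (simp add: v_def cwrap_nth field_simps)
    then show ?thesis by (simp only: cos_add cos_int_2pin sin_int_2pin)
  qed
  finally have "v\<^sup>2 \<le> 2 * (1 - cos (2 * pi / L * y $ i))" by simp
  then have "L\<^sup>2 / pi\<^sup>2 * v\<^sup>2 \<le> L\<^sup>2 / pi\<^sup>2 * (2 * (1 - cos (2 * pi / L * y $ i)))"
    by (intro mult_left_mono) auto
  then show ?thesis using L by (simp add: v_def power_mult_distrib power_divide algebra_simps diff_divide_distrib)
qed

text \<open>By \<open>cwrap_sq_le\<close> the second moment is controlled by the mean of
  \<open>1 - cos (2 * pi / L * y $ i)\<close>, which is
  \<open>1 - cos (pi / M) \<le> pi^2 / (2 * M^2)\<close>. The inequality
  \<open>u \<le> d / 2 + u^2 / (2 * d)\<close> turns this into a first moment.\<close>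

lemma jackson_moment:
  assumes L: "L > 0" and M: "M \<ge> 2"
  shows "(\<integral>\<^sup>+y. ennreal (jackson L M y * \<bar>cwrap L y $ i\<bar>) \<partial>torus_measure L) \<le> ennreal (L / M)"
proof -
  define k where "k = (if i = 1 then freq L 1 0 else freq L 0 1)"
  have k: "k \<in> freq_lattice L" by (simp add: k_def)
  have ki: "k \<bullet> y = 2 * pi / L * y $ i" for y
    using exhaust_2[of i] by (auto simp: k_def inner2)
  have c: "jackson_coeff L M k = cos (pi / M)"
    using L M by (simp add: k_def jackson_coeff_freq sinc2_0 sinc2_1)
  note J = jackson_integral_1[OF L M]
  have ic: "integrable (torus_measure L) (\<lambda>y. jackson L M y * cos (k \<bullet> y))"
    using integrable_Re[OF jackson_coeff_integral(2)[OF L M k]] by simp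
  have Ic: "(\<integral>y. jackson L M y * cos (k \<bullet> y) \<partial>torus_measure L) = cos (pi / M)"
    using arg_cong[OF jackson_coeff_integral(1)[OF L M k], of Re] 
    by (simp add: c integral_Re[OF jackson_coeff_integral(2)[OF L M k], symmetric])
  \<comment> \<open>This choice balances the inequality: each of its two summands contributes
    \<open>d / 2\<close>.\<close>
  define d where "d = L / M"
  have d: "d > 0" using L M by (simp add: d_def)
  have int: "integrable (torus_measure L)
      (\<lambda>y. d / 2 * jackson L M y + L\<^sup>2 / (d * pi\<^sup>2) * (jackson L M y - jackson L M y * cos (k \<bullet> y)))"
    using J ic by auto
  have "(\<integral>\<^sup>+y. ennreal (jackson L M y * \<bar>cwrap L y $ i\<bar>) \<partial>torus_measure L)
     \<le> (\<integral>\<^sup>+y. ennreal (d / 2 * jackson L M y + L\<^sup>2 / (d * pi\<^sup>2) * (jackson L M y - jackson L M y * cos (k \<bullet> y))) \<partial>torus_measure L)"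
  proof (intro nn_integral_mono ennreal_leI)
    fix y
    let ?u = "\<bar>cwrap L y $ i\<bar>"
    have "0 \<le> (?u - d)\<^sup>2" by simp
    then have "2 * d * ?u \<le> d\<^sup>2 + (cwrap L y $ i)\<^sup>2" by (simp add: power2_diff algebra_simps)
    also have "\<dots> \<le> d\<^sup>2 + 2 * L\<^sup>2 / pi\<^sup>2 * (1 - cos (k \<bullet> y))"
      using cwrap_sq_le[OF L, of y i] by (simp add: ki)
    finally have "?u \<le> (d\<^sup>2 + 2 * L\<^sup>2 / pi\<^sup>2 * (1 - cos (k \<bullet> y))) / (2 * d)"
      using d by (simp add: field_simps)
    also have "\<dots> = d / 2 + L\<^sup>2 / (d * pi\<^sup>2) * (1 - cos (k \<bullet> y))"
      using d by (simp add: field_simps power2_eq_square)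
    finally have "jackson L M y * ?u \<le> jackson L M y * (d / 2 + L\<^sup>2 / (d * pi\<^sup>2) * (1 - cos (k \<bullet> y)))"
      by (intro mult_left_mono jackson_nonneg)
    then show "jackson L M y * ?u \<le> d / 2 * jackson L M y + L\<^sup>2 / (d * pi\<^sup>2) * (jackson L M y - jackson L M y * cos (k \<bullet> y))"
      by (simp add: algebra_simps diff_divide_distrib)
  qed
  also have "\<dots> = ennreal (\<integral>y. d / 2 * jackson L M y + L\<^sup>2 / (d * pi\<^sup>2) * (jackson L M y - jackson L M y * cos (k \<bullet> y)) \<partial>torus_measure L)"
  proof (rule nn_integral_eq_integral[OF int AE_I2])
    fix y
    have "jackson L M y * cos (k \<bullet> y) \<le> jackson L M y" using jackson_nonneg[of L M y] by (simp add: mult_left_le)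
    then show "0 \<le> d / 2 * jackson L M y + L\<^sup>2 / (d * pi\<^sup>2) * (jackson L M y - jackson L M y * cos (k \<bullet> y))"
      using d by (intro add_nonneg_nonneg mult_nonneg_nonneg) (auto simp: jackson_nonneg)
  qed
  also have "(\<integral>y. d / 2 * jackson L M y + L\<^sup>2 / (d * pi\<^sup>2) * (jackson L M y - jackson L M y * cos (k \<bullet> y)) \<partial>torus_measure L)
      = d / 2 + L\<^sup>2 / (d * pi\<^sup>2) * (1 - cos (pi / M))"
    using J ic Ic by simp
  also have "\<dots> \<le> d / 2 + L\<^sup>2 / (d * pi\<^sup>2) * (pi\<^sup>2 / (2 * M\<^sup>2))"
  proof -
    have "1 - cos (pi / M) = 2 * (sin (pi / M / 2))\<^sup>2" using cos_double_sin[of "pi / M / 2"] by simp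
    also have "(sin (pi / M / 2))\<^sup>2 \<le> (pi / M / 2)\<^sup>2"
      using abs_sin_x_le_abs_x[of "pi / M / 2"] by (simp only: abs_le_square_iff)
    finally have "1 - cos (pi / M) \<le> pi\<^sup>2 / (2 * M\<^sup>2)" by (simp add: power_divide)
    then show ?thesis using d by (intro add_left_mono mult_left_mono) auto
  qed
  also have "\<dots> = d"
    using d L M by (simp add: d_def field_simps power2_eq_square)
  finally show ?thesis by (simp add: d_def ennreal_leI)
qed

text \<open>If the kernel has no frequency in \<open>F\<close>, averaging against it annihilates the
  function. So the smoothed function is minus the average of its own increments, and an increment by
  \<open>y\<close> costs the length of \<open>y\<close> divided by \<open>\<tau>\<close>. The
  average length is of order \<open>L / M\<close>, comparable to \<open>1 / \<rho>\<close>, and the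
  side \<open>L\<close> cancels.\<close>

lemma le3_gap:
  assumes L: "L > 0" and F: "F \<subseteq> freq_lattice L" and \<tau>: "\<tau> > 0" and \<rho>: "\<rho> > 0"
    and gap: "\<And>k. k \<in> F \<Longrightarrow> norm k \<ge> \<rho>"
    and b: "le3 L (trig F c) b"
  shows "le3 L (trig F (\<lambda>k. c k * heat \<tau> k)) (ennreal (18 / (\<rho> * \<tau>)) * b)"
proof -
  \<comment> \<open>If both indices of a frequency are below \<open>r\<close> in absolute value,
    then its norm is below \<open>sqrt 2 * (2 * pi / L) * r = \<rho>\<close>.\<close>
  define r where "r = \<rho> * L / (2 * sqrt 2 * pi)"
  have r: "r > 0" using L \<rho> by (simp add: r_def)
  \<comment> \<open>The active coefficients of the kernel have indices up to \<open>M - 2\<close>,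
    which is still below \<open>r\<close>, while \<open>M \<ge> r\<close> keeps the first moment of
    order \<open>L / r\<close>.\<close>
  define M where "M = nat \<lceil>r\<rceil> + 1"
  have M: "M \<ge> 2" "r \<le> M" "real M - 2 < r"
    using r by (auto simp: M_def) linarith+
  have zero: "jackson_coeff L M k = 0" if "k \<in> F" for k
  proof -
    obtain m n where k: "k = freq L m n" using F \<open>k \<in> F\<close> freq_latticeE by blast
    have "\<bar>m\<bar> \<ge> int M - 1 \<or> \<bar>n\<bar> \<ge> int M - 1"
    proof (rule ccontr)
      assume "\<not> ?thesis"
      then have "\<bar>real_of_int m\<bar> \<le> real M - 2" "\<bar>real_of_int n\<bar> \<le> real M - 2" by linarith+
      then have *: "\<bar>real_of_int m\<bar> < r" "\<bar>real_of_int n\<bar> < r" using M by linarith+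
      have "(real_of_int m)\<^sup>2 < r\<^sup>2" "(real_of_int n)\<^sup>2 < r\<^sup>2"
        using power_strict_mono[OF *(1), of 2] power_strict_mono[OF *(2), of 2] by simp_all
      then have "(2 * pi / L)\<^sup>2 * ((real_of_int m)\<^sup>2 + (real_of_int n)\<^sup>2) < (2 * pi / L)\<^sup>2 * (2 * r\<^sup>2)"
        using L by (intro mult_strict_left_mono) auto
      also have "\<dots> = \<rho>\<^sup>2"
        using L by (simp add: r_def power_mult_distrib power_divide)
      finally have "(norm k)\<^sup>2 < \<rho>\<^sup>2"
        unfolding norm2_sq k by (simp add: power_mult_distrib power_divide distrib_left)
      then have "norm k < \<rho>" using \<rho> by (simp add: power2_less_imp_less)
      then show False using gap[OF \<open>k \<in> F\<close>] by simp
    qed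
    then show ?thesis using M by (auto simp: k jackson_coeff_freq[OF L] sinc2_zero)
  qed
  let ?d = "\<lambda>k y. c k * heat \<tau> k * (cis (k \<bullet> y) - 1)"
  have eq: "trig F (\<lambda>k. c k * heat \<tau> k) x = - (\<integral>y. of_real (jackson L M y) * trig F (\<lambda>k. ?d k y) x \<partial>torus_measure L)" for x
  proof -
    have int: "integrable (torus_measure L) (\<lambda>y. of_real (jackson L M y) * (cis (k \<bullet> y) - 1))"
      and I: "(\<integral>y. of_real (jackson L M y) * (cis (k \<bullet> y) - 1) \<partial>torus_measure L) = - 1" if "k \<in> F" for k
    proof -
      have k: "k \<in> freq_lattice L" using that F by auto
      show "integrable (torus_measure L) (\<lambda>y. of_real (jackson L M y) * (cis (k \<bullet> y) - 1))"
        using jackson_coeff_integral(2)[OF L M(1) k] jackson_integral_1(1)[OF L M(1)]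
        by (simp add: right_diff_distrib)
      show "(\<integral>y. of_real (jackson L M y) * (cis (k \<bullet> y) - 1) \<partial>torus_measure L) = - 1"
        using jackson_coeff_integral[OF L M(1) k] jackson_integral_1[OF L M(1)] zero[OF that]
        by (simp add: right_diff_distrib)
    qed
    have "(\<integral>y. of_real (jackson L M y) * trig F (\<lambda>k. ?d k y) x \<partial>torus_measure L)
       = (\<integral>y. (\<Sum>k\<in>F. (c k * heat \<tau> k * cis (k \<bullet> x)) * (of_real (jackson L M y) * (cis (k \<bullet> y) - 1))) \<partial>torus_measure L)"
      unfolding trig_def sum_distrib_left by (intro Bochner_Integration.integral_cong refl sum.cong) (simp add: mult_ac)
    also have "\<dots> = (\<Sum>k\<in>F. (c k * heat \<tau> k * cis (k \<bullet> x)) * (- 1))"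
      by (subst Bochner_Integration.integral_sum) (use int I in auto)
    finally show ?thesis by (simp add: trig_def sum_negf)
  qed
  have "le3 L (trig F (\<lambda>k. c k * heat \<tau> k))
     (\<integral>\<^sup>+y. ennreal (jackson L M y) * (ennreal ((\<bar>cwrap L y $ 1\<bar> + \<bar>cwrap L y $ 2\<bar>) / \<tau>) * b) \<partial>torus_measure L)"
  proof (rule le3_minkowski[OF L sigma_finite_torus[OF L], where G="\<lambda>x y. of_real (jackson L M y) * trig F (\<lambda>k. ?d k y) x"])
    show "(\<lambda>(x, y). of_real (jackson L M y) * trig F (\<lambda>k. ?d k y) x) \<in> borel_measurable (torus_measure L \<Otimes>\<^sub>M torus_measure L)"
      unfolding case_prod_unfold trig_def by measurable
    show "ennreal (norm (trig F (\<lambda>k. c k * heat \<tau> k) x))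
        \<le> (\<integral>\<^sup>+y. ennreal (norm (of_real (jackson L M y) * trig F (\<lambda>k. ?d k y) x)) \<partial>torus_measure L)" for x
      unfolding eq norm_minus_cancel by (rule norm_integral_le_nn)
    show "le3 L (\<lambda>x. of_real (jackson L M y) * trig F (\<lambda>k. ?d k y) x)
       (ennreal (jackson L M y) * (ennreal ((\<bar>cwrap L y $ 1\<bar> + \<bar>cwrap L y $ 2\<bar>) / \<tau>) * b))" for y
    proof -
      \<comment> \<open>Lattice frequencies do not distinguish \<open>y\<close> from its centred
        representative, and the latter gives the shorter increment.\<close>
      have "trig F (\<lambda>k. ?d k y) = trig F (\<lambda>k. ?d k (cwrap L y))"
        using F by (intro trig_cong) (auto simp: cis_cwrap[OF L])
      then have "le3 L (trig F (\<lambda>k. ?d k y)) (ennreal ((\<bar>cwrap L y $ 1\<bar> + \<bar>cwrap L y $ 2\<bar>) / \<tau>) * b)"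
        using le3_heat_increment[OF L F \<tau> b, of "cwrap L y"] by simp
      from le3_cmult[OF _ this, of "of_real (jackson L M y)"] show ?thesis
        by (simp add: jackson_nonneg)
    qed
  qed measurable
  also have "(\<integral>\<^sup>+y. ennreal (jackson L M y) * (ennreal ((\<bar>cwrap L y $ 1\<bar> + \<bar>cwrap L y $ 2\<bar>) / \<tau>) * b) \<partial>torus_measure L)
    = (\<integral>\<^sup>+y. ennreal (jackson L M y * \<bar>cwrap L y $ 1\<bar>) + ennreal (jackson L M y * \<bar>cwrap L y $ 2\<bar>) \<partial>torus_measure L) * (ennreal (1 / \<tau>) * b)"
  proof (subst nn_integral_multc[symmetric])
    show "(\<lambda>y. ennreal (jackson L M y * \<bar>cwrap L y $ 1\<bar>) + ennreal (jackson L M y * \<bar>cwrap L y $ 2\<bar>)) \<in> borel_measurable (torus_measure L)"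
      by measurable
    show "(\<integral>\<^sup>+y. ennreal (jackson L M y) * (ennreal ((\<bar>cwrap L y $ 1\<bar> + \<bar>cwrap L y $ 2\<bar>) / \<tau>) * b) \<partial>torus_measure L)
      = (\<integral>\<^sup>+y. (ennreal (jackson L M y * \<bar>cwrap L y $ 1\<bar>) + ennreal (jackson L M y * \<bar>cwrap L y $ 2\<bar>)) * (ennreal (1 / \<tau>) * b) \<partial>torus_measure L)"
    proof (intro nn_integral_cong)
      fix y
      have "ennreal (jackson L M y * \<bar>cwrap L y $ 1\<bar>) + ennreal (jackson L M y * \<bar>cwrap L y $ 2\<bar>)
        = ennreal (jackson L M y) * ennreal (\<bar>cwrap L y $ 1\<bar> + \<bar>cwrap L y $ 2\<bar>)"
        by (simp add: jackson_nonneg distrib_left ennreal_mult)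
      moreover have "ennreal ((\<bar>cwrap L y $ 1\<bar> + \<bar>cwrap L y $ 2\<bar>) / \<tau>) = ennreal (\<bar>cwrap L y $ 1\<bar> + \<bar>cwrap L y $ 2\<bar>) * ennreal (1 / \<tau>)"
        using \<tau> by (subst ennreal_mult[symmetric]) auto
      ultimately show "ennreal (jackson L M y) * (ennreal ((\<bar>cwrap L y $ 1\<bar> + \<bar>cwrap L y $ 2\<bar>) / \<tau>) * b)
        = (ennreal (jackson L M y * \<bar>cwrap L y $ 1\<bar>) + ennreal (jackson L M y * \<bar>cwrap L y $ 2\<bar>)) * (ennreal (1 / \<tau>) * b)"
        by (simp add: mult_ac)
    qed
  qed
  finally show ?thesis
  proof (rule le3_mono)
    have "(\<integral>\<^sup>+y. ennreal (jackson L M y * \<bar>cwrap L y $ 1\<bar>) + ennreal (jackson L M y * \<bar>cwrap L y $ 2\<bar>) \<partial>torus_measure L)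
      \<le> ennreal (L / M) + ennreal (L / M)"
      by (subst nn_integral_add) (auto intro!: add_mono jackson_moment L M(1))
    also have "\<dots> = ennreal (2 * L / M)" using L by (simp flip: ennreal_plus)
    also have "\<dots> \<le> ennreal (18 / \<rho>)"
    proof (rule ennreal_leI)
      \<comment> \<open>The constant 18 is an upper bound for \<open>4 * sqrt 2 * pi\<close>, where
        \<open>r\<close> contributes \<open>2 * sqrt 2 * pi\<close> and the two coordinates of
        \<open>y\<close> contribute the remaining factor 2.\<close>
      have "2 * L / M \<le> 2 * L / r" using M r L by (intro divide_left_mono) auto
      also have "\<dots> = 4 * (sqrt 2 * pi) / \<rho>" using L \<rho> by (simp add: r_def field_simps)
      also have "\<dots> \<le> 18 / \<rho>"
      proof (intro divide_right_mono)
        have "sqrt 2 \<le> 1.42" by (rule real_le_lsqrt) (auto simp: power2_eq_square)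
        then have "sqrt 2 * pi \<le> 1.42 * 3.15" using pi_approx by (intro mult_mono) auto
        then show "4 * (sqrt 2 * pi) \<le> 18" by (simp add: mult.commute)
      qed (use \<rho> in simp)
      finally show "2 * L / M \<le> 18 / \<rho>" .
    qed
    finally have "(\<integral>\<^sup>+y. ennreal (jackson L M y * \<bar>cwrap L y $ 1\<bar>) + ennreal (jackson L M y * \<bar>cwrap L y $ 2\<bar>) \<partial>torus_measure L) * (ennreal (1 / \<tau>) * b)
      \<le> ennreal (18 / \<rho>) * (ennreal (1 / \<tau>) * b)"
      by (intro mult_right_mono) auto
    also have "\<dots> = ennreal (18 / (\<rho> * \<tau>)) * b"
      using \<rho> \<tau> by (simp add: ennreal_mult[symmetric] mult.assoc[symmetric])
    finally show "(\<integral>\<^sup>+y. ennreal (jackson L M y * \<bar>cwrap L y $ 1\<bar>) + ennreal (jackson L M y * \<bar>cwrap L y $ 2\<bar>) \<partial>torus_measure L) * (ennreal (1 / \<tau>) * b)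
      \<le> ennreal (18 / (\<rho> * \<tau>)) * b" .
  qed
qed

text \<open>The smaller of 1 and a positive number is at most any power of that number with exponent
  between 0 and 1; the two bounds compared are the contraction \<open>le3_heat\<close> and the gap
  estimate.\<close>

lemma le3_heat_interp:
  assumes L: "L > 0" and F: "F \<subseteq> freq_lattice L" and \<tau>: "\<tau> > 0" and \<rho>: "\<rho> > 0"
    and gap: "\<And>k. k \<in> F \<Longrightarrow> norm k \<ge> \<rho>" and X: "X \<ge> 0" and \<sigma>: "0 \<le> \<sigma>" "\<sigma> \<le> 1"
    and b: "le3 L (trig F c) (ennreal X)"
  shows "le3 L (trig F (\<lambda>k. c k * heat \<tau> k)) (ennreal (X * (18 / (\<rho> * \<tau>)) powr \<sigma>))"
proof (cases "18 / (\<rho> * \<tau>) \<le> 1")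
  case True
  have "18 / (\<rho> * \<tau>) \<le> (18 / (\<rho> * \<tau>)) powr \<sigma>"
    using powr_mono'[of \<sigma> 1 "18 / (\<rho> * \<tau>)"] True \<rho> \<tau> \<sigma> by simp
  then have "18 / (\<rho> * \<tau>) * X \<le> X * (18 / (\<rho> * \<tau>)) powr \<sigma>"
    using mult_left_mono[OF _ X] by (simp only: mult.commute[of _ X])
  then have "ennreal (18 / (\<rho> * \<tau>)) * ennreal X \<le> ennreal (X * (18 / (\<rho> * \<tau>)) powr \<sigma>)"
    using \<rho> \<tau> X by (subst ennreal_mult[symmetric]) (simp_all only: ennreal_leI divide_nonneg_pos mult_pos_pos zero_le_numeral)
  moreover have "le3 L (trig F (\<lambda>k. c k * heat \<tau> k)) (ennreal (18 / (\<rho> * \<tau>)) * ennreal X)"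
    by (rule le3_gap[OF L F \<tau> \<rho> _ b]) (rule gap)
  ultimately show ?thesis by (rule le3_mono[rotated])
next
  case False
  then have "1 \<le> (18 / (\<rho> * \<tau>)) powr \<sigma>" using \<sigma> by (intro ge_one_powr_ge_zero) auto
  then have "X * 1 \<le> X * (18 / (\<rho> * \<tau>)) powr \<sigma>" using X by (intro mult_left_mono) auto
  then show ?thesis
    by (intro le3_mono[OF le3_heat[OF L F b]] ennreal_leI) simp
qed

section \<open>Decay of the heat flow from the low-frequency seminorm\<close>

lemma sum_powr_le:
  fixes J :: int assumes "\<sigma> > 0"
  shows "(\<Sum>j\<in>{J..0}. 2 powr (\<sigma> * real_of_int j)) \<le> 1 / (1 - 2 powr (- \<sigma>))"
proof -
  define q where "q = 2 powr (- \<sigma>)"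
  have q: "0 \<le> q" "q < 1" using assms by (auto simp: q_def powr_less_one)
  \<comment> \<open>The intersection with \<open>{n. J \<le> 0}\<close> empties the index set when
    \<open>J > 0\<close>, as is the case for the interval on the left.\<close>
  have "(\<Sum>j\<in>{J..0}. 2 powr (\<sigma> * real_of_int j)) = (\<Sum>n\<in>{..nat (- J)} \<inter> {n. J \<le> 0}. q ^ n)"
    by (rule sum.reindex_bij_witness[of _ "\<lambda>n. - int n" "\<lambda>j. nat (- j)"])
       (auto simp: q_def powr_powr simp flip: powr_realpow split: if_splits)
  also have "\<dots> \<le> (\<Sum>n. q ^ n)"
    using q by (intro sum_le_suminf summable_geometric) auto
  also have "\<dots> = 1 / (1 - q)" using q by (intro suminf_geometric) auto
  finally show ?thesis by (simp add: q_def)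
qed

text \<open>The endpoints of the supporting interval become parameters because the lower one,
  \<open>a\<close>, enters the constants.\<close>

definition dyadic_partition :: "(real \<Rightarrow> real) \<Rightarrow> real \<Rightarrow> real \<Rightarrow> bool" where
  "dyadic_partition \<phi> a b \<longleftrightarrow> 0 < a \<and> a < b \<and> (\<forall>r. r \<notin> {a..b} \<longrightarrow> \<phi> r = 0) \<and>
     (\<forall>r>0. ((\<lambda>j::int. \<phi> (2 powi (- j) * r)) has_sum 1) UNIV)"

definition block_coeff :: "(real \<Rightarrow> real) \<Rightarrow> int \<Rightarrow> (plane \<Rightarrow> complex) \<Rightarrow> plane \<Rightarrow> complex" where
  "block_coeff \<phi> j c k = of_real (\<phi> (2 powi (- j) * norm k)) * c k"

text \<open>
  The blocks with \<open>j > 0\<close> need no estimate: the high-frequency part is the function minus its blocks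
  with \<open>j \<le> 0\<close>, and it decays because of the spectral gap.
\<close>

lemma heat_decay_low:
  assumes \<phi>: "dyadic_partition \<phi> a b" and s: "0 < s" "s < 1"
    and L: "L > 0" and F: "finite F" "F \<subseteq> freq_lattice L - {0}"
    and A: "A > 0" and B: "B \<ge> 0"
    and hA: "le3 L (trig F c) (ennreal A)"
    and hB: "\<And>j. j \<le> 0 \<Longrightarrow> le3 L (trig F (block_coeff \<phi> j c)) (ennreal (2 powr (s * real_of_int j) * B))"
    and \<tau>: "\<tau> > 0"
  shows "le3 L (trig F (\<lambda>k. c k * heat \<tau> k))
    (ennreal ((18 / a) powr (s / 2) * (1 + 2 / (1 - 2 powr (- (s / 2)))) * (A + B) * \<tau> powr (- (s / 2))))"
proof -
  define G where "G = 1 / (1 - 2 powr (- (s / 2)))"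
  have G: "G \<ge> 0" using s by (simp add: G_def powr_less_one less_imp_le)
  have a: "0 < a" "a < b" and supp: "\<And>r. r \<notin> {a..b} \<Longrightarrow> \<phi> r = 0"
    and part: "\<And>r. r > 0 \<Longrightarrow> ((\<lambda>j::int. \<phi> (2 powi (- j) * r)) has_sum 1) UNIV"
    using \<phi> by (auto simp: dyadic_partition_def)
  have FL: "F \<subseteq> freq_lattice L" using F by auto
  have pk: "norm k > 0" if "k \<in> F" for k using that F by auto
  obtain \<delta> where \<delta>: "\<delta> > 0" "\<And>k. k \<in> F \<Longrightarrow> \<delta> \<le> norm k"
  proof (cases "F = {}")
    case True then show ?thesis using that[of 1] by auto
  next
    case False
    show ?thesis
      by (rule that[of "Min (norm ` F)"]) (use False F pk in auto)
  qed
  \<comment> \<open>Finitely many nonzero frequencies stay away from 0, so all blocks below some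
    \<open>J\<close> vanish on \<open>F\<close>. The number \<open>J\<close> depends on
    \<open>F\<close>, but the geometric sums below are bounded uniformly in it.\<close>
  obtain J :: int where J: "\<And>j. j < J \<Longrightarrow> 2 powi (- j) * \<delta> > b"
  proof -
    obtain n :: nat where n: "b / \<delta> < 2 ^ n" using real_arch_pow[of 2 "b / \<delta>"] by auto
    show ?thesis
    proof (rule that[of "- int n"])
      fix j :: int assume "j < - int n"
      then have "(2::real) powi int n \<le> 2 powi (- j)" by (intro power_int_increasing) auto
      then have "b / \<delta> < 2 powi (- j)" using n by simp
      then show "2 powi (- j) * \<delta> > b" using \<delta> by (simp add: field_simps)
    qed
  qed
  have van: "\<phi> (2 powi (- j) * norm k) = 0" if "j < J" "k \<in> F" for j k
  proof -
    have "b < 2 powi (- j) * \<delta>" using J that by auto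
    also have "\<dots> \<le> 2 powi (- j) * norm k" using \<delta>(2)[OF that(2)] by (intro mult_left_mono) auto
    finally show ?thesis by (intro supp) auto
  qed
  define ch where "ch k = c k - (\<Sum>j\<in>{J..0}. block_coeff \<phi> j c k)" for k
  have ch0: "ch k = 0" if "k \<in> F" "norm k < a" for k
  proof -
    \<comment> \<open>Blocks below \<open>J\<close> vanish by the choice of \<open>J\<close>; those
      with \<open>j > 0\<close> because \<open>norm k < a\<close> puts
      \<open>2 powi (- j) * norm k\<close> below the support of \<open>\<phi>\<close>. The blocks
      from \<open>J\<close> to 0 thus already sum to the whole at \<open>k\<close>, and the
      remainder \<open>ch\<close> has the gap \<open>a\<close>.\<close>
    have "\<phi> (2 powi (- j) * norm k) = 0" if "j \<notin> {J..0}" for j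
    proof (cases "j < J")
      case False
      then have "j > 0" using that by auto
      then have "(2::real) powi (- j) \<le> 2 powi 0" by (intro power_int_increasing) auto
      then have "2 powi (- j) * norm k \<le> 1 * norm k" by (intro mult_right_mono) auto
      then show ?thesis using \<open>norm k < a\<close> by (intro supp) auto
    qed (use van \<open>k \<in> F\<close> in auto)
    then have "((\<lambda>j::int. \<phi> (2 powi (- j) * norm k)) has_sum 1) UNIV
        \<longleftrightarrow> ((\<lambda>j::int. \<phi> (2 powi (- j) * norm k)) has_sum 1) {J..0}"
      by (intro has_sum_cong_neutral) auto
    then have "((\<lambda>j::int. \<phi> (2 powi (- j) * norm k)) has_sum 1) {J..0}"
      using part[OF pk[OF \<open>k \<in> F\<close>]] by simp
    then have "(\<Sum>j\<in>{J..0}. \<phi> (2 powi (- j) * norm k)) = 1"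
      by (simp add: has_sum_finite_iff)
    then have "(\<Sum>j\<in>{J..0}. block_coeff \<phi> j c k) = c k"
      unfolding block_coeff_def by (simp flip: sum_distrib_right of_real_sum)
    then show ?thesis by (simp add: ch_def)
  qed
  \<comment> \<open>The gap estimate requires a gap of the index set, whereas here the coefficients
    vanish at low frequencies; the index set is cut down to their support.\<close>
  have restr: "trig F d = trig {k\<in>F. d k \<noteq> 0} d" for d
    unfolding trig_def[abs_def] using F by (intro ext sum.mono_neutral_right) auto
  have interp: "le3 L (trig F (\<lambda>k. d k * heat \<tau> k)) (ennreal (X * (18 / (\<rho> * \<tau>)) powr (s / 2)))"
    if "\<rho> > 0" "\<And>k. k \<in> F \<Longrightarrow> norm k < \<rho> \<Longrightarrow> d k = 0" "X \<ge> 0" "le3 L (trig F d) (ennreal X)" for d \<rho> X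
  proof -
    have "le3 L (trig {k\<in>F. d k \<noteq> 0} (\<lambda>k. d k * heat \<tau> k)) (ennreal (X * (18 / (\<rho> * \<tau>)) powr (s / 2)))"
      by (rule le3_heat_interp[OF L _ \<tau>]) (use that s FL restr[of d] in \<open>force+\<close>)
    also have "trig {k\<in>F. d k \<noteq> 0} (\<lambda>k. d k * heat \<tau> k) = trig F (\<lambda>k. d k * heat \<tau> k)"
      unfolding trig_def[abs_def] using F by (intro ext sum.mono_neutral_left) auto
    finally show ?thesis .
  qed
  define w where "w = (18 / (a * \<tau>)) powr (s / 2)"
  have w: "w \<ge> 0" by (simp add: w_def)
  \<comment> \<open>Block \<open>j\<close> has the gap \<open>a * 2 powi j\<close>. Interpolation
    with exponent \<open>s / 2\<close> loses \<open>2 powr (- s / 2 * j)\<close> against the gain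
    \<open>2 powr (s * j)\<close> of the seminorm, and the remaining
    \<open>2 powr (s / 2 * j)\<close> is summable over \<open>j \<le> 0\<close>.\<close>
  have blk: "le3 L (trig F (\<lambda>k. block_coeff \<phi> j c k * heat \<tau> k)) (ennreal (B * w * 2 powr (s / 2 * real_of_int j)))"
    if j: "j \<in> {J..0}" for j
  proof -
    have "le3 L (trig F (\<lambda>k. block_coeff \<phi> j c k * heat \<tau> k))
       (ennreal (2 powr (s * real_of_int j) * B * (18 / (a * 2 powi j * \<tau>)) powr (s / 2)))"
    proof (rule interp)
      show "le3 L (trig F (block_coeff \<phi> j c)) (ennreal (2 powr (s * real_of_int j) * B))"
        using hB j by auto
      fix k assume "k \<in> F" "norm k < a * 2 powi j"
      then have "2 powi (- j) * norm k < a" by (simp add: power_int_minus field_simps)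
      then show "block_coeff \<phi> j c k = 0" using supp by (simp add: block_coeff_def)
    qed (use a B in auto)
    also have "2 powr (s * real_of_int j) * B * (18 / (a * 2 powi j * \<tau>)) powr (s / 2) = B * w * 2 powr (s / 2 * real_of_int j)"
    proof -
      have "18 / (a * 2 powi j * \<tau>) = 18 / (a * \<tau>) * 2 powr (- real_of_int j)"
        by (simp add: powr_minus powr_real_of_int' divide_inverse)
      then have "(18 / (a * 2 powi j * \<tau>)) powr (s / 2) = (18 / (a * \<tau>) * 2 powr (- real_of_int j)) powr (s / 2)"
        by (simp only:)
      also have "\<dots> = w * (2 powr (- real_of_int j)) powr (s / 2)"
        unfolding w_def by (rule powr_mult)
      also have "(2 powr (- real_of_int j)) powr (s / 2) = 2 powr (- (s / 2 * real_of_int j))"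
        by (simp add: powr_powr mult.commute)
      finally have "(18 / (a * 2 powi j * \<tau>)) powr (s / 2) = w * 2 powr (- (s / 2 * real_of_int j))" .
      moreover have "2 powr (s * real_of_int j) = 2 powr (s / 2 * real_of_int j) * 2 powr (s / 2 * real_of_int j)"
        by (simp flip: powr_add)
      ultimately show ?thesis by (simp add: powr_minus field_simps)
    qed
    finally show ?thesis .
  qed
  have sumG: "(\<Sum>j\<in>{J..0}. 2 powr (s / 2 * real_of_int j)) \<le> G"
    unfolding G_def using s by (intro sum_powr_le) auto
  have low: "le3 L (\<lambda>x. \<Sum>j\<in>{J..0}. trig F (\<lambda>k. block_coeff \<phi> j c k * heat \<tau> k) x) (ennreal (B * w * G))"
  proof (rule le3_mono[OF le3_sum[OF L _ _ blk]])
    have "(\<Sum>j\<in>{J..0}. ennreal (B * w * 2 powr (s / 2 * real_of_int j)))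
       = ennreal (B * w * (\<Sum>j\<in>{J..0}. 2 powr (s / 2 * real_of_int j)))"
      using B w by (subst sum_ennreal) (auto simp: sum_distrib_left)
    also have "\<dots> \<le> ennreal (B * w * G)"
      using B w sumG by (intro ennreal_leI mult_left_mono) auto
    finally show "(\<Sum>j\<in>{J..0}. ennreal (B * w * 2 powr (s / 2 * real_of_int j))) \<le> ennreal (B * w * G)" .
  qed auto
  have "le3 L (trig F ch) (ennreal (A + B * G))"
  proof -
    have "le3 L (\<lambda>x. (- 1) * (\<Sum>j\<in>{J..0}. trig F (block_coeff \<phi> j c) x))
        (ennreal (norm (- 1 :: complex)) * (\<Sum>j\<in>{J..0}. ennreal (2 powr (s * real_of_int j) * B)))"
      by (intro le3_cmult le3_sum L hB) auto
    then have "le3 L (\<lambda>x. trig F c x + (- 1) * (\<Sum>j\<in>{J..0}. trig F (block_coeff \<phi> j c) x))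
        (ennreal A + ennreal (norm (- 1 :: complex)) * (\<Sum>j\<in>{J..0}. ennreal (2 powr (s * real_of_int j) * B)))"
      by (intro le3_add hA L) measurable
    also have "(\<lambda>x. trig F c x + (- 1) * (\<Sum>j\<in>{J..0}. trig F (block_coeff \<phi> j c) x)) = trig F ch"
      unfolding trig_def ch_def
      by (subst sum.swap) (simp add: sum_subtractf sum_negf algebra_simps sum_distrib_left)
    finally show ?thesis
    proof (rule le3_mono)
      \<comment> \<open>As \<open>j \<le> 0\<close>, halving the exponent only increases the terms,
        and the same constant \<open>G\<close> serves for both sums.\<close>
      have "(\<Sum>j\<in>{J..0}. 2 powr (s * real_of_int j) * B) \<le> (\<Sum>j\<in>{J..0}. 2 powr (s / 2 * real_of_int j) * B)"
      proof (intro sum_mono mult_right_mono B)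
        fix j :: int assume "j \<in> {J..0}"
        then have "s * real_of_int j \<le> s / 2 * real_of_int j"
          using s by (intro mult_right_mono_neg) auto
        then show "2 powr (s * real_of_int j) \<le> 2 powr (s / 2 * real_of_int j)" by simp
      qed
      also have "\<dots> \<le> B * G" using mult_right_mono[OF sumG B] by (simp only: sum_distrib_right mult.commute[of B G])
      finally have "ennreal A + ennreal (\<Sum>j\<in>{J..0}. 2 powr (s * real_of_int j) * B) \<le> ennreal (A + B * G)"
        using A B by (subst ennreal_plus[symmetric]) (auto intro!: ennreal_leI sum_nonneg)
      then show "ennreal A + ennreal (norm (- 1 :: complex)) * (\<Sum>j\<in>{J..0}. ennreal (2 powr (s * real_of_int j) * B)) \<le> ennreal (A + B * G)"
        using B by (simp add: sum_ennreal)
    qed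
  qed
  then have high: "le3 L (trig F (\<lambda>k. ch k * heat \<tau> k)) (ennreal ((A + B * G) * w))"
    unfolding w_def using A B G a ch0 by (intro interp) auto
  have "le3 L (\<lambda>x. (\<Sum>j\<in>{J..0}. trig F (\<lambda>k. block_coeff \<phi> j c k * heat \<tau> k) x) + trig F (\<lambda>k. ch k * heat \<tau> k) x)
     (ennreal (B * w * G) + ennreal ((A + B * G) * w))"
    by (intro le3_add low high L) measurable
  also have "(\<lambda>x. (\<Sum>j\<in>{J..0}. trig F (\<lambda>k. block_coeff \<phi> j c k * heat \<tau> k) x) + trig F (\<lambda>k. ch k * heat \<tau> k) x)
      = trig F (\<lambda>k. c k * heat \<tau> k)"
    unfolding trig_def ch_def
    by (subst sum.swap) (simp add: sum_subtractf algebra_simps sum_distrib_left sum_distrib_right sum.distrib)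
  finally show ?thesis
  proof (rule le3_mono)
    have "ennreal (B * w * G) + ennreal ((A + B * G) * w) = ennreal (B * w * G + (A + B * G) * w)"
      using A B G w by (subst ennreal_plus) auto
    also have "\<dots> \<le> ennreal ((1 + 2 * G) * (A + B) * w)"
    proof (rule ennreal_leI)
      have "0 \<le> B * w + 2 * (A * G * w)" using A B G w by auto
      then show "B * w * G + (A + B * G) * w \<le> (1 + 2 * G) * (A + B) * w"
        by (simp add: algebra_simps)
    qed
    also have "(1 + 2 * G) * (A + B) * w = (18 / a) powr (s / 2) * (1 + 2 / (1 - 2 powr (- (s / 2)))) * (A + B) * \<tau> powr (- (s / 2))"
    proof -
      have "w = (18 / a * (1 / \<tau>)) powr (s / 2)" by (simp add: w_def)
      also have "\<dots> = (18 / a) powr (s / 2) * (1 / \<tau>) powr (s / 2)" by (rule powr_mult)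
      also have "(1 / \<tau>) powr (s / 2) = \<tau> powr (- (s / 2))"
        using \<tau> by (simp add: powr_divide powr_minus_divide)
      finally have "w = (18 / a) powr (s / 2) * \<tau> powr (- (s / 2))" .
      then show ?thesis by (simp add: G_def mult_ac)
    qed
    finally show "ennreal (B * w * G) + ennreal ((A + B * G) * w)
       \<le> ennreal ((18 / a) powr (s / 2) * (1 + 2 / (1 - 2 powr (- (s / 2)))) * (A + B) * \<tau> powr (- (s / 2)))" .
  qed
qed

text \<open>The smaller of two bounds is at most their geometric mean. Taken between the contraction
  bound \<open>A\<close> and the decaying bound of \<open>heat_decay_low\<close>, this halves the
  exponent but leaves a constant whose square is linear in \<open>B\<close>.\<close>

lemma heat_decay:
  assumes \<phi>: "dyadic_partition \<phi> a b" and s: "0 < s" "s < 1"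
    and L: "L > 0" and F: "finite F" "F \<subseteq> freq_lattice L - {0}"
    and A: "A > 0" and B: "B \<ge> 0"
    and hA: "le3 L (trig F c) (ennreal A)"
    and hB: "\<And>j. j \<le> 0 \<Longrightarrow> le3 L (trig F (block_coeff \<phi> j c)) (ennreal (2 powr (s * real_of_int j) * B))"
    and \<tau>: "\<tau> > 0" and C: "C = sqrt ((18 / a) powr (s / 2) * (1 + 2 / (1 - 2 powr (- (s / 2)))))"
  shows "le3 L (trig F (\<lambda>k. c k * heat \<tau> k)) (ennreal (C * sqrt (A * (A + B)) * \<tau> powr (- (s / 4))))"
proof -
  define X where "X = (18 / a) powr (s / 2) * (1 + 2 / (1 - 2 powr (- (s / 2)))) * (A + B) * \<tau> powr (- (s / 2))"
  have "1 + 2 / (1 - 2 powr (- (s / 2))) \<ge> 0" using s by (simp add: powr_less_one less_imp_le)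
  then have X: "X \<ge> 0" unfolding X_def using A B by (intro mult_nonneg_nonneg) auto
  have "F \<subseteq> freq_lattice L" using F by auto
  note le = le3_heat[OF L this hA, of \<tau>] heat_decay_low[OF \<phi> s L F A B hA hB \<tau>, folded X_def]
  have "le3 L (trig F (\<lambda>k. c k * heat \<tau> k)) (ennreal (sqrt (A * X)))"
  proof (cases "A \<le> X")
    case True
    then have "A \<le> sqrt (A * X)" using A by (intro real_le_rsqrt) (simp add: power2_eq_square)
    then show ?thesis by (intro le3_mono[OF le(1)] ennreal_leI)
  next
    case False
    then have "X \<le> sqrt (A * X)" using X by (intro real_le_rsqrt) (simp add: power2_eq_square mult_right_mono)
    then show ?thesis by (intro le3_mono[OF le(2)] ennreal_leI)
  qed
  also have "sqrt (A * X) = C * sqrt (A * (A + B)) * sqrt (\<tau> powr (- (s / 2)))"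
    by (simp add: X_def C real_sqrt_mult mult_ac)
  also have "sqrt (\<tau> powr (- (s / 2))) = \<tau> powr (- (s / 4))"
    by (rule real_sqrt_unique) (simp_all add: power2_eq_square flip: powr_add)
  finally show ?thesis .
qed

subsection \<open>Integrals over the scales\<close>

abbreviation scales :: "real measure" where "scales \<equiv> restrict_space lborel {0<..}"

text \<open>The integral is split at \<open>\<tau> = r\<close>: near 0 it converges because
  \<open>\<kappa> < 1\<close>, near infinity because \<open>\<kappa> > 0\<close>. The two parts give
  the two summands of the constant.\<close>

lemma nn_integral_scales:
  assumes \<kappa>: "0 < \<kappa>" "\<kappa> < 1" and r: "r \<ge> 0"
  shows "(\<integral>\<^sup>+\<tau>. ennreal (\<tau> powr (- \<kappa>) * min 1 (r / \<tau>)) \<partial>scales) \<le> ennreal (r powr (1 - \<kappa>) * (1 / (1 - \<kappa>) + 1 / \<kappa>))"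
proof (cases "r = 0")
  case True
  have "(\<integral>\<^sup>+\<tau>. ennreal (\<tau> powr (- \<kappa>) * min 1 (r / \<tau>)) \<partial>scales) = (\<integral>\<^sup>+\<tau>. 0 \<partial>scales)"
    by (intro nn_integral_cong) (simp add: True)
  then show ?thesis by simp
next
  case False
  then have r: "r > 0" using r by simp
  let ?f = "\<lambda>\<tau>. if \<tau> \<in> {0..r} then \<tau> powr (- \<kappa>) else 0"
  let ?g = "\<lambda>\<tau>. if \<tau> \<in> {r..} then \<tau> powr (- \<kappa> - 1) else 0"
  have f: "(\<integral>\<^sup>+\<tau>. ennreal (?f \<tau>) \<partial>lborel) = ennreal (r powr (1 - \<kappa>) / (1 - \<kappa>))"
  proof (rule nn_integral_has_integral_lborel)
    show "(?f has_integral (r powr (1 - \<kappa>) / (1 - \<kappa>))) UNIV"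
      unfolding has_integral_restrict_UNIV
      using has_integral_powr_from_0[of "- \<kappa>" r] \<kappa> r by (simp add: add.commute)
  qed auto
  have g: "(\<integral>\<^sup>+\<tau>. ennreal (?g \<tau>) \<partial>lborel) = ennreal (r powr (- \<kappa>) / \<kappa>)"
  proof (rule nn_integral_has_integral_lborel)
    show "(?g has_integral (r powr (- \<kappa>) / \<kappa>)) UNIV"
      unfolding has_integral_restrict_UNIV
      using has_integral_powr_to_inf[of "- \<kappa> - 1" r] \<kappa> r by simp
  qed auto
  have "(\<integral>\<^sup>+\<tau>. ennreal (\<tau> powr (- \<kappa>) * min 1 (r / \<tau>)) \<partial>scales)
      = (\<integral>\<^sup>+\<tau>. ennreal (\<tau> powr (- \<kappa>) * min 1 (r / \<tau>)) * indicator {0<..} \<tau> \<partial>lborel)"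
    by (rule nn_integral_restrict_space) simp
  also have "\<dots> \<le> (\<integral>\<^sup>+\<tau>. ennreal (?f \<tau>) + ennreal r * ennreal (?g \<tau>) \<partial>lborel)"
  proof (intro nn_integral_mono)
    fix \<tau> :: real
    show "ennreal (\<tau> powr (- \<kappa>) * min 1 (r / \<tau>)) * indicator {0<..} \<tau> \<le> ennreal (?f \<tau>) + ennreal r * ennreal (?g \<tau>)"
    proof (cases "\<tau> > 0")
      case True
      show ?thesis
      proof (cases "\<tau> \<le> r")
        case True
        have "\<tau> powr (- \<kappa>) * min 1 (r / \<tau>) \<le> \<tau> powr (- \<kappa>) * 1" by (intro mult_left_mono) auto
        then have "ennreal (\<tau> powr (- \<kappa>) * min 1 (r / \<tau>)) \<le> ennreal (?f \<tau>)"
          using True \<open>\<tau> > 0\<close> by (intro ennreal_leI) auto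
        then show ?thesis using \<open>\<tau> > 0\<close> by (simp add: add_increasing2)
      next
        case False
        have "\<tau> powr (- \<kappa>) * min 1 (r / \<tau>) \<le> \<tau> powr (- \<kappa>) * (r / \<tau>)" by (intro mult_left_mono) auto
        also have "\<dots> = r * \<tau> powr (- \<kappa> - 1)" using \<open>\<tau> > 0\<close> by (simp add: powr_diff)
        finally have "ennreal (\<tau> powr (- \<kappa>) * min 1 (r / \<tau>)) \<le> ennreal r * ennreal (?g \<tau>)"
          using False \<open>\<tau> > 0\<close> r by (subst ennreal_mult[symmetric]) (auto intro!: ennreal_leI)
        then show ?thesis using \<open>\<tau> > 0\<close> False by simp
      qed
    qed simp
  qed
  also have "\<dots> = (\<integral>\<^sup>+\<tau>. ennreal (?f \<tau>) \<partial>lborel) + ennreal r * (\<integral>\<^sup>+\<tau>. ennreal (?g \<tau>) \<partial>lborel)"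
    by (subst nn_integral_add) (auto simp: nn_integral_cmult)
  also have "\<dots> = ennreal (r powr (1 - \<kappa>) / (1 - \<kappa>)) + ennreal (r * (r powr (- \<kappa>) / \<kappa>))"
    unfolding f g using r \<kappa> by (subst ennreal_mult) auto
  also have "\<dots> = ennreal (r powr (1 - \<kappa>) * (1 / (1 - \<kappa>) + 1 / \<kappa>))"
  proof -
    have "r * r powr (- \<kappa>) = r powr (1 - \<kappa>)" using r by (simp add: powr_diff powr_minus divide_inverse)
    then have e: "r * (r powr (- \<kappa>) / \<kappa>) = r powr (1 - \<kappa>) / \<kappa>"
      by (simp only: times_divide_eq_right)
    have "r powr (1 - \<kappa>) * (1 / (1 - \<kappa>) + 1 / \<kappa>) = r powr (1 - \<kappa>) / (1 - \<kappa>) + r * (r powr (- \<kappa>) / \<kappa>)"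
      unfolding e by (simp add: distrib_left)
    then show ?thesis using \<kappa> r by (simp add: ennreal_plus)
  qed
  finally show ?thesis .
qed

lemma heat_sq: "heat \<tau> k * heat \<tau> k = of_real (exp (- (\<tau>\<^sup>2 * (norm k)\<^sup>2)))"
  by (simp flip: of_real_mult exp_add)

lemma gauss_scales:
  assumes "r > 0"
  shows "integrable scales (\<lambda>\<tau>. exp (- (\<tau>\<^sup>2 * r\<^sup>2)))" "(\<integral>\<tau>. exp (- (\<tau>\<^sup>2 * r\<^sup>2)) \<partial>scales) = sqrt pi / (2 * r)"
proof -
  have "has_bochner_integral lborel (\<lambda>x. indicator {0..} (0 + r * x) *\<^sub>R exp (- (0 + r * x)\<^sup>2)) ((sqrt pi / 2) /\<^sub>R \<bar>r\<bar>)"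
    by (rule lborel_has_bochner_integral_real_affine_iff[THEN iffD1, OF _ gaussian_moment_0]) (use assms in simp)
  also have "(\<lambda>x. indicator {0..} (0 + r * x) *\<^sub>R exp (- (0 + r * x)\<^sup>2)) = (\<lambda>x. indicator {0..} x *\<^sub>R exp (- (x\<^sup>2 * r\<^sup>2)))"
  proof
    fix x
    have "(0 + r * x \<in> {0..}) = (x \<in> {0..})" using assms by (simp add: zero_le_mult_iff)
    moreover have "(0 + r * x)\<^sup>2 = x\<^sup>2 * r\<^sup>2" by (simp add: power_mult_distrib)
    ultimately show "indicator {0..} (0 + r * x) *\<^sub>R exp (- (0 + r * x)\<^sup>2) = indicator {0..} x *\<^sub>R exp (- (x\<^sup>2 * r\<^sup>2))"
      by (simp only: indicator_def)
  qed
  also have "(sqrt pi / 2) /\<^sub>R \<bar>r\<bar> = sqrt pi / (2 * r)" using assms by (simp add: field_simps)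
  finally have *: "has_bochner_integral lborel (\<lambda>x. indicator {0..} x *\<^sub>R exp (- (x\<^sup>2 * r\<^sup>2))) (sqrt pi / (2 * r))" .
  have "has_bochner_integral lborel (\<lambda>x. indicator {0<..} x *\<^sub>R exp (- (x\<^sup>2 * r\<^sup>2))) (sqrt pi / (2 * r))"
    by (rule has_bochner_integralI_AE[OF *]) (auto intro!: AE_I[where N="{0}"] split: split_indicator)
  then show "integrable scales (\<lambda>\<tau>. exp (- (\<tau>\<^sup>2 * r\<^sup>2)))" "(\<integral>\<tau>. exp (- (\<tau>\<^sup>2 * r\<^sup>2)) \<partial>scales) = sqrt pi / (2 * r)"
    by (simp_all add: integrable_restrict_space integral_restrict_space has_bochner_integral_iff)
qed

lemma sigma_finite_scales: "sigma_finite_measure scales"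
  by (rule sigma_finite_measure_restrict_space) (auto intro: sigma_finite_lborel)

text \<open>The Gaussian is kept as a product of two heat factors: one carries the decay of the
  field, while the other pays for an increment or a derivative.\<close>

lemma inverse_norm_scales:
  assumes "norm k > 0"
  shows "integrable scales (\<lambda>\<tau>. heat \<tau> k * heat \<tau> k)"
    "of_real (2 / sqrt pi) * (\<integral>\<tau>. heat \<tau> k * heat \<tau> k \<partial>scales) = complex_of_real (1 / norm k)"
proof -
  show "integrable scales (\<lambda>\<tau>. heat \<tau> k * heat \<tau> k)"
    unfolding heat_sq using gauss_scales(1)[OF assms] by (rule integrable_of_real)
  have I: "(\<integral>\<tau>. heat \<tau> k * heat \<tau> k \<partial>scales) = of_real (sqrt pi / (2 * norm k))"
    unfolding heat_sq by (simp only: integral_complex_of_real gauss_scales(2)[OF assms])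
  have "2 / sqrt pi * (sqrt pi / (2 * norm k)) = 1 / norm k" by simp
  then show "of_real (2 / sqrt pi) * (\<integral>\<tau>. heat \<tau> k * heat \<tau> k \<partial>scales) = complex_of_real (1 / norm k)"
    unfolding I by (metis of_real_mult)
qed

lemma trig_integral:
  assumes "\<And>k. k \<in> F \<Longrightarrow> integrable N (m k)"
  shows "(\<integral>w. trig F (\<lambda>k. d k * m k w) x \<partial>N) = trig F (\<lambda>k. d k * (\<integral>w. m k w \<partial>N)) x"
proof -
  have "(\<integral>w. trig F (\<lambda>k. d k * m k w) x \<partial>N) = (\<integral>w. (\<Sum>k\<in>F. (d k * cis (k \<bullet> x)) * m k w) \<partial>N)"
    unfolding trig_def by (simp only: mult_ac)
  also have "\<dots> = (\<Sum>k\<in>F. (\<integral>w. (d k * cis (k \<bullet> x)) * m k w \<partial>N))"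
    by (rule Bochner_Integration.integral_sum) (intro integrable_mult_right assms)
  also have "\<dots> = trig F (\<lambda>k. d k * (\<integral>w. m k w \<partial>N)) x"
    unfolding trig_def integral_mult_right_zero by (simp only: mult_ac)
  finally show ?thesis .
qed

lemma abs_sum_le_norm2: "\<bar>y $ 1\<bar> + \<bar>y $ 2\<bar> \<le> 2 * norm (y::plane)"
  using component_le_norm_cart[of y 1] component_le_norm_cart[of y 2] by simp

text \<open>At scales below the length of \<open>y\<close> the triangle inequality is used, at
  larger scales the smoothing gains \<open>norm y / \<tau>\<close>; the integral over the scales
  then gives the power \<open>1 - \<kappa>\<close>.\<close>

lemma potential_increment:
  assumes L: "L > 0" and F: "F \<subseteq> freq_lattice L - {0}" and \<kappa>: "0 < \<kappa>" "\<kappa> < 1" and X: "X \<ge> 0"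
    and h: "\<And>\<tau>. \<tau> > 0 \<Longrightarrow> le3 L (trig F (\<lambda>k. c k * heat \<tau> k)) (ennreal (X * \<tau> powr (- \<kappa>)))"
  shows "le3 L (trig F (\<lambda>k. c k * of_real (1 / norm k) * (cis (k \<bullet> y) - 1)))
     (ennreal (3 * (1 / (1 - \<kappa>) + 1 / \<kappa>) * X * norm y powr (1 - \<kappa>)))"
proof -
  have FL: "F \<subseteq> freq_lattice L" using F by auto
  define G where "G x \<tau> = of_real (2 / sqrt pi) * trig F (\<lambda>k. c k * heat \<tau> k * heat \<tau> k * (cis (k \<bullet> y) - 1)) x" for x \<tau>
  have eq: "trig F (\<lambda>k. c k * of_real (1 / norm k) * (cis (k \<bullet> y) - 1)) x = (\<integral>\<tau>. G x \<tau> \<partial>scales)" for x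
  proof -
    have pk: "norm k > 0" if "k \<in> F" for k using that F by auto
    have "G x \<tau> = of_real (2 / sqrt pi) * trig F (\<lambda>k. c k * (cis (k \<bullet> y) - 1) * (heat \<tau> k * heat \<tau> k)) x" for \<tau>
      unfolding G_def by (simp only: mult_ac)
    then have "(\<integral>\<tau>. G x \<tau> \<partial>scales)
       = of_real (2 / sqrt pi) * trig F (\<lambda>k. c k * (cis (k \<bullet> y) - 1) * (\<integral>\<tau>. heat \<tau> k * heat \<tau> k \<partial>scales)) x"
      using trig_integral[OF inverse_norm_scales(1)[OF pk]] by (simp only: integral_mult_right_zero)
    also have "\<dots> = trig F (\<lambda>k. c k * (cis (k \<bullet> y) - 1) * (of_real (2 / sqrt pi) * (\<integral>\<tau>. heat \<tau> k * heat \<tau> k \<partial>scales))) x"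
      unfolding trig_cmult by (simp only: mult_ac)
    also have "\<dots> = trig F (\<lambda>k. c k * of_real (1 / norm k) * (cis (k \<bullet> y) - 1)) x"
      by (rule fun_cong[OF trig_cong]) (simp only: inverse_norm_scales(2)[OF pk] mult_ac)
    finally show ?thesis by simp
  qed
  \<comment> \<open>The 3 absorbs the factor 2 of an increment and the constant
    \<open>2 / sqrt pi\<close>, which is at most 1.2.\<close>
  define bd where "bd \<tau> = 3 * X * (\<tau> powr (- \<kappa>) * min 1 (norm y / \<tau>))" for \<tau>
  have sp: "2 / sqrt pi \<le> 1.2"
  proof -
    have "1.7 \<le> sqrt pi" using pi_approx by (intro real_le_rsqrt) (simp add: power2_eq_square)
    then have "2 / sqrt pi \<le> 2 / 1.7" by (intro divide_left_mono) auto
    then show ?thesis by simp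
  qed
  have "le3 L (trig F (\<lambda>k. c k * of_real (1 / norm k) * (cis (k \<bullet> y) - 1))) (\<integral>\<^sup>+\<tau>. ennreal (bd \<tau>) \<partial>scales)"
  proof (rule le3_minkowski[OF L sigma_finite_scales, where G=G])
    show "(\<lambda>(x, \<tau>). G x \<tau>) \<in> borel_measurable (torus_measure L \<Otimes>\<^sub>M scales)"
    proof -
      have [measurable]: "(\<lambda>\<tau>::real. \<tau>) \<in> borel_measurable scales" by (intro measurable_restrict_space1) simp
      have [measurable]: "snd \<in> borel_measurable (torus_measure L \<Otimes>\<^sub>M scales)"
        using measurable_compose[OF measurable_snd \<open>(\<lambda>\<tau>::real. \<tau>) \<in> borel_measurable scales\<close>] by simp
      show ?thesis unfolding G_def trig_def case_prod_unfold by measurable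
    qed
    show "(\<lambda>\<tau>. ennreal (bd \<tau>)) \<in> borel_measurable scales"
      unfolding bd_def by (intro measurable_restrict_space1) measurable
    show "ennreal (norm (trig F (\<lambda>k. c k * of_real (1 / norm k) * (cis (k \<bullet> y) - 1)) x))
        \<le> (\<integral>\<^sup>+\<tau>. ennreal (norm (G x \<tau>)) \<partial>scales)" for x
      unfolding eq by (rule norm_integral_le_nn)
    fix \<tau> assume "\<tau> \<in> space scales"
    then have \<tau>: "\<tau> > 0" by (simp add: space_restrict_space)
    define Y where "Y = X * \<tau> powr (- \<kappa>)"
    have Y: "Y \<ge> 0" using X by (simp add: Y_def)
    have h\<tau>: "le3 L (trig F (\<lambda>k. c k * heat \<tau> k)) (ennreal Y)" using h[OF \<tau>] by (simp add: Y_def)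
    let ?g = "trig F (\<lambda>k. c k * heat \<tau> k * heat \<tau> k * (cis (k \<bullet> y) - 1))"
    have le1: "le3 L ?g (ennreal (2 * norm y / \<tau> * Y))"
    proof (rule le3_mono[OF le3_heat_increment[OF L FL \<tau> h\<tau>]])
      show "ennreal ((\<bar>y $ 1\<bar> + \<bar>y $ 2\<bar>) / \<tau>) * ennreal Y \<le> ennreal (2 * norm y / \<tau> * Y)"
        using \<tau> Y abs_sum_le_norm2[of y]
        by (subst ennreal_mult[symmetric]) (auto intro!: ennreal_leI mult_right_mono divide_right_mono)
    qed
    have le2: "le3 L ?g (ennreal (2 * Y))"
    proof -
      let ?q = "trig F (\<lambda>k. c k * heat \<tau> k * heat \<tau> k)"
      have q: "le3 L ?q (ennreal Y)" by (rule le3_heat[OF L FL h\<tau>])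
      have "le3 L (\<lambda>x. ?q (x + y) + (- 1) * ?q x) (ennreal Y + ennreal (norm (- 1 :: complex)) * ennreal Y)"
        by (intro le3_add le3_cmult le3_shift L q trig_periodic FL) measurable
      also have "(\<lambda>x. ?q (x + y) + (- 1) * ?q x) = ?g"
        by (simp add: fun_eq_iff trig_shift trig_cmult trig_add algebra_simps)
      also have "ennreal Y + ennreal (norm (- 1 :: complex)) * ennreal Y = ennreal (2 * Y)"
        using Y by (simp flip: ennreal_plus)
      finally show ?thesis .
    qed
    have le: "le3 L ?g (ennreal (2 * Y * min 1 (norm y / \<tau>)))"
      using le1 le2 by (cases "norm y / \<tau> \<le> 1") (auto simp: min_def mult_ac)
    have "le3 L (\<lambda>x. G x \<tau>) (ennreal (norm (complex_of_real (2 / sqrt pi))) * ennreal (2 * Y * min 1 (norm y / \<tau>)))"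
      unfolding G_def by (intro le3_cmult le) measurable
    then show "le3 L (\<lambda>x. G x \<tau>) (ennreal (bd \<tau>))"
    proof (rule le3_mono)
      have "2 / sqrt pi * (2 * Y * min 1 (norm y / \<tau>)) \<le> 1.2 * (2 * Y * min 1 (norm y / \<tau>))"
        using sp Y \<tau> by (intro mult_right_mono) auto
      also have "\<dots> \<le> 1.5 * (2 * Y * min 1 (norm y / \<tau>))"
        using Y \<tau> by (intro mult_right_mono) auto
      also have "\<dots> = bd \<tau>" by (simp add: bd_def Y_def)
      finally show "ennreal (norm (complex_of_real (2 / sqrt pi))) * ennreal (2 * Y * min 1 (norm y / \<tau>)) \<le> ennreal (bd \<tau>)"
        using Y \<tau> by (subst ennreal_mult[symmetric]) (auto intro!: ennreal_leI simp: norm_divide)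
    qed
  qed
  then show ?thesis
  proof (rule le3_mono)
    have "(\<integral>\<^sup>+\<tau>. ennreal (bd \<tau>) \<partial>scales) = (\<integral>\<^sup>+\<tau>. ennreal (3 * X) * ennreal (\<tau> powr (- \<kappa>) * min 1 (norm y / \<tau>)) \<partial>scales)"
      unfolding bd_def using X
      by (intro nn_integral_cong ennreal_mult) (auto simp: space_restrict_space)
    also have "\<dots> = ennreal (3 * X) * (\<integral>\<^sup>+\<tau>. ennreal (\<tau> powr (- \<kappa>) * min 1 (norm y / \<tau>)) \<partial>scales)"
      by (intro nn_integral_cmult measurable_restrict_space1) measurable
    also have "\<dots> \<le> ennreal (3 * X) * ennreal (norm y powr (1 - \<kappa>) * (1 / (1 - \<kappa>) + 1 / \<kappa>))"
      by (intro mult_left_mono nn_integral_scales \<kappa>) auto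
    also have "\<dots> = ennreal (3 * (1 / (1 - \<kappa>) + 1 / \<kappa>) * X * norm y powr (1 - \<kappa>))"
      using X \<kappa> by (subst ennreal_mult[symmetric]) (auto simp: mult_ac)
    finally show "(\<integral>\<^sup>+\<tau>. ennreal (bd \<tau>) \<partial>scales) \<le> ennreal (3 * (1 / (1 - \<kappa>) + 1 / \<kappa>) * X * norm y powr (1 - \<kappa>))" .
  qed
qed

section \<open>The trilinear flux of a trigonometric polynomial\<close>

lemma integrable_torus_bounded:
  fixes f :: "plane \<Rightarrow> 'b::{banach, second_countable_topology}"
  assumes "L > 0" "f \<in> borel_measurable borel" "\<And>x. norm (f x) \<le> B"
  shows "integrable (torus_measure L) f"
proof -
  interpret prob_space "torus_measure L" by (rule prob_space_torus_measure) fact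
  show ?thesis using assms by (intro integrable_const_bound[where B=B]) auto
qed

lemma integral_mult_trig:
  assumes W: "integrable (torus_measure L) W"
  shows "(\<integral>x. W x * trig F d x \<partial>torus_measure L) = (\<Sum>k\<in>F. d k * (\<integral>x. W x * cis (k \<bullet> x) \<partial>torus_measure L))"
proof -
  have [measurable]: "W \<in> borel_measurable borel" using W by auto
  have i: "integrable (torus_measure L) (\<lambda>x. W x * cis (k \<bullet> x))" for k
    by (rule Bochner_Integration.integrable_bound[OF W]) (auto simp: norm_mult)
  have "(\<integral>x. W x * trig F d x \<partial>torus_measure L) = (\<integral>x. (\<Sum>k\<in>F. d k * (W x * cis (k \<bullet> x))) \<partial>torus_measure L)"
    unfolding trig_def sum_distrib_left by (simp only: mult_ac)
  also have "\<dots> = (\<Sum>k\<in>F. (\<integral>x. d k * (W x * cis (k \<bullet> x)) \<partial>torus_measure L))"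
    by (rule Bochner_Integration.integral_sum) (intro integrable_mult_right i)
  finally show ?thesis by simp
qed

lemma powr_norm_le: "0 < \<kappa> \<Longrightarrow> \<kappa> < 1 \<Longrightarrow> norm (y::plane) powr (1 - \<kappa>) \<le> 1 + \<bar>y $ 1\<bar> + \<bar>y $ 2\<bar>"
proof -
  assume \<kappa>: "0 < \<kappa>" "\<kappa> < 1"
  have "norm y powr (1 - \<kappa>) \<le> 1 + norm y"
  proof (cases "norm y \<le> 1")
    case True
    then have "norm y powr (1 - \<kappa>) \<le> 1" using \<kappa> by (intro powr_le1) auto
    then show ?thesis using norm_ge_zero[of y] by linarith
  next
    case False
    then have "norm y powr (1 - \<kappa>) \<le> norm y powr 1" using \<kappa> by (intro powr_mono) auto
    then show ?thesis using False by (simp add: add_increasing)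
  qed
  also have "norm y \<le> \<bar>y $ 1\<bar> + \<bar>y $ 2\<bar>" using norm_le_l1_cart[of y] by (simp add: sum_2)
  finally show ?thesis by simp
qed

text \<open>The power is at most one plus the absolute coordinates, and the resulting products are
  bounded by squares. The three units are a first absolute moment, the second moment of coordinate
  \<open>i\<close>, and half of each second moment.\<close>

lemma gauss2_moment:
  assumes "0 < \<kappa>" "\<kappa> < 1"
  shows "(\<integral>\<^sup>+w. ennreal (\<bar>pt w $ i\<bar> * norm (pt w) powr (1 - \<kappa>)) \<partial>gauss2) \<le> 3"
proof -
  have "(\<integral>\<^sup>+w. ennreal (\<bar>pt w $ i\<bar> * norm (pt w) powr (1 - \<kappa>)) \<partial>gauss2)
     \<le> (\<integral>\<^sup>+w. ennreal \<bar>pt w $ i\<bar> + (ennreal ((pt w $ i)\<^sup>2) + (ennreal (1 / 2) * ennreal ((pt w $ 1)\<^sup>2) + ennreal (1 / 2) * ennreal ((pt w $ 2)\<^sup>2))) \<partial>gauss2)"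
  proof (intro nn_integral_mono)
    fix w
    have "\<bar>pt w $ i\<bar> * norm (pt w) powr (1 - \<kappa>) \<le> \<bar>pt w $ i\<bar> * (1 + \<bar>pt w $ 1\<bar> + \<bar>pt w $ 2\<bar>)"
      using powr_norm_le[OF assms, of "pt w"] by (intro mult_left_mono) auto
    also have "\<dots> \<le> \<bar>pt w $ i\<bar> + ((pt w $ i)\<^sup>2 + (1 / 2 * (pt w $ 1)\<^sup>2 + 1 / 2 * (pt w $ 2)\<^sup>2))"
      using sum_squares_bound[of "\<bar>pt w $ i\<bar>" "\<bar>pt w $ 1\<bar>"] sum_squares_bound[of "\<bar>pt w $ i\<bar>" "\<bar>pt w $ 2\<bar>"]
      by (simp add: distrib_left)
    finally have "ennreal (\<bar>pt w $ i\<bar> * norm (pt w) powr (1 - \<kappa>)) \<le> ennreal (\<bar>pt w $ i\<bar> + ((pt w $ i)\<^sup>2 + (1 / 2 * (pt w $ 1)\<^sup>2 + 1 / 2 * (pt w $ 2)\<^sup>2)))"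
      by (rule ennreal_leI)
    also have "\<dots> = ennreal \<bar>pt w $ i\<bar> + (ennreal ((pt w $ i)\<^sup>2) + (ennreal (1 / 2 * (pt w $ 1)\<^sup>2) + ennreal (1 / 2 * (pt w $ 2)\<^sup>2)))"
      by (simp add: ennreal_plus del: pt_nth)
    also have "ennreal (1 / 2 * (pt w $ 1)\<^sup>2) = ennreal (1 / 2) * ennreal ((pt w $ 1)\<^sup>2)" by (rule ennreal_mult) auto
    also have "ennreal (1 / 2 * (pt w $ 2)\<^sup>2) = ennreal (1 / 2) * ennreal ((pt w $ 2)\<^sup>2)" by (rule ennreal_mult) auto
    finally show "ennreal (\<bar>pt w $ i\<bar> * norm (pt w) powr (1 - \<kappa>)) \<le> ennreal \<bar>pt w $ i\<bar> + (ennreal ((pt w $ i)\<^sup>2) + (ennreal (1 / 2) * ennreal ((pt w $ 1)\<^sup>2) + ennreal (1 / 2) * ennreal ((pt w $ 2)\<^sup>2)))" .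
  qed
  also have "\<dots> = (\<integral>\<^sup>+w. ennreal \<bar>pt w $ i\<bar> \<partial>gauss2) + ((\<integral>\<^sup>+w. ennreal ((pt w $ i)\<^sup>2) \<partial>gauss2)
      + (ennreal (1 / 2) * (\<integral>\<^sup>+w. ennreal ((pt w $ 1)\<^sup>2) \<partial>gauss2) + ennreal (1 / 2) * (\<integral>\<^sup>+w. ennreal ((pt w $ 2)\<^sup>2) \<partial>gauss2)))"
    by (simp add: nn_integral_add nn_integral_cmult del: pt_nth)
  also have "\<dots> = (\<integral>\<^sup>+a. ennreal \<bar>a\<bar> \<partial>gauss) + (1 + (ennreal (1 / 2) * 1 + ennreal (1 / 2) * 1))"
    using nn_integral_gauss2_nth[of "\<lambda>a. ennreal \<bar>a\<bar>"] nn_integral_gauss2_nth[of "\<lambda>a. ennreal (a\<^sup>2)"] gauss_sq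
    by (simp del: pt_nth)
  also have "ennreal (1 / 2) * 1 + ennreal (1 / 2) * 1 = 1"
  proof -
    have "ennreal (1 / 2) * 1 + ennreal (1 / 2) * 1 = ennreal (1 / 2 + 1 / 2)"
      by (subst ennreal_plus) auto
    then show ?thesis by simp
  qed
  also have "(\<integral>\<^sup>+a. ennreal \<bar>a\<bar> \<partial>gauss) + (1 + 1) \<le> 1 + (1 + 1)"
    by (intro add_right_mono gauss_abs)
  finally show ?thesis by simp
qed

lemma le3_dist:
  assumes L: "L > 0" and F: "F \<subseteq> freq_lattice L" and d: "le3 L (trig F d) b"
  shows "le3 L (\<lambda>x. trig F d (x + y) - trig F d (x + z)) (2 * b)"
proof -
  have "le3 L (\<lambda>x. trig F d (x + y) + (- 1) * trig F d (x + z)) (b + ennreal (norm (- 1 :: complex)) * b)"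
    by (intro le3_add le3_cmult le3_shift L d trig_periodic F) measurable
  then show ?thesis by (simp add: mult_2)
qed

text \<open>
  The multiplier is an average of translations against an odd weight, so the integral only sees
  \<open>V (x + z) - V x\<close>; this compensates the singularity of the Riesz kernel.
\<close>

lemma commutator_bound:
  assumes L: "L > 0" and F: "finite F" "F \<subseteq> freq_lattice L" and \<kappa>: "0 < \<kappa>" "\<kappa> < 1"
    and A: "A \<ge> 0" and Y: "Y \<ge> 0" and hA: "le3 L (trig F c) (ennreal A)"
    and V [measurable]: "V \<in> borel_measurable borel" and Vb: "\<And>x. norm (V x) \<le> BV" and Vp: "torus_periodic L V"
    and incr: "\<And>z. le3 L (\<lambda>x. V (x + z) - V x) (ennreal (Y * norm z powr (1 - \<kappa>)))"
    and \<tau>: "\<tau> > 0"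
  shows "norm (\<integral>x. (trig F c x * V x) * trig F (\<lambda>k. c k * (\<i> * of_real (\<tau> * k $ i) * heat \<tau> k)) x \<partial>torus_measure L)
     \<le> 3 / 2 * A\<^sup>2 * Y * \<tau> powr (1 - \<kappa>)"
proof -
  let ?T = "torus_measure L" and ?\<theta> = "trig F c"
  define S where "S = (\<integral>x. (?\<theta> x * V x) * trig F (\<lambda>k. c k * (\<i> * of_real (\<tau> * k $ i) * heat \<tau> k)) x \<partial>?T)"
  define W where "W x = ?\<theta> x * V x" for x
  have BV: "BV \<ge> 0" using Vb[of 0] norm_ge_zero order_trans by blast
  have Wm [measurable]: "W \<in> borel_measurable borel" unfolding W_def by measurable
  have Wi: "integrable ?T W" unfolding W_def
    by (rule integrable_torus_bounded[OF L, where B="(\<Sum>k\<in>F. norm (c k)) * BV"])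
       (auto simp: norm_mult intro!: mult_mono trig_bound Vb sum_nonneg)
  define M where "M k = (\<integral>x. W x * cis (k \<bullet> x) \<partial>?T)" for k
  \<comment> \<open>The correlation of \<open>W\<close> with the translates of
    \<open>?\<theta>\<close>. As a function of the translation it is again a trigonometric
    polynomial, so the Gaussian formula for derivatives applies to it at the point 0.\<close>
  define J where "J = trig F (\<lambda>k. c k * M k)"
  have [measurable]: "J \<in> borel_measurable borel" unfolding J_def by measurable
  have J: "J z = (\<integral>x. W x * ?\<theta> (x + z) \<partial>?T)" for z
  proof -
    have "J z = (\<Sum>k\<in>F. c k * cis (k \<bullet> z) * M k)"
      unfolding J_def trig_def by (simp only: mult_ac)
    also have "\<dots> = (\<integral>x. W x * trig F (\<lambda>k. c k * cis (k \<bullet> z)) x \<partial>?T)"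
      unfolding integral_mult_trig[OF Wi] M_def ..
    finally show ?thesis by (simp only: trig_shift)
  qed
  have S: "S = (\<Sum>k\<in>F. c k * M k * (\<i> * of_real (\<tau> * k $ i) * heat \<tau> k))"
    unfolding S_def W_def[symmetric] integral_mult_trig[OF Wi] M_def[symmetric] by (simp only: mult_ac)
  have JS: "(\<integral>w. of_real (pt w $ i) * J (\<sigma> *\<^sub>R pt w) \<partial>gauss2) = (\<Sum>k\<in>F. c k * M k * (\<i> * of_real (\<sigma> * k $ i) * heat \<sigma> k))" for \<sigma>
    using trig_grad_gauss[OF L F(2), of "\<lambda>k. c k * M k" \<sigma> i 0] by (simp add: J_def trig_def)
  have Ji: "integrable gauss2 (\<lambda>w. of_real (pt w $ i) * J (\<sigma> *\<^sub>R pt w))" for \<sigma>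
  proof (rule Bochner_Integration.integrable_bound)
    show "integrable gauss2 (\<lambda>w. of_real (\<Sum>k\<in>F. norm (c k * M k)) * complex_of_real (pt w $ i))"
      by (intro integrable_mult_right integrable_pt)
    show "AE w in gauss2. norm (of_real (pt w $ i) * J (\<sigma> *\<^sub>R pt w)) \<le> norm (of_real (\<Sum>k\<in>F. norm (c k * M k)) * complex_of_real (pt w $ i))"
    proof (rule AE_I2)
      fix w
      have "norm (J (\<sigma> *\<^sub>R pt w)) \<le> (\<Sum>k\<in>F. norm (c k * M k))" unfolding J_def by (rule trig_bound)
      moreover have "0 \<le> (\<Sum>k\<in>F. norm (c k * M k))" by (intro sum_nonneg) auto
      ultimately show "norm (of_real (pt w $ i) * J (\<sigma> *\<^sub>R pt w)) \<le> norm (of_real (\<Sum>k\<in>F. norm (c k * M k)) * complex_of_real (pt w $ i))"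
        unfolding norm_mult norm_of_real abs_of_nonneg[OF \<open>0 \<le> (\<Sum>k\<in>F. norm (c k * M k))\<close>]
        by (simp only: mult.commute[of "\<bar>pt w $ i\<bar>"] mult_right_mono abs_ge_zero)
    qed
  qed measurable
  \<comment> \<open>Replacing \<open>\<tau>\<close> by \<open>- \<tau>\<close> changes the sign of
    the multiplier and hence of \<open>S\<close>. Symmetrisation produces a difference of
    correlations; its factor 2 and the 3 of \<open>gauss2_moment\<close> make the constant
    \<open>3 / 2\<close>.\<close>
  have two: "2 * S = (\<integral>w. of_real (pt w $ i) * (J (\<tau> *\<^sub>R pt w) - J (- (\<tau> *\<^sub>R pt w))) \<partial>gauss2)"
  proof -
    have "(\<integral>w. of_real (pt w $ i) * J (- \<tau> *\<^sub>R pt w) \<partial>gauss2) = - S"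
      unfolding JS S sum_negf[symmetric] by (intro sum.cong refl) simp
    moreover have "(\<integral>w. of_real (pt w $ i) * J (\<tau> *\<^sub>R pt w) \<partial>gauss2) = S"
      unfolding JS S ..
    moreover have "(\<integral>w. of_real (pt w $ i) * (J (\<tau> *\<^sub>R pt w) - J (- (\<tau> *\<^sub>R pt w))) \<partial>gauss2)
       = (\<integral>w. of_real (pt w $ i) * J (\<tau> *\<^sub>R pt w) \<partial>gauss2) - (\<integral>w. of_real (pt w $ i) * J (- \<tau> *\<^sub>R pt w) \<partial>gauss2)"
      using Bochner_Integration.integral_diff[OF Ji[of \<tau>] Ji[of "- \<tau>"]] by (simp add: right_diff_distrib)
    ultimately show ?thesis by simp
  qed
  \<comment> \<open>A translation by \<open>z\<close> writes \<open>J (- z)\<close> with the same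
    product \<open>?\<theta> x * ?\<theta> (x + z)\<close> as \<open>J z\<close>. Only the positions
    of \<open>V\<close> differ, so an increment of \<open>V\<close> factors out.\<close>
  have Jd: "ennreal (norm (J z - J (- z))) \<le> ennreal (A\<^sup>2 * Y * norm z powr (1 - \<kappa>))" for z
  proof -
    have p: "torus_periodic L (\<lambda>x. W x * ?\<theta> (x - z))"
      unfolding W_def using torus_periodic_shift[OF trig_periodic[OF F(2) L], where y="- z"]
      by (intro torus_periodic_mult trig_periodic F L Vp) simp
    have "J (- z) = (\<integral>x. W (x + z) * ?\<theta> x \<partial>?T)"
      using integral_torus_shift[OF L _ p, of z] unfolding J by simp
    moreover have "integrable ?T (\<lambda>x. W x * ?\<theta> (x + z))" "integrable ?T (\<lambda>x. W (x + z) * ?\<theta> x)"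
      unfolding W_def
      by (rule integrable_torus_bounded[OF L, where B="(\<Sum>k\<in>F. norm (c k)) * BV * (\<Sum>k\<in>F. norm (c k))"],
          measurable, auto simp: norm_mult BV intro!: mult_mono trig_bound Vb sum_nonneg mult_nonneg_nonneg)+
    ultimately have "J z - J (- z) = (\<integral>x. W x * ?\<theta> (x + z) - W (x + z) * ?\<theta> x \<partial>?T)"
      unfolding J[of z] by simp
    also have "\<dots> = - (\<integral>x. ?\<theta> x * ?\<theta> (x + z) * (V (x + z) - V x) \<partial>?T)"
      unfolding Bochner_Integration.integral_minus[symmetric] W_def
      by (intro Bochner_Integration.integral_cong refl) (simp add: algebra_simps)
    finally have "ennreal (norm (J z - J (- z))) \<le> (\<integral>\<^sup>+x. ennreal (norm (?\<theta> x * ?\<theta> (x + z) * (V (x + z) - V x))) \<partial>?T)"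
      using norm_integral_le_nn[of ?T "\<lambda>x. ?\<theta> x * ?\<theta> (x + z) * (V (x + z) - V x)"] by simp
    also have "\<dots> \<le> ennreal A * ennreal A * ennreal (Y * norm z powr (1 - \<kappa>))"
      by (intro le3_hoelder hA incr le3_shift L trig_periodic F) measurable
    also have "\<dots> = ennreal (A\<^sup>2 * Y * norm z powr (1 - \<kappa>))"
      using A Y by (simp add: power2_eq_square mult.assoc flip: ennreal_mult)
    finally show ?thesis .
  qed
  have "ennreal (2 * norm S) \<le> (\<integral>\<^sup>+w. ennreal (norm (of_real (pt w $ i) * (J (\<tau> *\<^sub>R pt w) - J (- (\<tau> *\<^sub>R pt w))))) \<partial>gauss2)"
    using norm_integral_le_nn[of gauss2 "\<lambda>w. of_real (pt w $ i) * (J (\<tau> *\<^sub>R pt w) - J (- (\<tau> *\<^sub>R pt w)))"]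
    unfolding two[symmetric] by (simp add: norm_mult)
  also have "\<dots> \<le> (\<integral>\<^sup>+w. ennreal (A\<^sup>2 * Y * \<tau> powr (1 - \<kappa>)) * ennreal (\<bar>pt w $ i\<bar> * norm (pt w) powr (1 - \<kappa>)) \<partial>gauss2)"
  proof (intro nn_integral_mono)
    fix w
    have "norm (J (\<tau> *\<^sub>R pt w) - J (- (\<tau> *\<^sub>R pt w))) \<le> A\<^sup>2 * Y * norm (\<tau> *\<^sub>R pt w) powr (1 - \<kappa>)"
      using Jd[of "\<tau> *\<^sub>R pt w"] A Y by (subst (asm) ennreal_le_iff) auto
    also have "norm (\<tau> *\<^sub>R pt w) powr (1 - \<kappa>) = \<tau> powr (1 - \<kappa>) * norm (pt w) powr (1 - \<kappa>)"
      using \<tau> by (simp add: powr_mult)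
    finally have "\<bar>pt w $ i\<bar> * norm (J (\<tau> *\<^sub>R pt w) - J (- (\<tau> *\<^sub>R pt w)))
      \<le> \<bar>pt w $ i\<bar> * (A\<^sup>2 * Y * (\<tau> powr (1 - \<kappa>) * norm (pt w) powr (1 - \<kappa>)))"
      by (intro mult_left_mono) auto
    also have "\<dots> = A\<^sup>2 * Y * \<tau> powr (1 - \<kappa>) * (\<bar>pt w $ i\<bar> * norm (pt w) powr (1 - \<kappa>))"
      by (simp only: mult_ac)
    finally show "ennreal (norm (of_real (pt w $ i) * (J (\<tau> *\<^sub>R pt w) - J (- (\<tau> *\<^sub>R pt w)))))
      \<le> ennreal (A\<^sup>2 * Y * \<tau> powr (1 - \<kappa>)) * ennreal (\<bar>pt w $ i\<bar> * norm (pt w) powr (1 - \<kappa>))"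
      using A Y by (subst ennreal_mult[symmetric]) (auto simp: norm_mult intro!: ennreal_leI)
  qed
  also have "\<dots> = ennreal (A\<^sup>2 * Y * \<tau> powr (1 - \<kappa>)) * (\<integral>\<^sup>+w. ennreal (\<bar>pt w $ i\<bar> * norm (pt w) powr (1 - \<kappa>)) \<partial>gauss2)"
    by (rule nn_integral_cmult) measurable
  also have "\<dots> \<le> ennreal (A\<^sup>2 * Y * \<tau> powr (1 - \<kappa>)) * 3"
    by (intro mult_left_mono gauss2_moment \<kappa>) auto
  also have "\<dots> = ennreal (A\<^sup>2 * Y * \<tau> powr (1 - \<kappa>) * 3)"
    using A Y by (subst ennreal_mult) auto
  finally have "2 * norm S \<le> A\<^sup>2 * Y * \<tau> powr (1 - \<kappa>) * 3"
    using A Y by (subst (asm) ennreal_le_iff) auto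
  then show ?thesis unfolding S_def by simp
qed

text \<open>The Riesz symbol is written as an integral over scales of a derivative with two heat
  factors. Two bounds on its integrand \<open>U \<tau>\<close>, one good below \<open>l\<close> and
  one good above, combine to \<open>\<tau> powr (- \<kappa>) * min 1 (l / \<tau>)\<close>, whose
  integral has the order \<open>l powr (1 - \<kappa>)\<close>.\<close>

lemma trilinear_bound:
  assumes L: "L > 0" and F: "finite F" "F \<subseteq> freq_lattice L - {0}" and \<kappa>: "0 < \<kappa>" "\<kappa> < 1"
    and A: "A \<ge> 0" "A \<le> X" and hA: "le3 L (trig F c) (ennreal A)"
    and h: "\<And>\<tau>. \<tau> > 0 \<Longrightarrow> le3 L (trig F (\<lambda>k. c k * heat \<tau> k)) (ennreal (X * \<tau> powr (- \<kappa>)))"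
    and K: "K = 3 * (1 / (1 - \<kappa>) + 1 / \<kappa>)"
    and l: "norm y = l" "l \<ge> 1"
  shows "norm (\<integral>x. trig F c x * (trig F (\<lambda>k. c k * of_real (1 / norm k)) (x + y) - trig F (\<lambda>k. c k * of_real (1 / norm k)) (x - y))
       * trig F (\<lambda>k. c k * (\<i> * of_real (k $ i / norm k))) x \<partial>torus_measure L)
     \<le> 2 * K\<^sup>2 * A * X\<^sup>2 * l powr (1 - \<kappa>)"
proof -
  let ?T = "torus_measure L" and ?\<theta> = "trig F c" and ?p = "\<lambda>k. c k * of_real (1 / norm k)"
  have FL: "F \<subseteq> freq_lattice L" using F by auto
  have pk: "norm k > 0" if "k \<in> F" for k using that F by auto
  have X: "X \<ge> 0" using A by simp
  have Kp: "K > 0" using \<kappa> by (simp add: K add_pos_pos)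
  define V where "V x = trig F ?p (x + y) - trig F ?p (x - y)" for x
  have Vm [measurable]: "V \<in> borel_measurable borel" unfolding V_def by measurable
  define BV where "BV = 2 * (\<Sum>k\<in>F. norm (?p k))"
  have Vb: "norm (V x) \<le> BV" for x
    unfolding V_def BV_def
    using norm_triangle_ineq4[of "trig F ?p (x + y)" "trig F ?p (x - y)"] trig_bound[of F ?p "x + y"] trig_bound[of F ?p "x - y"]
    by linarith
  have Vp: "torus_periodic L V"
  proof -
    have "torus_periodic L (\<lambda>x. trig F ?p (x + z))" for z
      by (intro torus_periodic_shift trig_periodic FL L)
    from this[of y] this[of "- y"] show ?thesis by (simp add: torus_periodic_def V_def)
  qed
  have inc: "le3 L (trig F (\<lambda>k. ?p k * (cis (k \<bullet> z) - 1))) (ennreal (K * X * norm z powr (1 - \<kappa>)))" for z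
    unfolding K by (rule potential_increment[OF L F(2) \<kappa> X]) (rule h)
  \<comment> \<open>The symmetric difference is an increment by \<open>2 *\<^sub>R y\<close>,
    observed from the point \<open>x - y\<close>.\<close>
  have V3: "le3 L V (ennreal (K * X * (2 * l) powr (1 - \<kappa>)))"
  proof -
    have "le3 L (\<lambda>x. trig F (\<lambda>k. ?p k * (cis (k \<bullet> (2 *\<^sub>R y)) - 1)) (x + (- y))) (ennreal (K * X * norm (2 *\<^sub>R y) powr (1 - \<kappa>)))"
      by (intro le3_shift inc L trig_periodic FL) measurable
    also have "(\<lambda>x. trig F (\<lambda>k. ?p k * (cis (k \<bullet> (2 *\<^sub>R y)) - 1)) (x + (- y))) = V"
    proof
      fix x
      have "V x = trig F ?p ((x + - y) + 2 *\<^sub>R y) - trig F ?p (x + - y)"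
        by (simp add: V_def algebra_simps scaleR_2)
      also have "\<dots> = trig F (\<lambda>k. ?p k * (cis (k \<bullet> (2 *\<^sub>R y)) - 1)) (x + - y)"
        unfolding trig_shift[of F ?p "x + - y"] trig_diff by (simp add: right_diff_distrib)
      finally show "trig F (\<lambda>k. ?p k * (cis (k \<bullet> (2 *\<^sub>R y)) - 1)) (x + (- y)) = V x" by simp
    qed
    finally show ?thesis using l by simp
  qed
  have Vinc: "le3 L (\<lambda>x. V (x + z) - V x) (ennreal (2 * K * X * norm z powr (1 - \<kappa>)))" for z
  proof -
    let ?q = "trig F (\<lambda>k. ?p k * (cis (k \<bullet> z) - 1))"
    have "le3 L (\<lambda>x. ?q (x + y) - ?q (x + (- y))) (2 * ennreal (K * X * norm z powr (1 - \<kappa>)))"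
      by (intro le3_dist L FL inc)
    also have "(\<lambda>x. ?q (x + y) - ?q (x + (- y))) = (\<lambda>x. V (x + z) - V x)"
    proof
      fix x
      have q: "?q u = trig F ?p (u + z) - trig F ?p u" for u
        unfolding trig_shift[of F ?p u] trig_diff by (simp add: right_diff_distrib)
      show "?q (x + y) - ?q (x + (- y)) = V (x + z) - V x"
        unfolding q V_def by (simp add: algebra_simps)
    qed
    also have "2 * ennreal (K * X * norm z powr (1 - \<kappa>)) = ennreal (2 * K * X * norm z powr (1 - \<kappa>))"
      using Kp X by (simp add: ennreal_mult mult.assoc)
    finally show ?thesis .
  qed
  define W where "W x = ?\<theta> x * V x" for x
  have Wi: "integrable ?T W" unfolding W_def
    by (rule integrable_torus_bounded[OF L, where B="(\<Sum>k\<in>F. norm (c k)) * BV"])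
       (auto simp: norm_mult intro!: mult_mono trig_bound Vb sum_nonneg)
  define M where "M k = (\<integral>x. W x * cis (k \<bullet> x) \<partial>?T)" for k
  define Q where "Q = 3 * K * A * X\<^sup>2"
  have Q: "Q \<ge> 0" using A Kp by (simp add: Q_def)
  \<comment> \<open>Up to \<open>2 / sqrt pi\<close>, the contribution of the scale
    \<open>\<tau>\<close> to the flux. The numbers \<open>M k\<close> carry the dependence on the
    other two factors, so the integral over the scales meets only a finite sum.\<close>
  define U where "U \<tau> = (\<Sum>k\<in>F. c k * (\<i> * of_real (k $ i)) * M k * (heat \<tau> k * heat \<tau> k))" for \<tau>
  have U_bound: "norm (U \<tau>) \<le> Q * (\<tau> powr (- \<kappa>) * min 1 (l / \<tau>))" if \<tau>: "\<tau> > 0" for \<tau>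
  proof -
    have b1: "norm (U \<tau>) \<le> Q * \<tau> powr (- \<kappa>)"
    proof -
      \<comment> \<open>Two heat factors at \<open>\<tau>\<close> are one at
        \<open>sqrt 2 * \<tau>\<close>, the form that \<open>commutator_bound\<close> treats; the
        quotient by \<open>\<tau>'\<close> then turns the exponent \<open>1 - \<kappa>\<close> into
        \<open>- \<kappa>\<close>.\<close>
      define \<tau>' where "\<tau>' = sqrt 2 * \<tau>"
      have \<tau>': "\<tau>' > 0" using \<tau> by (simp add: \<tau>'_def)
      have hh: "heat \<tau>' k = heat \<tau> k * heat \<tau> k" for k
        unfolding heat_sq by (simp add: \<tau>'_def power_mult_distrib)
      have eq: "(\<integral>x. (?\<theta> x * V x) * trig F (\<lambda>k. c k * (\<i> * of_real (\<tau>' * k $ i) * heat \<tau>' k)) x \<partial>?T) = of_real \<tau>' * U \<tau>"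
        unfolding W_def[symmetric] integral_mult_trig[OF Wi] M_def[symmetric] U_def sum_distrib_left hh
        by (intro sum.cong refl) (simp only: of_real_mult[of \<tau>'] mult_ac)
      have "norm (of_real \<tau>' * U \<tau>) \<le> 3 / 2 * A\<^sup>2 * (2 * K * X) * \<tau>' powr (1 - \<kappa>)"
        unfolding eq[symmetric]
        using commutator_bound[OF L F(1) FL \<kappa> A(1) _ hA Vm Vb Vp Vinc \<tau>'] Kp X by simp
      then have "\<tau>' * norm (U \<tau>) \<le> 3 / 2 * A\<^sup>2 * (2 * K * X) * \<tau>' powr (1 - \<kappa>)"
        using \<tau>' by (simp add: norm_mult)
      also have "\<tau>' powr (1 - \<kappa>) = \<tau>' * \<tau>' powr (- \<kappa>)" using \<tau>' by (simp add: powr_diff powr_minus_divide)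
      finally have "\<tau>' * norm (U \<tau>) \<le> \<tau>' * (3 * A\<^sup>2 * K * X * \<tau>' powr (- \<kappa>))" by (simp add: mult_ac)
      then have "norm (U \<tau>) \<le> 3 * A\<^sup>2 * K * X * \<tau>' powr (- \<kappa>)" using \<tau>' by simp
      also have "\<dots> \<le> 3 * A\<^sup>2 * K * X * \<tau> powr (- \<kappa>)"
        using \<tau> \<kappa> Kp X by (intro mult_left_mono powr_mono2') (auto simp: \<tau>'_def)
      also have "3 * A\<^sup>2 * K * X = 3 * K * A * (A * X)" by (simp add: power2_eq_square)
      also have "3 * K * A * (A * X) * \<tau> powr (- \<kappa>) \<le> Q * \<tau> powr (- \<kappa>)"
        unfolding Q_def using A X Kp by (intro mult_right_mono mult_left_mono) (auto simp: power2_eq_square intro!: mult_right_mono)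
      finally show ?thesis .
    qed
    have b2: "norm (U \<tau>) \<le> Q * (\<tau> powr (- \<kappa>) * (l / \<tau>))"
    proof -
      let ?g = "trig F (\<lambda>k. c k * heat \<tau> k * (\<i> * of_real (\<tau> * k $ i) * heat \<tau> k))"
      have eq: "(\<integral>x. (?\<theta> x * V x) * ?g x \<partial>?T) = of_real \<tau> * U \<tau>"
        unfolding W_def[symmetric] integral_mult_trig[OF Wi] M_def[symmetric] U_def sum_distrib_left
        by (intro sum.cong refl) (simp only: of_real_mult[of \<tau>] mult_ac)
      have "ennreal (norm (of_real \<tau> * U \<tau>)) \<le> (\<integral>\<^sup>+x. ennreal (norm (?\<theta> x * V x * ?g x)) \<partial>?T)"
        unfolding eq[symmetric] by (rule norm_integral_le_nn)
      also have "\<dots> \<le> ennreal A * ennreal (K * X * (2 * l) powr (1 - \<kappa>)) * ennreal (X * \<tau> powr (- \<kappa>))"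
        by (intro le3_hoelder hA V3 le3_grad L FL h \<tau>) measurable
      also have "\<dots> = ennreal (A * (K * X * (2 * l) powr (1 - \<kappa>)) * (X * \<tau> powr (- \<kappa>)))"
        using A X Kp by (simp flip: ennreal_mult)
      finally have "norm (of_real \<tau> * U \<tau>) \<le> A * (K * X * (2 * l) powr (1 - \<kappa>)) * (X * \<tau> powr (- \<kappa>))"
        using A X Kp by (subst (asm) ennreal_le_iff) auto
      also have "\<dots> = K * A * X\<^sup>2 * \<tau> powr (- \<kappa>) * (2 * l) powr (1 - \<kappa>)"
        by (simp add: power2_eq_square mult_ac)
      \<comment> \<open>Since \<open>2 * l \<ge> 1\<close>, the exponent may be raised to 1, and 3
        in place of 2 reproduces \<open>Q\<close>. The gain \<open>l powr (- \<kappa>)\<close> is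
        recovered from the integral over the scales.\<close>
      also have "\<dots> \<le> K * A * X\<^sup>2 * \<tau> powr (- \<kappa>) * (3 * l)"
      proof (intro mult_left_mono)
        have "(2 * l) powr (1 - \<kappa>) \<le> (2 * l) powr 1" using l \<kappa> by (intro powr_mono) auto
        then show "(2 * l) powr (1 - \<kappa>) \<le> 3 * l" using l by simp
      qed (use A Kp in auto)
      also have "\<dots> = \<tau> * (Q * (\<tau> powr (- \<kappa>) * (l / \<tau>)))"
        using \<tau> by (simp add: Q_def)
      finally have "\<tau> * norm (U \<tau>) \<le> \<tau> * (Q * (\<tau> powr (- \<kappa>) * (l / \<tau>)))"
        using \<tau> by (simp add: norm_mult)
      then show ?thesis using \<tau> by (simp only: mult_le_cancel_left_pos)
    qed
    show ?thesis using b1 b2 by (simp add: min_def)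
  qed
  have T: "(\<integral>x. W x * trig F (\<lambda>k. c k * (\<i> * of_real (k $ i / norm k))) x \<partial>?T) = of_real (2 / sqrt pi) * (\<integral>\<tau>. U \<tau> \<partial>scales)"
  proof -
    have "(\<integral>\<tau>. U \<tau> \<partial>scales) = (\<Sum>k\<in>F. c k * (\<i> * of_real (k $ i)) * M k * (\<integral>\<tau>. heat \<tau> k * heat \<tau> k \<partial>scales))"
      unfolding U_def
      by (subst Bochner_Integration.integral_sum)
         (intro integrable_mult_right inverse_norm_scales(1) pk, assumption, simp only: integral_mult_right_zero)
    then have "of_real (2 / sqrt pi) * (\<integral>\<tau>. U \<tau> \<partial>scales)
       = (\<Sum>k\<in>F. c k * (\<i> * of_real (k $ i)) * M k * (of_real (2 / sqrt pi) * (\<integral>\<tau>. heat \<tau> k * heat \<tau> k \<partial>scales)))"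
      by (simp only: sum_distrib_left mult_ac)
    also have "\<dots> = (\<Sum>k\<in>F. c k * (\<i> * of_real (k $ i / norm k)) * M k)"
    proof (rule sum.cong[OF refl])
      fix k assume k: "k \<in> F"
      have r: "complex_of_real (k $ i / norm k) = of_real (k $ i) * of_real (1 / norm k)" by simp
      show "c k * (\<i> * of_real (k $ i)) * M k * (of_real (2 / sqrt pi) * (\<integral>\<tau>. heat \<tau> k * heat \<tau> k \<partial>scales))
          = c k * (\<i> * of_real (k $ i / norm k)) * M k"
        unfolding inverse_norm_scales(2)[OF pk[OF k]] r by (simp only: mult_ac)
    qed
    finally show ?thesis
      unfolding integral_mult_trig[OF Wi] M_def[symmetric] by simp
  qed
  have "ennreal (norm (\<integral>\<tau>. U \<tau> \<partial>scales)) \<le> (\<integral>\<^sup>+\<tau>. ennreal (norm (U \<tau>)) \<partial>scales)"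
    by (rule norm_integral_le_nn)
  also have "\<dots> \<le> (\<integral>\<^sup>+\<tau>. ennreal Q * ennreal (\<tau> powr (- \<kappa>) * min 1 (l / \<tau>)) \<partial>scales)"
  proof (intro nn_integral_mono)
    fix \<tau> assume "\<tau> \<in> space scales"
    then have \<tau>: "\<tau> > 0" by (simp add: space_restrict_space)
    then show "ennreal (norm (U \<tau>)) \<le> ennreal Q * ennreal (\<tau> powr (- \<kappa>) * min 1 (l / \<tau>))"
      using U_bound[OF \<tau>] Q l by (subst ennreal_mult[symmetric]) (auto intro!: ennreal_leI)
  qed
  also have "\<dots> = ennreal Q * (\<integral>\<^sup>+\<tau>. ennreal (\<tau> powr (- \<kappa>) * min 1 (l / \<tau>)) \<partial>scales)"
    by (intro nn_integral_cmult measurable_restrict_space1) measurable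
  also have "\<dots> \<le> ennreal Q * ennreal (l powr (1 - \<kappa>) * (1 / (1 - \<kappa>) + 1 / \<kappa>))"
    using l by (intro mult_left_mono nn_integral_scales \<kappa>) auto
  also have "\<dots> = ennreal (Q * (l powr (1 - \<kappa>) * (K / 3)))"
  proof -
    have K3: "1 / (1 - \<kappa>) + 1 / \<kappa> = K / 3" by (simp add: K)
    show ?thesis unfolding K3 using Q Kp by (subst ennreal_mult[symmetric]) auto
  qed
  finally have Ub: "norm (\<integral>\<tau>. U \<tau> \<partial>scales) \<le> Q * (l powr (1 - \<kappa>) * (K / 3))"
    using Q Kp by (subst (asm) ennreal_le_iff) auto
  have sp: "2 / sqrt pi \<le> 2"
  proof -
    have "1 \<le> sqrt pi" using pi_ge_two by (intro real_le_rsqrt) simp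
    then have "2 / sqrt pi \<le> 2 / 1" by (intro divide_left_mono) auto
    then show ?thesis by simp
  qed
  have "norm (of_real (2 / sqrt pi) * (\<integral>\<tau>. U \<tau> \<partial>scales)) = 2 / sqrt pi * norm (\<integral>\<tau>. U \<tau> \<partial>scales)"
    by (simp add: norm_mult norm_divide)
  also have "\<dots> \<le> 2 * (Q * (l powr (1 - \<kappa>) * (K / 3)))"
    using sp Ub Q Kp by (intro mult_mono) auto
  also have "\<dots> = 2 * K\<^sup>2 * A * X\<^sup>2 * l powr (1 - \<kappa>)"
    by (simp add: Q_def power2_eq_square)
  finally show ?thesis
    unfolding T[symmetric] W_def V_def .
qed

subsection \<open>Square-integrable functions on the torus\<close>

definition fcoef :: "real \<Rightarrow> (plane \<Rightarrow> complex) \<Rightarrow> plane \<Rightarrow> complex" where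
  "fcoef L f k = (\<integral>x. f x * cis (- (k \<bullet> x)) \<partial>torus_measure L)"

definition sqn :: "real \<Rightarrow> (plane \<Rightarrow> complex) \<Rightarrow> real" where
  "sqn L f = (\<integral>x. (norm (f x))\<^sup>2 \<partial>torus_measure L)"

definition torus_L2 :: "real \<Rightarrow> (plane \<Rightarrow> complex) \<Rightarrow> bool" where
  "torus_L2 L f \<longleftrightarrow> torus_periodic L f \<and> f \<in> borel_measurable borel \<and>
     integrable (torus_measure L) (\<lambda>x. (norm (f x))\<^sup>2)"

lemma sqn_nonneg: "sqn L f \<ge> 0"
  by (simp add: sqn_def)

lemma torus_L2_trig: "L > 0 \<Longrightarrow> F \<subseteq> freq_lattice L \<Longrightarrow> torus_L2 L (trig F c)"
  unfolding torus_L2_def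
  by (auto intro!: trig_periodic integrable_torus_bounded[where B="(\<Sum>k\<in>F. norm (c k))\<^sup>2"] power_mono trig_bound)

lemma integrable_mult_torus_L2:
  assumes [measurable_dest]: "torus_L2 L f" "torus_L2 L g"
  shows "integrable (torus_measure L) (\<lambda>x. f x * g x)"
proof (rule Bochner_Integration.integrable_bound)
  show "integrable (torus_measure L) (\<lambda>x. (norm (f x))\<^sup>2 + (norm (g x))\<^sup>2)"
    using assms by (auto simp: torus_L2_def)
  show "AE x in torus_measure L. norm (f x * g x) \<le> norm ((norm (f x))\<^sup>2 + (norm (g x))\<^sup>2)"
  proof (rule AE_I2)
    fix x
    have "norm (f x) * norm (g x) \<le> (norm (f x))\<^sup>2 + (norm (g x))\<^sup>2"
      using sum_squares_bound[of "norm (f x)" "norm (g x)"] mult_nonneg_nonneg[OF norm_ge_zero[of "f x"] norm_ge_zero[of "g x"]]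
      by (simp only: mult.assoc)
    then show "norm (f x * g x) \<le> norm ((norm (f x))\<^sup>2 + (norm (g x))\<^sup>2)" by (simp add: norm_mult)
  qed
qed (use assms in \<open>auto simp: torus_L2_def\<close>)

lemma torus_L2_const: "L > 0 \<Longrightarrow> torus_L2 L (\<lambda>_. a)"
  unfolding torus_L2_def by (auto simp: torus_periodic_def intro!: integrable_torus_bounded[where B="(norm a)\<^sup>2"])

lemma integrable_torus_L2: "L > 0 \<Longrightarrow> torus_L2 L f \<Longrightarrow> integrable (torus_measure L) f"
  using integrable_mult_torus_L2[OF _ torus_L2_const[of L 1], of f] by simp

lemma norm_add_sq: "(norm (a + b :: complex))\<^sup>2 \<le> 2 * (norm a)\<^sup>2 + 2 * (norm b)\<^sup>2"
proof -
  have "(norm (a + b))\<^sup>2 \<le> (norm a + norm b)\<^sup>2" by (intro power_mono norm_triangle_ineq) auto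
  also have "\<dots> \<le> 2 * (norm a)\<^sup>2 + 2 * (norm b)\<^sup>2"
    using sum_squares_bound[of "norm a" "norm b"] by (simp add: power2_sum)
  finally show ?thesis .
qed

lemma torus_L2_add:
  assumes "torus_L2 L f" "torus_L2 L g"
  shows "torus_L2 L (\<lambda>x. f x + g x)" "sqn L (\<lambda>x. f x + g x) \<le> 2 * sqn L f + 2 * sqn L g"
proof -
  have i: "integrable (torus_measure L) (\<lambda>x. 2 * (norm (f x))\<^sup>2 + 2 * (norm (g x))\<^sup>2)"
    using assms by (auto simp: torus_L2_def)
  have i': "integrable (torus_measure L) (\<lambda>x. (norm (f x + g x))\<^sup>2)"
    by (rule Bochner_Integration.integrable_bound[OF i])
       (use assms norm_add_sq in \<open>auto simp: torus_L2_def\<close>)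
  then show "torus_L2 L (\<lambda>x. f x + g x)"
    using assms by (auto simp: torus_L2_def torus_periodic_def)
  have "sqn L (\<lambda>x. f x + g x) \<le> (\<integral>x. 2 * (norm (f x))\<^sup>2 + 2 * (norm (g x))\<^sup>2 \<partial>torus_measure L)"
    unfolding sqn_def by (intro integral_mono i i' norm_add_sq)
  also have "\<dots> = 2 * sqn L f + 2 * sqn L g"
    using assms by (simp add: sqn_def torus_L2_def)
  finally show "sqn L (\<lambda>x. f x + g x) \<le> 2 * sqn L f + 2 * sqn L g" .
qed

lemma torus_L2_uminus: "torus_L2 L f \<Longrightarrow> torus_L2 L (\<lambda>x. - f x)" "sqn L (\<lambda>x. - f x) = sqn L f"
  by (auto simp: torus_L2_def torus_periodic_def sqn_def)

lemma torus_L2_diff: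
  assumes "torus_L2 L f" "torus_L2 L g"
  shows "torus_L2 L (\<lambda>x. f x - g x)" "sqn L (\<lambda>x. f x - g x) \<le> 2 * sqn L f + 2 * sqn L g"
  using torus_L2_add[OF assms(1) torus_L2_uminus(1)[OF assms(2)]] by (simp_all add: torus_L2_uminus(2))

lemma torus_L2_shift:
  assumes "L > 0" "torus_L2 L f" shows "torus_L2 L (\<lambda>x. f (x + y))" "sqn L (\<lambda>x. f (x + y)) = sqn L f"
proof -
  have [measurable]: "f \<in> borel_measurable borel" using assms by (simp add: torus_L2_def)
  have p: "torus_periodic L (\<lambda>x. (norm (f x))\<^sup>2)" using assms by (auto simp: torus_L2_def intro: torus_periodic_compose)
  show "sqn L (\<lambda>x. f (x + y)) = sqn L f"
    unfolding sqn_def using integral_torus_shift[OF assms(1) _ p] by simp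
  have "(\<integral>\<^sup>+x. ennreal ((norm (f (x + y)))\<^sup>2) \<partial>torus_measure L) = (\<integral>\<^sup>+x. ennreal ((norm (f x))\<^sup>2) \<partial>torus_measure L)"
    by (rule nn_integral_torus_shift[OF assms(1) _ torus_periodic_compose[OF p]]) measurable
  then have "integrable (torus_measure L) (\<lambda>x. (norm (f (x + y)))\<^sup>2)"
    using assms by (simp add: torus_L2_def integrable_iff_bounded)
  then show "torus_L2 L (\<lambda>x. f (x + y))"
    using assms by (simp add: torus_L2_def torus_periodic_shift)
qed

lemma torus_cauchy_schwarz:
  assumes "torus_L2 L f" "torus_L2 L g"
  shows "(\<integral>x. norm (f x * g x) \<partial>torus_measure L)\<^sup>2 \<le> sqn L f * sqn L g"
proof -
  have [measurable]: "f \<in> borel_measurable borel" "g \<in> borel_measurable borel" using assms by (auto simp: torus_L2_def)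
  have nn: "(\<integral>\<^sup>+x. (ennreal (norm (u x)))\<^sup>2 \<partial>torus_measure L) = ennreal (sqn L u)" if "torus_L2 L u" for u
    using that by (simp add: sqn_def torus_L2_def ennreal_power nn_integral_eq_integral)
  have "(\<integral>\<^sup>+x. ennreal (norm (f x)) * ennreal (norm (g x)) \<partial>torus_measure L)
     = ennreal (\<integral>x. norm (f x * g x) \<partial>torus_measure L)"
    using integrable_norm[OF integrable_mult_torus_L2[OF assms]]
    by (subst nn_integral_eq_integral[symmetric]) (auto simp: norm_mult ennreal_mult)
  then have "(ennreal (\<integral>x. norm (f x * g x) \<partial>torus_measure L))\<^sup>2 \<le> ennreal (sqn L f) * ennreal (sqn L g)"
    using Cauchy_Schwarz_nn_integral[of "\<lambda>x. ennreal (norm (f x))" "torus_measure L" "\<lambda>x. ennreal (norm (g x))"]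
    by (simp add: nn assms)
  also have "\<dots> = ennreal (sqn L f * sqn L g)" by (simp add: ennreal_mult sqn_nonneg)
  finally show ?thesis
    by (simp add: ennreal_power sqn_nonneg)
qed

lemma integral_norm_le_sqn:
  assumes "L > 0" "torus_L2 L f" shows "(\<integral>x. norm (f x) \<partial>torus_measure L) \<le> sqrt (sqn L f)"
proof -
  interpret prob_space "torus_measure L" by (rule prob_space_torus_measure) fact
  have "(\<integral>x. norm (f x * 1) \<partial>torus_measure L)\<^sup>2 \<le> sqn L f * sqn L (\<lambda>_. 1)"
    by (intro torus_cauchy_schwarz assms torus_L2_const)
  then show ?thesis by (simp add: sqn_def prob_space[simplified] real_le_rsqrt)
qed

lemma integral_trig_mult_cis:
  assumes "integrable (torus_measure L) f"
  shows "(\<integral>x. f x * trig F c x \<partial>torus_measure L) = (\<Sum>k\<in>F. c k * fcoef L f (- k))"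
  unfolding integral_mult_trig[OF assms] fcoef_def by simp

lemma cis_uminus_measurable [measurable]: "(\<lambda>x::plane. cis (- (k \<bullet> x))) \<in> borel_measurable borel"
  using cis_measurable[of "- k"] by simp

lemma fcoef_trig:
  assumes L: "L > 0" and F: "finite F" "F \<subseteq> freq_lattice L" and k: "k \<in> freq_lattice L"
  shows "fcoef L (trig F c) k = (if k \<in> F then c k else 0)"
proof -
  have "fcoef L (trig F c) k = (\<integral>x. cis (- k \<bullet> x) * trig F c x \<partial>torus_measure L)"
    unfolding fcoef_def by (simp add: mult.commute)
  also have "\<dots> = (\<Sum>q\<in>F. c q * (\<integral>x. cis (- k \<bullet> x) * cis (q \<bullet> x) \<partial>torus_measure L))"
    by (intro integral_mult_trig integrable_torus_bounded[OF L, where B=1]) auto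
  also have "\<dots> = (\<Sum>q\<in>F. if q = k then c q else 0)"
  proof (rule sum.cong[OF refl])
    fix q assume "q \<in> F"
    then have "q - k \<in> freq_lattice L" using F k by (auto intro: freq_lattice_diff)
    have "(\<integral>x. cis (- k \<bullet> x) * cis (q \<bullet> x) \<partial>torus_measure L) = (\<integral>x. cis ((q - k) \<bullet> x) \<partial>torus_measure L)"
      by (simp add: cis_mult inner_diff_left)
    also have "\<dots> = (if q - k = 0 then 1 else 0)" by (rule integral_cis_torus) fact+
    finally show "c q * (\<integral>x. cis (- k \<bullet> x) * cis (q \<bullet> x) \<partial>torus_measure L) = (if q = k then c q else 0)" by simp
  qed
  also have "\<dots> = (if k \<in> F then c k else 0)" using F by (simp add: sum.delta)
  finally show ?thesis .
qed

lemma cnj_trig: "cnj (trig F c x) = (\<Sum>k\<in>F. cnj (c k) * cis (- (k \<bullet> x)))"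
  by (simp add: trig_def cis_cnj)

lemma cnj_trig_measurable [measurable]: "(\<lambda>x. cnj (trig F c x)) \<in> borel_measurable borel"
  unfolding cnj_trig by measurable

lemma integral_mult_cnj_trig:
  assumes L: "L > 0" and f: "integrable (torus_measure L) f"
  shows "(\<integral>x. f x * cnj (trig F c x) \<partial>torus_measure L) = (\<Sum>k\<in>F. cnj (c k) * fcoef L f k)"
proof -
  have [measurable]: "f \<in> borel_measurable borel" using f by auto
  have i: "integrable (torus_measure L) (\<lambda>x. f x * cis (- (k \<bullet> x)))" for k
    by (rule Bochner_Integration.integrable_bound[OF f]) (auto simp: norm_mult)
  have "(\<integral>x. f x * cnj (trig F c x) \<partial>torus_measure L) = (\<integral>x. (\<Sum>k\<in>F. cnj (c k) * (f x * cis (- (k \<bullet> x)))) \<partial>torus_measure L)"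
    unfolding cnj_trig sum_distrib_left by (simp only: mult_ac)
  also have "\<dots> = (\<Sum>k\<in>F. (\<integral>x. cnj (c k) * (f x * cis (- (k \<bullet> x))) \<partial>torus_measure L))"
    by (rule Bochner_Integration.integral_sum) (intro integrable_mult_right i)
  finally show ?thesis by (simp add: fcoef_def)
qed

lemma norm_diff_sq: "(norm (a - b :: complex))\<^sup>2 = (norm a)\<^sup>2 + (norm b)\<^sup>2 - 2 * Re (a * cnj b)"
  unfolding cmod_power2 by (simp add: power2_eq_square algebra_simps)

text \<open>Completing the square, for arbitrary coefficients: \<open>c = fcoef L f\<close> yields
  Bessel's inequality, \<open>f = 0\<close> the norm of a trigonometric polynomial, and damped
  coefficients the error of a Jackson mean.\<close>

lemma sqn_diff_trig:
  assumes L: "L > 0" and F: "finite F" "F \<subseteq> freq_lattice L" and f: "torus_L2 L f"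
  shows "sqn L (\<lambda>x. f x - trig F c x) = sqn L f - (\<Sum>k\<in>F. (norm (fcoef L f k))\<^sup>2) + (\<Sum>k\<in>F. (norm (fcoef L f k - c k))\<^sup>2)"
proof -
  let ?T = "torus_measure L"
  note fi = integrable_torus_L2[OF L f]
  have sq: "sqn L (trig F c) = (\<Sum>k\<in>F. (norm (c k))\<^sup>2)"
  proof -
    have "complex_of_real (sqn L (trig F c)) = (\<integral>x. trig F c x * cnj (trig F c x) \<partial>?T)"
      unfolding sqn_def integral_complex_of_real[symmetric] complex_norm_square ..
    also have "\<dots> = (\<Sum>k\<in>F. cnj (c k) * c k)"
      unfolding integral_mult_cnj_trig[OF L integrable_trig[OF L]]
      using F by (intro sum.cong refl) (auto simp: fcoef_trig[OF L F])
    also have "\<dots> = complex_of_real (\<Sum>k\<in>F. (norm (c k))\<^sup>2)"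
      unfolding of_real_sum by (intro sum.cong refl) (simp only: complex_norm_square mult.commute)
    finally show ?thesis by (simp only: of_real_eq_iff)
  qed
  have "torus_L2 L (\<lambda>x. cnj (trig F c x))"
    using torus_L2_trig[OF L F(2), of c] by (auto simp: torus_L2_def torus_periodic_def)
  then have i: "integrable ?T (\<lambda>x. f x * cnj (trig F c x))" by (rule integrable_mult_torus_L2[OF f])
  define R where "R x = Re (f x * cnj (trig F c x))" for x
  have R: "integrable ?T R" "(\<integral>x. R x \<partial>?T) = Re (\<integral>x. f x * cnj (trig F c x) \<partial>?T)"
    unfolding R_def by (rule integrable_Re[OF i], rule integral_Re[OF i])
  have "sqn L (\<lambda>x. f x - trig F c x) = (\<integral>x. (norm (f x))\<^sup>2 + (norm (trig F c x))\<^sup>2 - 2 * R x \<partial>?T)"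
    unfolding sqn_def norm_diff_sq R_def ..
  also have "\<dots> = sqn L f + sqn L (trig F c) - 2 * Re (\<integral>x. f x * cnj (trig F c x) \<partial>?T)"
    unfolding R(2)[symmetric] using f torus_L2_trig[OF L F(2), of c] R(1) unfolding sqn_def torus_L2_def by simp
  also have "\<dots> = sqn L f + (\<Sum>k\<in>F. (norm (c k))\<^sup>2 - 2 * Re (fcoef L f k * cnj (c k)))"
    unfolding sq integral_mult_cnj_trig[OF L fi] by (simp add: sum_subtractf sum_distrib_left mult.commute)
  also have "\<dots> = sqn L f - (\<Sum>k\<in>F. (norm (fcoef L f k))\<^sup>2) + (\<Sum>k\<in>F. (norm (fcoef L f k - c k))\<^sup>2)"
    unfolding norm_diff_sq by (simp add: sum.distrib sum_subtractf)
  finally show ?thesis .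
qed

lemma sqn_trig:
  assumes "L > 0" "finite F" "F \<subseteq> freq_lattice L"
  shows "sqn L (trig F c) = (\<Sum>k\<in>F. (norm (c k))\<^sup>2)"
  using sqn_diff_trig[OF assms torus_L2_const[OF assms(1), of 0], of c] by (simp add: fcoef_def sqn_def)

lemma bessel:
  assumes "L > 0" "finite F" "F \<subseteq> freq_lattice L" "torus_L2 L f"
  shows "(\<Sum>k\<in>F. (norm (fcoef L f k))\<^sup>2) \<le> sqn L f"
    "sqn L (\<lambda>x. f x - trig F (fcoef L f) x) = sqn L f - (\<Sum>k\<in>F. (norm (fcoef L f k))\<^sup>2)"
  using sqn_diff_trig[OF assms, of "fcoef L f"] sqn_nonneg[of L "\<lambda>x. f x - trig F (fcoef L f) x"] by simp_all

subsection \<open>Uniqueness of Fourier coefficients\<close>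

lemma uminus_jackson_freqs: "uminus ` jackson_freqs L M = jackson_freqs L M"
proof -
  have "- k \<in> jackson_freqs L M" if "k \<in> jackson_freqs L M" for k
    using that by (force simp: jackson_freqs_def freq_minus)
  then show ?thesis by (force simp: image_iff)
qed

text \<open>The kernel has even coefficients on a symmetric set of frequencies, so an average of
  \<open>f (x + y)\<close> is a genuine convolution and damps each Fourier coefficient of
  \<open>f\<close>.\<close>

lemma jackson_conv:
  assumes L: "L > 0" and M: "M \<ge> 2" and f: "integrable (torus_measure L) f" and p: "torus_periodic L f"
  shows "(\<integral>y. of_real (jackson L M y) * f (x + y) \<partial>torus_measure L)
    = trig (jackson_freqs L M) (\<lambda>k. of_real (jackson_coeff L M k) * fcoef L f k) x"
proof -
  let ?F = "jackson_freqs L M" and ?T = "torus_measure L"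
  have [measurable]: "f \<in> borel_measurable borel" using f by auto
  have "(\<integral>\<^sup>+y. ennreal (norm (f (y + x))) \<partial>?T) = (\<integral>\<^sup>+y. ennreal (norm (f y)) \<partial>?T)"
    by (rule nn_integral_torus_shift[OF L _ torus_periodic_compose[OF p]]) measurable
  then have fp: "integrable ?T (\<lambda>y. f (y + x))"
    using f by (simp add: integrable_iff_bounded)
  have "(\<integral>y. of_real (jackson L M y) * f (x + y) \<partial>?T)
      = (\<integral>y. f (y + x) * trig ?F (\<lambda>k. of_real (jackson_coeff L M k)) y \<partial>?T)"
    by (simp add: jackson_eq_trig[OF L] mult.commute add.commute)
  also have "\<dots> = (\<Sum>k\<in>?F. of_real (jackson_coeff L M k) * (\<integral>y. f (y + x) * cis (k \<bullet> y) \<partial>?T))"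
    by (rule integral_mult_trig[OF fp])
  also have "\<dots> = (\<Sum>k\<in>?F. of_real (jackson_coeff L M (- k)) * fcoef L f (- k) * cis (- k \<bullet> x))"
  proof (rule sum.cong[OF refl])
    fix k assume "k \<in> ?F"
    then have k: "k \<in> freq_lattice L" using jackson_freqs_lattice by auto
    have "(\<integral>y. f (y + x) * cis (k \<bullet> y) \<partial>?T) = (\<integral>y. f (y + x) * cis (k \<bullet> (y + x)) * cis (- k \<bullet> x) \<partial>?T)"
      by (intro Bochner_Integration.integral_cong refl) (simp add: mult.assoc cis_mult inner_add_right)
    also have "\<dots> = (\<integral>y. f y * cis (k \<bullet> y) \<partial>?T) * cis (- k \<bullet> x)"
      using integral_torus_shift[OF L _ torus_periodic_mult[OF p cis_torus_periodic[OF k L]], of x] by simp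
    finally show "of_real (jackson_coeff L M k) * (\<integral>y. f (y + x) * cis (k \<bullet> y) \<partial>?T)
        = of_real (jackson_coeff L M (- k)) * fcoef L f (- k) * cis (- k \<bullet> x)"
      by (simp add: jackson_coeff_uminus[OF L k] fcoef_def)
  qed
  also have "\<dots> = (\<Sum>k\<in>uminus ` ?F. of_real (jackson_coeff L M k) * fcoef L f k * cis (k \<bullet> x))"
    by (subst sum.reindex) (auto simp: inj_on_def)
  finally show ?thesis by (simp add: uminus_jackson_freqs trig_def)
qed

text \<open>The kernel sits at distance of order \<open>L / M\<close> from the lattice. A function
  with Lipschitz decay towards the lattice therefore has a small mean; characters and Lipschitz test
  functions are treated by this one estimate.\<close>

lemma jackson_approx:
  fixes h :: "plane \<Rightarrow> complex"
  assumes L: "L > 0" and M: "M \<ge> 2" and [measurable]: "h \<in> borel_measurable borel"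
    and h: "\<And>y. norm (h y) \<le> C * (\<bar>cwrap L y $ 1\<bar> + \<bar>cwrap L y $ 2\<bar>)" and C: "C \<ge> 0"
  shows "norm (\<integral>y. of_real (jackson L M y) * h y \<partial>torus_measure L) \<le> C * (2 * L / M)"
proof -
  let ?T = "torus_measure L"
  have "ennreal (norm (\<integral>y. of_real (jackson L M y) * h y \<partial>?T)) \<le> (\<integral>\<^sup>+y. ennreal (norm (of_real (jackson L M y) * h y)) \<partial>?T)"
    by (rule norm_integral_le_nn)
  also have "\<dots> \<le> (\<integral>\<^sup>+y. ennreal C * (ennreal (jackson L M y * \<bar>cwrap L y $ 1\<bar>) + ennreal (jackson L M y * \<bar>cwrap L y $ 2\<bar>)) \<partial>?T)"
  proof (intro nn_integral_mono)
    fix y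
    have "norm (of_real (jackson L M y) * h y) \<le> jackson L M y * (C * (\<bar>cwrap L y $ 1\<bar> + \<bar>cwrap L y $ 2\<bar>))"
      using h[of y] jackson_nonneg[of L M y] by (simp add: norm_mult mult_left_mono)
    also have "\<dots> = C * (jackson L M y * \<bar>cwrap L y $ 1\<bar> + jackson L M y * \<bar>cwrap L y $ 2\<bar>)"
      by (simp add: algebra_simps)
    finally have "ennreal (norm (of_real (jackson L M y) * h y)) \<le> ennreal (C * (jackson L M y * \<bar>cwrap L y $ 1\<bar> + jackson L M y * \<bar>cwrap L y $ 2\<bar>))"
      by (rule ennreal_leI)
    also have "\<dots> = ennreal C * (ennreal (jackson L M y * \<bar>cwrap L y $ 1\<bar>) + ennreal (jackson L M y * \<bar>cwrap L y $ 2\<bar>))"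
      using C by (subst ennreal_mult) (auto simp: jackson_nonneg)
    finally show "ennreal (norm (of_real (jackson L M y) * h y))
       \<le> ennreal C * (ennreal (jackson L M y * \<bar>cwrap L y $ 1\<bar>) + ennreal (jackson L M y * \<bar>cwrap L y $ 2\<bar>))" .
  qed
  also have "\<dots> = ennreal C * ((\<integral>\<^sup>+y. ennreal (jackson L M y * \<bar>cwrap L y $ 1\<bar>) \<partial>?T) + (\<integral>\<^sup>+y. ennreal (jackson L M y * \<bar>cwrap L y $ 2\<bar>) \<partial>?T))"
    by (simp add: nn_integral_cmult nn_integral_add)
  also have "\<dots> \<le> ennreal C * (ennreal (L / M) + ennreal (L / M))"
    by (intro mult_left_mono add_mono jackson_moment L M) auto
  also have "\<dots> = ennreal (C * (2 * L / M))"
  proof -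
    have "ennreal (L / M) + ennreal (L / M) = ennreal (2 * L / M)"
      using L by (subst ennreal_plus[symmetric]) auto
    then show ?thesis using L C by (simp only:) (subst ennreal_mult[symmetric], auto)
  qed
  finally show ?thesis using L C by (subst (asm) ennreal_le_iff) auto
qed

lemma jackson_coeff_near_1:
  assumes L: "L > 0" and M: "M \<ge> 2" and k: "k \<in> freq_lattice L"
  shows "\<bar>1 - jackson_coeff L M k\<bar> \<le> norm k * (2 * L / M)"
proof -
  have "(\<integral>y. of_real (jackson L M y) * (1 - cis (k \<bullet> y)) \<partial>torus_measure L) = of_real (1 - jackson_coeff L M k)"
    using jackson_coeff_integral[OF L M k] jackson_integral_1[OF L M] by (simp add: right_diff_distrib)
  moreover have "norm (\<integral>y. of_real (jackson L M y) * (1 - cis (k \<bullet> y)) \<partial>torus_measure L) \<le> norm k * (2 * L / M)"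
  proof (rule jackson_approx[OF L M])
    fix y
    have "norm (1 - cis (k \<bullet> y)) = norm (cis (k \<bullet> cwrap L y) - 1)"
      by (simp add: cis_cwrap[OF L k] norm_minus_commute)
    also have "\<dots> \<le> \<bar>k \<bullet> cwrap L y\<bar>"
      using iexp_approx1[of "k \<bullet> cwrap L y" 0] by (simp add: cis_conv_exp)
    also have "\<dots> \<le> norm k * norm (cwrap L y)" by (rule Cauchy_Schwarz_ineq2)
    also have "\<dots> \<le> norm k * (\<bar>cwrap L y $ 1\<bar> + \<bar>cwrap L y $ 2\<bar>)"
      using norm_le_l1_cart[of "cwrap L y"] by (intro mult_left_mono) (auto simp: sum_2)
    finally show "norm (1 - cis (k \<bullet> y)) \<le> norm k * (\<bar>cwrap L y $ 1\<bar> + \<bar>cwrap L y $ 2\<bar>)" .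
  qed auto
  ultimately show ?thesis by (metis norm_of_real)
qed

text \<open>The Jackson means of \<open>g\<close> are trigonometric polynomials, hence orthogonal to
  \<open>f\<close>, and they approach \<open>g\<close> uniformly at the rate
  \<open>L / M\<close>.\<close>

lemma zero_coeffs_lipschitz:
  assumes L: "L > 0" and f: "integrable (torus_measure L) f"
    and zero: "\<And>k. k \<in> freq_lattice L \<Longrightarrow> fcoef L f k = 0"
    and g: "\<And>x y. \<bar>g x - g y\<bar> \<le> C * dist x y" and gp: "torus_periodic L g" and g1: "\<And>x. \<bar>g x\<bar> \<le> 1"
  shows "(\<integral>x. f x * of_real (g x) \<partial>torus_measure L) = 0"
proof -
  let ?T = "torus_measure L"
  have C: "C \<ge> 0" using g[of "axis 1 1" 0] by (simp add: dist_norm) 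
  have "C-lipschitz_on UNIV g" using C g by (auto intro!: lipschitz_onI simp: dist_real_def)
  then have "continuous_on UNIV g" by (rule lipschitz_on_continuous_on)
  then have gm [measurable]: "g \<in> borel_measurable borel" by (rule borel_measurable_continuous_onI)
  have fm [measurable]: "f \<in> borel_measurable borel" using f by auto
  have gi: "integrable ?T (\<lambda>x. complex_of_real (g x))"
    by (rule integrable_torus_bounded[OF L, where B=1]) (use g1 in auto)
  have gp': "torus_periodic L (\<lambda>x. complex_of_real (g x))" using gp by (rule torus_periodic_compose)
  define B where "B = (\<integral>x. norm (f x) \<partial>?T)"
  have bound: "norm (\<integral>x. f x * of_real (g x) \<partial>?T) \<le> B * (C * (2 * L / M))" if M: "M \<ge> 2" for M :: nat
  proof -
    define Kg where "Kg = trig (jackson_freqs L M) (\<lambda>k. of_real (jackson_coeff L M k) * fcoef L (\<lambda>x. of_real (g x)) k)"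
    have Kg: "Kg x = (\<integral>y. of_real (jackson L M y) * of_real (g (x + y)) \<partial>?T)" for x
      unfolding Kg_def using jackson_conv[OF L M gi gp', of x] by simp
    have "(\<integral>x. f x * Kg x \<partial>?T) = 0"
      unfolding Kg_def integral_trig_mult_cis[OF f]
    proof (rule sum.neutral, rule ballI)
      fix k assume "k \<in> jackson_freqs L M"
      then have "fcoef L f (- k) = 0" using jackson_freqs_lattice by (intro zero) auto
      then show "of_real (jackson_coeff L M k) * fcoef L (\<lambda>x. complex_of_real (g x)) k * fcoef L f (- k) = 0" by simp
    qed
    moreover have iK: "integrable ?T (\<lambda>x. f x * Kg x)"
    proof -
      define s0 where "s0 = (\<Sum>k\<in>jackson_freqs L M. norm (of_real (jackson_coeff L M k) * fcoef L (\<lambda>x. of_real (g x)) k))"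
      have "s0 \<ge> 0" unfolding s0_def by (intro sum_nonneg) auto
      moreover have "norm (Kg x) \<le> s0" for x unfolding Kg_def s0_def by (rule trig_bound)
      ultimately have "norm (f x * Kg x) \<le> norm (of_real s0 * f x)" for x
        by (simp add: norm_mult mult.commute[of s0] mult_left_mono)
      then show ?thesis
        by (intro Bochner_Integration.integrable_bound[OF integrable_mult_right[OF f]]) (auto simp: Kg_def)
    qed
    moreover have ig: "integrable ?T (\<lambda>x. f x * of_real (g x))"
      using g1 by (intro Bochner_Integration.integrable_bound[OF f]) (auto simp: norm_mult mult_left_le)
    ultimately have "(\<integral>x. f x * of_real (g x) \<partial>?T) = (\<integral>x. f x * (of_real (g x) - Kg x) \<partial>?T)"
      by (simp add: right_diff_distrib)
    also have "norm \<dots> \<le> (\<integral>x. norm (f x) * (C * (2 * L / M)) \<partial>?T)"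
    proof (rule order_trans[OF integral_norm_bound integral_mono])
      show "integrable ?T (\<lambda>x. norm (f x * (of_real (g x) - Kg x)))"
        using ig iK by (simp add: right_diff_distrib)
      show "integrable ?T (\<lambda>x. norm (f x) * (C * (2 * L / M)))" using f by simp
      fix x
      have "complex_of_real (g x) = (\<integral>y. of_real (jackson L M y) * of_real (g x) \<partial>?T)"
        using jackson_integral_1[OF L M] by simp
      then have "of_real (g x) - Kg x = (\<integral>y. of_real (jackson L M y) * (of_real (g x) - of_real (g (x + y))) \<partial>?T)"
        unfolding Kg right_diff_distrib
        using jackson_integral_1[OF L M] g1
        by (subst Bochner_Integration.integral_diff)
           (auto intro!: Bochner_Integration.integrable_bound[where f="jackson L M"] simp: norm_mult mult_left_le)
      also have "norm \<dots> \<le> C * (2 * L / M)"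
      proof (rule jackson_approx[OF L M])
        fix y
        have "g (x + y) = g (x + cwrap L y)"
          using torus_periodic_lat[OF gp] by (simp add: cwrap_def flip: add.assoc)
        then have "\<bar>g x - g (x + y)\<bar> \<le> C * norm (cwrap L y)"
          using g[of x "x + cwrap L y"] by (simp add: dist_norm)
        also have "\<dots> \<le> C * (\<bar>cwrap L y $ 1\<bar> + \<bar>cwrap L y $ 2\<bar>)"
          using norm_le_l1_cart[of "cwrap L y"] C by (intro mult_left_mono) (auto simp: sum_2)
        finally show "norm (complex_of_real (g x) - of_real (g (x + y))) \<le> C * (\<bar>cwrap L y $ 1\<bar> + \<bar>cwrap L y $ 2\<bar>)"
          by (simp flip: of_real_diff)
      qed (use C in auto)
      finally show "norm (f x * (of_real (g x) - Kg x)) \<le> norm (f x) * (C * (2 * L / M))"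
        by (simp only: norm_mult mult_left_mono norm_ge_zero)
    qed
    also have "\<dots> = B * (C * (2 * L / M))" by (simp add: B_def)
    finally show ?thesis .
  qed
  have "((\<lambda>M. B * (C * (2 * L / real M))) \<longlonglongrightarrow> B * (C * 0))"
    by (intro tendsto_mult tendsto_const tendsto_divide_0[OF tendsto_const] filterlim_at_top_imp_at_infinity filterlim_real_sequentially)
  then have "norm (\<integral>x. f x * of_real (g x) \<partial>?T) \<le> B * (C * 0)"
    by (rule LIMSEQ_le_const) (use bound in auto)
  then show ?thesis by simp
qed

text \<open>The indicator of a closed set is the decreasing limit of the Lipschitz functions
  \<open>max 0 (1 - n * infdist x S)\<close>, which inherit the periodicity of
  \<open>S\<close>.\<close>

lemma zero_coeffs_closed:
  assumes L: "L > 0" and f: "integrable (torus_measure L) f"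
    and zero: "\<And>k. k \<in> freq_lattice L \<Longrightarrow> fcoef L f k = 0"
    and S: "closed S" "S \<noteq> {}" and Sp: "torus_periodic L (\<lambda>x. x \<in> S)"
  shows "(\<integral>x. f x * indicator S x \<partial>torus_measure L) = 0"
proof -
  let ?T = "torus_measure L"
  have fm [measurable]: "f \<in> borel_measurable borel" using f by auto
  have [measurable]: "(\<lambda>x. infdist x S) \<in> borel_measurable borel"
    by (intro borel_measurable_continuous_onI continuous_on_infdist continuous_on_id)
  define g where "g n x = max 0 (1 - real n * infdist x S)" for n x
  have lip: "\<bar>g n x - g n y\<bar> \<le> real n * dist x y" for n x y
  proof -
    have "\<bar>g n x - g n y\<bar> \<le> \<bar>real n * infdist x S - real n * infdist y S\<bar>" unfolding g_def by linarith
    also have "\<dots> = real n * \<bar>infdist x S - infdist y S\<bar>" by (simp add: abs_mult flip: right_diff_distrib)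
    also have "\<dots> \<le> real n * dist x y" by (intro mult_left_mono infdist_triangle_abs) auto
    finally show ?thesis .
  qed
  have inf_le: "infdist (x + v) S \<le> infdist x S" if "\<And>z. z \<in> S \<Longrightarrow> z + v \<in> S" for x v
  proof -
    obtain z where "z \<in> S" "infdist x S = dist x z" using infdist_attains_inf[OF S, of x] by metis
    then show ?thesis using infdist_le[OF that[of z], of "x + v"] by (simp add: dist_norm)
  qed
  have per: "torus_periodic L (g n)" for n
    unfolding torus_periodic_def
  proof (intro allI)
    fix x and j :: 2
    have "infdist (x + L *\<^sub>R axis j 1) S \<le> infdist x S"
      using Sp by (intro inf_le) (auto simp: torus_periodic_def)
    moreover have "infdist (x + L *\<^sub>R axis j 1 + - (L *\<^sub>R axis j 1)) S \<le> infdist (x + L *\<^sub>R axis j 1) S"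
    proof (rule inf_le)
      fix z assume "z \<in> S"
      then show "z + - (L *\<^sub>R axis j 1) \<in> S"
        using Sp[unfolded torus_periodic_def, rule_format, of "z - L *\<^sub>R axis j 1" j] by simp
    qed
    ultimately show "g n (x + L *\<^sub>R axis j 1) = g n x" by (simp add: g_def)
  qed
  have "g n x \<le> 1" "0 \<le> g n x" for n x by (auto simp: g_def infdist_nonneg)
  then have g1: "\<bar>g n x\<bar> \<le> 1" for n x by simp
  have lim: "(\<lambda>n. g n x) \<longlonglongrightarrow> indicator S x" for x
  proof (cases "x \<in> S")
    case True
    then have "g n x = 1" for n by (simp add: g_def)
    then show ?thesis using True by simp
  next
    case False
    then have pos: "infdist x S > 0" using infdist_pos_not_in_closed[OF S] by simp
    obtain N :: nat where N: "1 < real N * infdist x S" using reals_Archimedean3[OF pos] by blast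
    have "g n x = 0" if "n \<ge> N" for n
    proof -
      have "real N * infdist x S \<le> real n * infdist x S" using that pos by (intro mult_right_mono) auto
      then show ?thesis using N by (simp add: g_def)
    qed
    then have "eventually (\<lambda>n. g n x = indicator S x) sequentially"
      using False by (auto simp: eventually_at_top_linorder)
    then show ?thesis by (rule tendsto_eventually)
  qed
  have "(\<lambda>n. \<integral>x. f x * of_real (g n x) \<partial>?T) \<longlonglongrightarrow> (\<integral>x. f x * indicator S x \<partial>?T)"
  proof (rule integral_dominated_convergence[where w="\<lambda>x. norm (f x)"])
    have [measurable]: "S \<in> sets borel" using S by auto
    show "(\<lambda>x. f x * indicator S x) \<in> borel_measurable ?T" by measurable
    show "(\<lambda>x. f x * of_real (g n x)) \<in> borel_measurable ?T" for n
      unfolding g_def by measurable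
    show "AE x in ?T. (\<lambda>n. f x * of_real (g n x)) \<longlonglongrightarrow> f x * indicator S x"
    proof (rule AE_I2)
      fix x
      have "(\<lambda>n. f x * complex_of_real (g n x)) \<longlonglongrightarrow> f x * of_real (indicator S x)"
        by (intro tendsto_intros lim)
      then show "(\<lambda>n. f x * complex_of_real (g n x)) \<longlonglongrightarrow> f x * indicator S x"
        by (simp add: of_real_indicator)
    qed
    show "AE x in ?T. norm (f x * of_real (g n x)) \<le> norm (f x)" for n
      using g1 by (auto simp: norm_mult mult_left_le)
  qed (use f in simp)
  moreover have "(\<integral>x. f x * of_real (g n x) \<partial>?T) = 0" for n
    by (rule zero_coeffs_lipschitz[OF L f zero lip per g1])
  ultimately show ?thesis by (simp add: LIMSEQ_const_iff)
qed

text \<open>If the set where \<open>r\<close> is positive had positive measure, it would contain a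
  compact set of positive measure. The lattice orbit of that compact set is an admissible closed set
  on which \<open>r\<close> is positive, so its integral could not vanish.\<close>

lemma AE_nonpos_of_closed:
  fixes r :: "plane \<Rightarrow> real"
  assumes L: "L > 0" and r: "integrable (torus_measure L) r" and rp: "torus_periodic L r"
    and cl: "\<And>S. closed S \<Longrightarrow> S \<noteq> {} \<Longrightarrow> torus_periodic L (\<lambda>x. x \<in> S) \<Longrightarrow> (\<integral>x. r x * indicator S x \<partial>torus_measure L) = 0"
  shows "AE x in torus_measure L. r x \<le> 0"
proof -
  let ?T = "torus_measure L"
  interpret prob_space ?T by (rule prob_space_torus_measure[OF L])
  have [measurable]: "r \<in> borel_measurable borel" using r by auto
  define P where "P = {x. r x > 0}"
  have P [measurable]: "P \<in> sets borel" unfolding P_def by measurable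
  have "emeasure ?T K = 0" if K: "K \<subseteq> P" "compact K" for K
  proof (cases "K = {}")
    case False
    \<comment> \<open>Saturating \<open>K\<close> by the lattice makes it periodic. The result is
      closed as the sum of a compact and a discrete closed set, and it stays where \<open>r\<close>
      is positive because \<open>r\<close> is periodic.\<close>
    define S where "S = (\<Union>x\<in>K. \<Union>y\<in>range (lat L). {x + y})"
    have "closed (range (lat L))"
    proof (rule discrete_imp_closed[of L])
      show "\<forall>x\<in>range (lat L). \<forall>y\<in>range (lat L). dist y x < L \<longrightarrow> y = x"
      proof (intro ballI impI)
        fix x y assume xy: "x \<in> range (lat L)" "y \<in> range (lat L)" and d: "dist y x < L"
        obtain p q where pq: "x = lat L p" "y = lat L q" using xy by auto
        have eqI: "m = n" if "L * \<bar>real_of_int m - real_of_int n\<bar> < L" for m n :: int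
        proof -
          have "\<bar>real_of_int m - real_of_int n\<bar> < 1" using that L by simp
          then show ?thesis by linarith
        qed
        have "L * \<bar>real_of_int (fst q) - real_of_int (fst p)\<bar> \<le> dist y x" "L * \<bar>real_of_int (snd q) - real_of_int (snd p)\<bar> \<le> dist y x"
          using component_le_norm_cart[of "y - x" 1] component_le_norm_cart[of "y - x" 2] L
          by (simp_all add: pq dist_norm abs_mult flip: right_diff_distrib)
        then have "L * \<bar>real_of_int (fst q) - real_of_int (fst p)\<bar> < L" "L * \<bar>real_of_int (snd q) - real_of_int (snd p)\<bar> < L"
          using d by linarith+
        then have "fst q = fst p" "snd q = snd p" by (blast intro: eqI)+
        then show "y = x" by (simp add: pq prod_eq_iff lat_def)
      qed
    qed (rule L)
    then have clS: "closed S" unfolding S_def by (rule compact_closed_sums[OF K(2)])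
    then have [measurable]: "S \<in> sets borel" by auto
    have KS: "K \<subseteq> S"
    proof
      fix x assume "x \<in> K"
      moreover have "lat L (0, 0) = 0" by (simp add: vec_eq_iff forall_2)
      ultimately show "x \<in> S" unfolding S_def by (force intro!: bexI[of _ x])
    qed
    have SP: "S \<subseteq> P"
      using K(1) torus_periodic_lat[OF rp] by (auto simp: S_def P_def)
    have lat_add: "lat L p + lat L q = lat L (p + q)" for p q
      by (simp add: vec_eq_iff forall_2 algebra_simps)
    have inv: "z + lat L q \<in> S" if "z \<in> S" for z q
    proof -
      obtain x p where x: "x \<in> K" "z = x + lat L p" using \<open>z \<in> S\<close> by (auto simp: S_def)
      then have "z + lat L q = x + lat L (p + q)" by (simp add: lat_add add.assoc)
      then show ?thesis using x unfolding S_def by blast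
    qed
    have "(x + L *\<^sub>R axis j 1 \<in> S) = (x \<in> S)" for x and j :: 2
    proof -
      obtain q where q: "L *\<^sub>R axis j 1 = lat L q"
      proof -
        consider "j = 1" | "j = 2" using exhaust_2 by blast
        then show ?thesis
          by cases (rule that[of "(1, 0)"], simp add: vec_eq_iff forall_2 axis_def,
              rule that[of "(0, 1)"], simp add: vec_eq_iff forall_2 axis_def)
      qed
      have "lat L q + lat L (- q) = 0" by (simp add: vec_eq_iff forall_2)
      then show ?thesis
        using inv[of x q] inv[of "x + lat L q" "- q"] unfolding q by (auto simp: add.assoc)
    qed
    then have "(\<integral>x. r x * indicator S x \<partial>?T) = 0"
      using False KS by (intro cl clS) (auto simp: torus_periodic_def)
    moreover have "integrable ?T (\<lambda>x. r x * indicator S x)"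
      by (rule integrable_real_mult_indicator[OF _ r]) simp
    moreover have "0 \<le> r x * indicator S x" for x using SP by (auto simp: P_def indicator_def less_imp_le)
    ultimately have "AE x in ?T. r x * indicator S x = 0"
      by (subst (asm) integral_nonneg_eq_0_iff_AE) auto
    then have "AE x in ?T. x \<notin> S"
      by eventually_elim (use SP in \<open>auto simp: P_def indicator_def split: if_splits\<close>)
    then have "emeasure ?T S = 0" by (subst (asm) AE_iff_measurable[OF _ refl]) auto
    then show ?thesis using emeasure_mono[OF KS, of ?T] by simp
  qed simp
  then have "emeasure ?T P = 0"
    by (subst inner_regular[OF _ _ P]) (auto simp: SUP_constant intro!: SUP_eq_const)
  then have "AE x in ?T. x \<notin> P" by (intro AE_not_in) (auto simp: null_sets_def)
  then show ?thesis by (simp add: P_def not_less)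
qed

text \<open>The one-sided criterion is applied to the real parts of \<open>a * f x\<close> for
  \<open>a\<close> equal to 1, -1, \<open>- \<i>\<close> and \<open>\<i>\<close>, which are the real
  and imaginary parts of \<open>f\<close> with both signs.\<close>

lemma fourier_unique:
  assumes L: "L > 0" and f: "integrable (torus_measure L) f" and p: "torus_periodic L f"
    and zero: "\<And>k. k \<in> freq_lattice L \<Longrightarrow> fcoef L f k = 0"
  shows "AE x in torus_measure L. f x = 0"
proof -
  let ?T = "torus_measure L"
  have [measurable]: "f \<in> borel_measurable borel" using f by auto
  have *: "AE x in ?T. r (f x) \<le> 0"
    if r: "\<And>z. r z = Re (a * z)" for a and r :: "complex \<Rightarrow> real"
  proof (rule AE_nonpos_of_closed[OF L])
    have fa: "integrable ?T (\<lambda>x. a * f x)" using f by simp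
    show "integrable ?T (\<lambda>x. r (f x))" unfolding r by (rule integrable_Re[OF fa])
    show "torus_periodic L (\<lambda>x. r (f x))" using p by (rule torus_periodic_compose)
    fix S assume S: "closed S" "S \<noteq> {}" "torus_periodic L (\<lambda>x. x \<in> S)"
    have [measurable]: "S \<in> sets borel" using S by auto
    have "integrable ?T (\<lambda>x. f x * indicator S x)"
      by (rule Bochner_Integration.integrable_bound[OF f]) (auto simp: norm_mult indicator_def)
    then have i: "integrable ?T (\<lambda>x. a * (f x * indicator S x))" by simp
    have "(\<integral>x. r (f x) * indicator S x \<partial>?T) = (\<integral>x. Re (a * (f x * indicator S x)) \<partial>?T)"
      by (intro Bochner_Integration.integral_cong refl) (simp add: r indicator_def)
    also have "\<dots> = Re (\<integral>x. a * (f x * indicator S x) \<partial>?T)" by (rule integral_Re[OF i])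
    also have "\<dots> = 0" by (simp add: zero_coeffs_closed[OF L f zero S])
    finally show "(\<integral>x. r (f x) * indicator S x \<partial>?T) = 0" .
  qed
  have "AE x in ?T. Re (f x) \<le> 0" "AE x in ?T. - Re (f x) \<le> 0" "AE x in ?T. Im (f x) \<le> 0" "AE x in ?T. - Im (f x) \<le> 0"
    using *[of "\<lambda>z. Re z" 1] *[of "\<lambda>z. - Re z" "-1"] *[of "\<lambda>z. Im z" "- \<i>"] *[of "\<lambda>z. - Im z" \<i>] by simp_all
  then show ?thesis by eventually_elim (simp add: complex_eq_iff)
qed

subsection \<open>The Riesz-Fischer theorem and completeness\<close>

text \<open>A finite set whose sum comes within \<open>\<epsilon>\<close> of the supremum leaves at
  most \<open>\<epsilon>\<close> for any finite set disjoint from it.\<close>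

lemma small_tails:
  fixes w :: "'a \<Rightarrow> real"
  assumes w: "\<And>k. w k \<ge> 0" and B: "\<And>F. finite F \<Longrightarrow> F \<subseteq> A \<Longrightarrow> sum w F \<le> B" and \<epsilon>: "\<epsilon> > 0"
  obtains E where "finite E" "E \<subseteq> A" "\<And>G. finite G \<Longrightarrow> G \<subseteq> A \<Longrightarrow> G \<inter> E = {} \<Longrightarrow> sum w G \<le> \<epsilon>"
proof -
  define X where "X = sum w ` {F. finite F \<and> F \<subseteq> A}"
  have X: "X \<noteq> {}" "bdd_above X" using B by (auto simp: X_def intro!: bdd_aboveI[of _ B])
  have "Sup X - \<epsilon> < Sup X" using \<epsilon> by simp
  then have "\<exists>x\<in>X. Sup X - \<epsilon> < x" using less_cSup_iff[OF X] by blast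
  then obtain x where x: "x \<in> X" "Sup X - \<epsilon> < x" by blast
  obtain E where E: "finite E" "E \<subseteq> A" "Sup X - \<epsilon> < sum w E"
    using x(1) x(2) unfolding X_def by blast
  show ?thesis
  proof (rule that[OF E(1,2)])
    fix G assume G: "finite G" "G \<subseteq> A" "G \<inter> E = {}"
    have "sum w G + sum w E = sum w (G \<union> E)" using G E by (intro sum.union_disjoint[symmetric]) auto
    also have "\<dots> \<le> Sup X" using G E X by (intro cSup_upper) (auto simp: X_def)
    finally show "sum w G \<le> \<epsilon>" using E by simp
  qed
qed

text \<open>Finite sets of frequencies are chosen with tails at most \<open>(1 / 4) ^ n\<close>. The
  increments of the partial sums are then geometrically small in mean, so the series converges
  almost everywhere; Fatou's lemma returns the mean-square estimate.\<close>

lemma riesz_fischer: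
  assumes L: "L > 0" and B: "\<And>F. finite F \<Longrightarrow> F \<subseteq> freq_lattice L \<Longrightarrow> (\<Sum>k\<in>F. (norm (c k))\<^sup>2) \<le> B"
  obtains h where "torus_L2 L h" "\<And>k. k \<in> freq_lattice L \<Longrightarrow> fcoef L h k = c k"
    "\<And>\<epsilon>. \<epsilon> > 0 \<Longrightarrow> \<exists>F. finite F \<and> F \<subseteq> freq_lattice L \<and> sqn L (\<lambda>x. h x - trig F c x) \<le> \<epsilon>"
proof -
  let ?\<Lambda> = "freq_lattice L" and ?T = "torus_measure L"
  interpret prob_space ?T by (rule prob_space_torus_measure[OF L])
  have "\<exists>E. finite E \<and> E \<subseteq> ?\<Lambda> \<and> (\<forall>G. finite G \<longrightarrow> G \<subseteq> ?\<Lambda> \<longrightarrow> G \<inter> E = {} \<longrightarrow> (\<Sum>k\<in>G. (norm (c k))\<^sup>2) \<le> (1 / 4) ^ n)" for n :: nat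
    using small_tails[of "\<lambda>k. (norm (c k))\<^sup>2" ?\<Lambda> B "(1 / 4) ^ n"] B by (metis zero_le_power2 zero_less_power zero_less_divide_1_iff zero_less_numeral)
  then obtain E where E: "\<And>n. finite (E n)" "\<And>n. E n \<subseteq> ?\<Lambda>"
    "\<And>n G. finite G \<Longrightarrow> G \<subseteq> ?\<Lambda> \<Longrightarrow> G \<inter> E n = {} \<Longrightarrow> (\<Sum>k\<in>G. (norm (c k))\<^sup>2) \<le> (1 / 4) ^ n"
    by metis
  \<comment> \<open>The union starts empty, so that the increments \<open>d\<close> telescope from
    0; the tail bound of index \<open>n\<close> is available from \<open>F (Suc n)\<close>
    on.\<close>
  define F where "F n = (\<Union>i<n. E i)" for n :: nat
  have F: "finite (F n)" "F n \<subseteq> ?\<Lambda>" for n using E by (auto simp: F_def)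
  have F_mono: "F m \<subseteq> F n" if "m \<le> n" for m n using that by (force simp: F_def)
  have tail: "(\<Sum>k\<in>G. (norm (c k))\<^sup>2) \<le> (1 / 4) ^ n" if "finite G" "G \<subseteq> ?\<Lambda>" "G \<inter> F (Suc n) = {}" for G n
    using that by (intro E(3)) (auto simp: F_def)
  define d where "d n = trig (F (Suc n) - F n) c" for n
  define S where "S n = trig (F n) c" for n
  have dm [measurable]: "d n \<in> borel_measurable borel" and Sm [measurable]: "S n \<in> borel_measurable borel" for n
    unfolding d_def S_def by measurable
  have di: "integrable ?T (d n)" for n unfolding d_def by (rule integrable_trig[OF L])
  have Sd: "(\<Sum>i<n. d i x) = S n x" for n x
  proof (induction n)
    case 0 then show ?case by (simp add: S_def F_def trig_def)
  next
    case (Suc n)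
    have "S (Suc n) x = S n x + d n x"
      unfolding S_def d_def trig_def using F F_mono[of n "Suc n"]
      by (subst sum.subset_diff[of "F n" "F (Suc n)"]) auto
    then show ?case using Suc by simp
  qed
  have sqd: "sqn L (trig (F m - F (Suc n)) c) \<le> (1 / 4) ^ n" for m n
    using F[of m] by (subst sqn_trig[OF L]) (auto intro!: tail)
  have dint: "(\<integral>x. norm (d (Suc n) x) \<partial>?T) \<le> (1 / 2) ^ n" for n
  proof -
    have "(\<integral>x. norm (d (Suc n) x) \<partial>?T) \<le> sqrt (sqn L (d (Suc n)))"
      unfolding d_def using F by (intro integral_norm_le_sqn L torus_L2_trig) auto
    also have "\<dots> \<le> sqrt ((1 / 4) ^ n)" unfolding d_def by (intro real_sqrt_le_mono sqd)
    also have "\<dots> = (1 / 2) ^ n" by (simp add: real_sqrt_power real_sqrt_divide)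
    finally show ?thesis .
  qed
  have sums: "summable (\<lambda>n. \<integral>x. norm (d n x) \<partial>?T)"
  proof (subst summable_Suc_iff[symmetric], rule summable_comparison_test')
    show "summable (\<lambda>n. (1 / 2 :: real) ^ n)" by (rule summable_geometric) simp
    show "norm (\<integral>x. norm (d (Suc n) x) \<partial>?T) \<le> (1 / 2) ^ n" if "n \<ge> 0" for n
      using dint[of n] by simp
  qed
  have AEs: "AE x in ?T. summable (\<lambda>n. norm (d n x))"
  proof -
    have "(\<integral>\<^sup>+x. (\<Sum>n. ennreal (norm (d n x))) \<partial>?T) = (\<Sum>n. \<integral>\<^sup>+x. ennreal (norm (d n x)) \<partial>?T)"
      by (rule nn_integral_suminf) measurable
    also have "\<dots> = (\<Sum>n. ennreal (\<integral>x. norm (d n x) \<partial>?T))"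
      using di by (intro suminf_cong nn_integral_eq_integral) auto
    also have "\<dots> \<noteq> top" by (rule ennreal_suminf_neq_top[OF sums]) simp
    finally have "AE x in ?T. (\<Sum>n. ennreal (norm (d n x))) \<noteq> \<infinity>"
      by (intro nn_integral_PInf_AE) (simp_all add: infinity_ennreal_def)
    then show ?thesis by eventually_elim (auto intro: summable_suminf_not_top)
  qed
  define h where "h x = (\<Sum>n. d n x)" for x
  have hi: "integrable ?T h" unfolding h_def by (rule integrable_suminf[OF di AEs sums])
  then have [measurable]: "h \<in> borel_measurable borel" by auto
  have dp: "torus_periodic L (d n)" for n unfolding d_def using F by (intro trig_periodic L) auto
  have hp: "torus_periodic L h" unfolding h_def torus_periodic_def using dp by (simp add: torus_periodic_def)
  have AEc: "AE x in ?T. (\<lambda>n. S n x) \<longlonglongrightarrow> h x"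
    using AEs
  proof eventually_elim
    case (elim x)
    show ?case unfolding h_def Sd[symmetric]
      by (rule summable_LIMSEQ[OF summable_norm_cancel[OF elim]])
  qed
  have coef: "fcoef L h k = c k" if k: "k \<in> ?\<Lambda>" for k
  proof -
    let ?e = "\<lambda>x. cis (- (k \<bullet> x))"
    have ie: "integrable ?T (\<lambda>x. d i x * ?e x)" for i
      by (rule Bochner_Integration.integrable_bound[OF di[of i]]) (auto simp: norm_mult)
    have "(\<lambda>i. \<integral>x. d i x * ?e x \<partial>?T) sums (\<integral>x. (\<Sum>i. d i x * ?e x) \<partial>?T)"
    proof (rule sums_integral)
      show "integrable ?T (\<lambda>x. d i x * ?e x)" for i by (rule ie)
    qed (use AEs sums in \<open>auto simp: norm_mult\<close>)
    moreover have "(\<integral>x. (\<Sum>i. d i x * ?e x) \<partial>?T) = fcoef L h k"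
      unfolding fcoef_def
    proof (rule integral_cong_AE)
      show "AE x in ?T. (\<Sum>i. d i x * ?e x) = h x * ?e x"
        using AEs
      proof eventually_elim
        case (elim x)
        show ?case unfolding h_def by (rule suminf_mult2[symmetric, OF summable_norm_cancel[OF elim]])
      qed
      show "(\<lambda>x. \<Sum>i. d i x * ?e x) \<in> borel_measurable ?T"
        by (rule borel_measurable_integrable, rule integrable_suminf)
           (use AEs sums ie in \<open>auto simp: norm_mult\<close>)
    qed measurable
    ultimately have "(\<lambda>n. \<Sum>i<n. fcoef L (d i) k) \<longlonglongrightarrow> fcoef L h k"
      unfolding sums_def fcoef_def by simp
    moreover have "(\<Sum>i<n. fcoef L (d i) k) = (if k \<in> F n then c k else 0)" for n
    proof (induction n)
      case (Suc n)
      have "fcoef L (d n) k = (if k \<in> F (Suc n) - F n then c k else 0)"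
        unfolding d_def using F by (intro fcoef_trig[OF L _ _ k]) auto
      then show ?case using Suc F_mono[of n "Suc n"] by auto
    qed (simp add: F_def)
    moreover have "(\<lambda>n. if k \<in> F n then c k else 0) \<longlonglongrightarrow> c k"
    proof (cases "\<exists>n. k \<in> F n")
      case True
      then obtain N where "k \<in> F N" by auto
      then have "eventually (\<lambda>n. (if k \<in> F n then c k else 0) = c k) sequentially"
        using F_mono by (auto simp: eventually_at_top_linorder intro!: exI[of _ N])
      then show ?thesis by (rule tendsto_eventually)
    next
      case False
      \<comment> \<open>A frequency that is never captured belongs to every tail, so its coefficient
        is 0 and agrees with the default value.\<close>
      have "(norm (c k))\<^sup>2 \<le> (1 / 4) ^ n" for n
        using tail[of "{k}" n] False k by auto
      moreover have "(\<lambda>n. (1 / 4 :: real) ^ n) \<longlonglongrightarrow> 0" by (intro LIMSEQ_realpow_zero) auto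
      ultimately have "(norm (c k))\<^sup>2 \<le> 0" by (intro LIMSEQ_le_const) auto
      then show ?thesis using False by simp
    qed
    ultimately show ?thesis using LIMSEQ_unique by (simp cong: if_cong) 
  qed
  \<comment> \<open>Almost everywhere convergence alone does not make \<open>h\<close> square
    integrable. The uniform bounds on the differences of partial sums pass to the limit and give
    both integrability and the rate.\<close>
  have fatou: "(\<integral>\<^sup>+x. ennreal ((norm (h x - S (Suc N) x))\<^sup>2) \<partial>?T) \<le> ennreal ((1 / 4) ^ N)" for N
  proof -
    have "(\<integral>\<^sup>+x. ennreal ((norm (h x - S (Suc N) x))\<^sup>2) \<partial>?T)
       = (\<integral>\<^sup>+x. liminf (\<lambda>m. ennreal ((norm (S m x - S (Suc N) x))\<^sup>2)) \<partial>?T)"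
    proof (rule nn_integral_cong_AE)
      show "AE x in ?T. ennreal ((norm (h x - S (Suc N) x))\<^sup>2) = liminf (\<lambda>m. ennreal ((norm (S m x - S (Suc N) x))\<^sup>2))"
        using AEc
      proof eventually_elim
        case (elim x)
        then have "(\<lambda>m. ennreal ((norm (S m x - S (Suc N) x))\<^sup>2)) \<longlonglongrightarrow> ennreal ((norm (h x - S (Suc N) x))\<^sup>2)"
          by (intro tendsto_intros)
        then show ?case by (intro lim_imp_Liminf[symmetric]) auto
      qed
    qed
    also have "\<dots> \<le> liminf (\<lambda>m. \<integral>\<^sup>+x. ennreal ((norm (S m x - S (Suc N) x))\<^sup>2) \<partial>?T)"
      by (rule nn_integral_liminf) measurable
    also have "\<dots> \<le> liminf (\<lambda>m. ennreal ((1 / 4) ^ N))"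
    proof (rule Liminf_mono)
      show "\<forall>\<^sub>F m in sequentially. (\<integral>\<^sup>+x. ennreal ((norm (S m x - S (Suc N) x))\<^sup>2) \<partial>?T) \<le> ennreal ((1 / 4) ^ N)"
        unfolding eventually_at_top_linorder
      proof (intro exI allI impI)
        fix m assume m: "m \<ge> Suc N"
        have "S m x - S (Suc N) x = trig (F m - F (Suc N)) c x" for x
          unfolding S_def trig_def using F F_mono[OF m] by (subst sum.subset_diff[of "F (Suc N)" "F m"]) auto
        then have "(\<integral>\<^sup>+x. ennreal ((norm (S m x - S (Suc N) x))\<^sup>2) \<partial>?T) = ennreal (sqn L (trig (F m - F (Suc N)) c))"
          unfolding sqn_def using torus_L2_trig[OF L, of "F m - F (Suc N)" c] F
          by (subst nn_integral_eq_integral[symmetric]) (auto simp: torus_L2_def)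
        then show "(\<integral>\<^sup>+x. ennreal ((norm (S m x - S (Suc N) x))\<^sup>2) \<partial>?T) \<le> ennreal ((1 / 4) ^ N)"
          using sqd by (simp add: ennreal_leI)
      qed
    qed
    also have "\<dots> = ennreal ((1 / 4) ^ N)" by (simp add: Liminf_const)
    finally show ?thesis .
  qed
  have dL2: "torus_L2 L (\<lambda>x. h x - S (Suc N) x)" for N
  proof -
    have "integrable ?T (\<lambda>x. (norm (h x - S (Suc N) x))\<^sup>2)"
      unfolding integrable_iff_bounded using fatou[of N] by (auto intro: le_less_trans)
    moreover have "torus_periodic L (S (Suc N))" unfolding S_def by (intro trig_periodic F L)
    ultimately show ?thesis using hp by (simp add: torus_L2_def torus_periodic_def)
  qed
  show ?thesis
  proof (rule that)
    show "torus_L2 L h"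
      using torus_L2_add(1)[OF dL2[of 0], of "S 1"] torus_L2_trig[OF L F(2), of 1 c] by (simp add: S_def)
    show "fcoef L h k = c k" if "k \<in> ?\<Lambda>" for k by (rule coef[OF that])
    fix \<epsilon> :: real assume \<epsilon>: "\<epsilon> > 0"
    obtain N where N: "(1 / 4) ^ N < \<epsilon>" using real_arch_pow_inv[OF \<epsilon>, of "1 / 4"] by auto
    have "ennreal (sqn L (\<lambda>x. h x - S (Suc N) x)) \<le> ennreal ((1 / 4) ^ N)"
      unfolding sqn_def using fatou[of N] dL2[of N]
      by (subst nn_integral_eq_integral[symmetric]) (auto simp: torus_L2_def)
    then have "sqn L (\<lambda>x. h x - trig (F (Suc N)) c x) \<le> \<epsilon>" using N by (simp add: S_def)
    then show "\<exists>F. finite F \<and> F \<subseteq> ?\<Lambda> \<and> sqn L (\<lambda>x. h x - trig F c x) \<le> \<epsilon>" using F by blast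
  qed
qed

text \<open>The Riesz-Fischer function built from the coefficients of \<open>f\<close> is
  approximated by their partial sums, and it equals \<open>f\<close> almost everywhere by
  uniqueness.\<close>

lemma fourier_complete:
  assumes L: "L > 0" and f: "torus_L2 L f" and \<epsilon>: "\<epsilon> > 0"
  obtains F where "finite F" "F \<subseteq> freq_lattice L" "sqn L (\<lambda>x. f x - trig F (fcoef L f) x) \<le> \<epsilon>"
proof -
  obtain h where h: "torus_L2 L h" "\<And>k. k \<in> freq_lattice L \<Longrightarrow> fcoef L h k = fcoef L f k"
    and app: "\<And>\<epsilon>. \<epsilon> > 0 \<Longrightarrow> \<exists>F. finite F \<and> F \<subseteq> freq_lattice L \<and> sqn L (\<lambda>x. h x - trig F (fcoef L f) x) \<le> \<epsilon>"
    using riesz_fischer[OF L, of "fcoef L f" "sqn L f"] bessel(1)[OF L _ _ f] by blast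
  have d: "torus_L2 L (\<lambda>x. f x - h x)" by (rule torus_L2_diff(1)[OF f h(1)])
  have "AE x in torus_measure L. f x - h x = 0"
  proof (rule fourier_unique[OF L integrable_torus_L2[OF L d]])
    show "torus_periodic L (\<lambda>x. f x - h x)" using d by (simp add: torus_L2_def)
    fix k assume k: "k \<in> freq_lattice L"
    have i: "integrable (torus_measure L) (\<lambda>x. u x * cis (- (k \<bullet> x)))" if "torus_L2 L u" for u
      by (rule Bochner_Integration.integrable_bound[OF integrable_torus_L2[OF L that]])
         (use that in \<open>auto simp: norm_mult torus_L2_def\<close>)
    have "fcoef L (\<lambda>x. f x - h x) k = fcoef L f k - fcoef L h k"
      unfolding fcoef_def left_diff_distrib by (rule Bochner_Integration.integral_diff[OF i[OF f] i[OF h(1)]])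
    then show "fcoef L (\<lambda>x. f x - h x) k = 0" using h(2)[OF k] by simp
  qed
  then have "sqn L (\<lambda>x. f x - trig F (fcoef L f) x) = sqn L (\<lambda>x. h x - trig F (fcoef L f) x)" for F
    unfolding sqn_def using f h(1) by (intro integral_cong_AE) (auto simp: torus_L2_def)
  then show ?thesis using app[OF \<epsilon>] that by auto
qed

lemma jackson_coeff_abs_le:
  assumes "L > 0" "M \<ge> 2" "k \<in> freq_lattice L" shows "\<bar>jackson_coeff L M k\<bar> \<le> 1"
proof -
  have "ennreal \<bar>jackson_coeff L M k\<bar> = ennreal (norm (\<integral>y. of_real (jackson L M y) * cis (k \<bullet> y) \<partial>torus_measure L))"
    using jackson_coeff_integral(1)[OF assms] by simp
  also have "\<dots> \<le> (\<integral>\<^sup>+y. ennreal (norm (of_real (jackson L M y) * cis (k \<bullet> y))) \<partial>torus_measure L)"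
    by (rule norm_integral_le_nn)
  also have "\<dots> = 1" using jackson_integral_1(3)[OF assms(1,2)] by (simp add: norm_mult jackson_nonneg)
  finally show ?thesis by simp
qed

definition jackson_mean :: "real \<Rightarrow> nat \<Rightarrow> (plane \<Rightarrow> complex) \<Rightarrow> plane \<Rightarrow> complex" where
  "jackson_mean L M f = trig (jackson_freqs L M) (\<lambda>k. of_real (jackson_coeff L M k) * fcoef L f k)"

lemma torus_L2_jackson_mean: "L > 0 \<Longrightarrow> torus_L2 L (jackson_mean L M f)"
  unfolding jackson_mean_def by (intro torus_L2_trig jackson_freqs_lattice)

lemma sqn_jackson_mean_le:
  assumes L: "L > 0" and M: "M \<ge> 2" and f: "torus_L2 L f"
  shows "sqn L (jackson_mean L M f) \<le> sqn L f"
proof -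
  note F = finite_jackson_freqs[of L M] jackson_freqs_lattice[of L M]
  have "sqn L (jackson_mean L M f) \<le> (\<Sum>k\<in>jackson_freqs L M. (norm (fcoef L f k))\<^sup>2)"
    unfolding jackson_mean_def sqn_trig[OF L F]
  proof (intro sum_mono power_mono)
    fix k assume "k \<in> jackson_freqs L M"
    then have "\<bar>jackson_coeff L M k\<bar> \<le> 1" using F by (intro jackson_coeff_abs_le L M) auto
    then show "norm (of_real (jackson_coeff L M k) * fcoef L f k) \<le> norm (fcoef L f k)"
      by (simp add: norm_mult mult_left_le_one_le)
  qed simp
  also have "\<dots> \<le> sqn L f" by (rule bessel(1)[OF L F f])
  finally show ?thesis .
qed

text \<open>On a finite set that carries nearly all of the mass the damping factors tend to 1; on
  the other frequencies they are bounded, and little mass is left.\<close>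

lemma jackson_mean_tendsto:
  assumes L: "L > 0" and f: "torus_L2 L f"
  shows "(\<lambda>M. sqn L (\<lambda>x. f x - jackson_mean L M f x)) \<longlonglongrightarrow> 0"
proof (rule LIMSEQ_I)
  fix r :: real assume r: "r > 0"
  \<comment> \<open>Of the eighths of \<open>r\<close>, one pays for the frequencies outside the
    kernel, four for those of the kernel outside \<open>F\<close>, where the squared damping error
    is at most 4, and one for \<open>F\<close> itself. Six in all stay below
    \<open>r\<close>.\<close>
  obtain F where F: "finite F" "F \<subseteq> freq_lattice L" "sqn L (\<lambda>x. f x - trig F (fcoef L f) x) \<le> r / 8"
    using fourier_complete[OF L f, of "r / 8"] r by auto
  define A where "A = (\<Sum>k\<in>F. (norm k * (2 * L))\<^sup>2 * (norm (fcoef L f k))\<^sup>2)"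
  have A: "A \<ge> 0" unfolding A_def by (intro sum_nonneg) auto
  have inF: "\<forall>\<^sub>F M in sequentially. F \<subseteq> jackson_freqs L M"
  proof -
    have "\<forall>\<^sub>F M in sequentially. k \<in> jackson_freqs L M" if "k \<in> F" for k
    proof -
      obtain m n where k: "k = freq L m n" using \<open>k \<in> F\<close> F(2) freq_latticeE by blast
      show ?thesis unfolding eventually_at_top_linorder
        by (rule exI[of _ "nat (max \<bar>m\<bar> \<bar>n\<bar>)"]) (auto simp: jackson_freqs_def k intro!: image_eqI[of _ _ "(m, n)"])
    qed
    then show ?thesis unfolding subset_iff using F(1) by (auto simp: eventually_ball_finite_distrib Ball_def[symmetric])
  qed
  have lim: "(\<lambda>M. A / (real M)\<^sup>2) \<longlonglongrightarrow> 0"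
    by (intro tendsto_divide_0[OF tendsto_const] filterlim_at_top_imp_at_infinity filterlim_pow_at_top filterlim_real_sequentially) simp
  then have "\<forall>\<^sub>F M in sequentially. A / (real M)\<^sup>2 < r / 8" by (rule order_tendstoD) (use r in simp)
  then have "\<forall>\<^sub>F M in sequentially. norm (sqn L (\<lambda>x. f x - jackson_mean L M f x) - 0) < r"
    using inF eventually_ge_at_top[of 2]
  proof eventually_elim
    case (elim M)
    note G = finite_jackson_freqs[of L M] jackson_freqs_lattice[of L M]
    let ?G = "jackson_freqs L M" and ?n = "\<lambda>k. (norm (fcoef L f k))\<^sup>2" and ?j = "\<lambda>k. jackson_coeff L M k"
    have d: "(norm (fcoef L f k - of_real (?j k) * fcoef L f k))\<^sup>2 = \<bar>1 - ?j k\<bar>\<^sup>2 * ?n k" for k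
    proof -
      have "fcoef L f k - of_real (?j k) * fcoef L f k = of_real (1 - ?j k) * fcoef L f k"
        by (simp add: algebra_simps)
      then show ?thesis by (simp only: norm_mult norm_of_real power_mult_distrib)
    qed
    have split: "sum u ?G = sum u (?G - F) + sum u F" for u :: "plane \<Rightarrow> real"
      using elim G by (intro sum.subset_diff) auto
    have res: "sum ?n (?G - F) \<le> r / 8"
      using F(3) bessel[OF L F(1,2) f] bessel(1)[OF L G f] split[of ?n] by simp
    have "(\<Sum>k\<in>?G - F. \<bar>1 - ?j k\<bar>\<^sup>2 * ?n k) \<le> (\<Sum>k\<in>?G - F. 2\<^sup>2 * ?n k)"
    proof (intro sum_mono mult_right_mono power_mono)
      fix k assume "k \<in> ?G - F"
      then have "\<bar>?j k\<bar> \<le> 1" using G elim by (intro jackson_coeff_abs_le L) auto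
      then show "\<bar>1 - ?j k\<bar> \<le> 2" by linarith
    qed auto
    also have "\<dots> = 4 * sum ?n (?G - F)" by (simp add: sum_distrib_left)
    finally have 1: "(\<Sum>k\<in>?G - F. \<bar>1 - ?j k\<bar>\<^sup>2 * ?n k) \<le> 4 * (r / 8)" using res by linarith
    have "(\<Sum>k\<in>F. \<bar>1 - ?j k\<bar>\<^sup>2 * ?n k) \<le> (\<Sum>k\<in>F. (norm k * (2 * L / M))\<^sup>2 * ?n k)"
      using F elim L by (intro sum_mono mult_right_mono power_mono jackson_coeff_near_1) auto
    also have "\<dots> = A / (real M)\<^sup>2"
      unfolding A_def sum_divide_distrib by (intro sum.cong refl) (simp add: power_divide power_mult_distrib)
    finally have 2: "(\<Sum>k\<in>F. \<bar>1 - ?j k\<bar>\<^sup>2 * ?n k) \<le> r / 8" using elim(1) by linarith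
    have "sqn L (\<lambda>x. f x - jackson_mean L M f x) = sqn L f - sum ?n ?G + (\<Sum>k\<in>?G. \<bar>1 - ?j k\<bar>\<^sup>2 * ?n k)"
      unfolding jackson_mean_def sqn_diff_trig[OF L G f] d ..
    also have "sqn L f - sum ?n ?G \<le> sqn L f - sum ?n F"
      using split[of ?n] sum_nonneg[of "?G - F" ?n] by simp
    also have "\<dots> \<le> r / 8" using F(3) bessel(2)[OF L F(1,2) f] by simp
    finally have "sqn L (\<lambda>x. f x - jackson_mean L M f x) \<le> r / 8 + (4 * (r / 8) + r / 8)"
      using 1 2 unfolding split[of "\<lambda>k. \<bar>1 - ?j k\<bar>\<^sup>2 * ?n k"] by linarith
    then show ?case using r sqn_nonneg[of L "\<lambda>x. f x - jackson_mean L M f x"] by simp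
  qed
  then show "\<exists>no. \<forall>n\<ge>no. norm (sqn L (\<lambda>x. f x - jackson_mean L n f x) - 0) < r"
    by (simp add: eventually_at_top_linorder)
qed

text \<open>A Jackson mean is an average of translates against a probability density; positivity of
  the kernel is what keeps the constant equal to 1.\<close>

lemma le3_jackson_mean:
  assumes L: "L > 0" and M: "M \<ge> 2" and f: "integrable (torus_measure L) f" and p: "torus_periodic L f"
    and b: "le3 L f b"
  shows "le3 L (jackson_mean L M f) b"
proof -
  have [measurable]: "f \<in> borel_measurable borel" using f by auto
  have "le3 L (jackson_mean L M f) (\<integral>\<^sup>+y. ennreal (jackson L M y) * b \<partial>torus_measure L)"
  proof (rule le3_minkowski[OF L sigma_finite_torus[OF L], where G="\<lambda>x y. of_real (jackson L M y) * f (x + y)"])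
    show "(\<lambda>(x, y). of_real (jackson L M y) * f (x + y)) \<in> borel_measurable (torus_measure L \<Otimes>\<^sub>M torus_measure L)"
      unfolding case_prod_unfold by measurable
    show "ennreal (norm (jackson_mean L M f x)) \<le> (\<integral>\<^sup>+y. ennreal (norm (of_real (jackson L M y) * f (x + y))) \<partial>torus_measure L)" for x
      unfolding jackson_mean_def jackson_conv[OF L M f p, symmetric] by (rule norm_integral_le_nn)
    show "le3 L (\<lambda>x. of_real (jackson L M y) * f (x + y)) (ennreal (jackson L M y) * b)" for y
      using le3_cmult[OF _ le3_shift[OF L _ p b, of y], of "of_real (jackson L M y)"]
      by (simp add: jackson_nonneg)
  qed measurable
  then show ?thesis using jackson_integral_1(3)[OF L M] by (simp add: nn_integral_multc)
qed

subsection \<open>Norms and multipliers of real functions\<close>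

abbreviation cplx :: "('a \<Rightarrow> real) \<Rightarrow> 'a \<Rightarrow> complex" where "cplx f \<equiv> \<lambda>x. complex_of_real (f x)"

lemma Lp_norm_eq:
  assumes "L > 0" and [measurable]: "f \<in> borel_measurable borel"
  shows "Lp_norm L p f = ennreal_powr (\<integral>\<^sup>+x. ennreal (norm (f x) powr p) \<partial>torus_measure L) (1 / p)"
  unfolding Lp_norm_def using assms by (subst nn_integral_torus) auto

text \<open>The exponent is positive because \<open>0 powr 0 = 0\<close> whereas
  \<open>0 ^ 0 = 1\<close>.\<close>

lemma powr_nat_pos: "x \<ge> 0 \<Longrightarrow> n > 0 \<Longrightarrow> x powr real n = x ^ n" for x :: real
  by (cases "x = 0") (auto simp: powr_realpow)

lemma L2_space_iff:
  assumes "L > 0" shows "f \<in> L2_space L \<longleftrightarrow> torus_L2 L (cplx f)"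
proof -
  have m: "(cplx f \<in> borel_measurable borel) = (f \<in> borel_measurable borel)"
    by (simp add: borel_measurable_complex_iff)
  have p: "torus_periodic L (cplx f) = torus_periodic L f" by (simp add: torus_periodic_def)
  have "Lp_norm L 2 f < \<infinity> \<longleftrightarrow> integrable (torus_measure L) (\<lambda>x. (norm (cplx f x))\<^sup>2)"
    if [measurable]: "f \<in> borel_measurable borel"
  proof -
    have "norm (f x) powr 2 = (f x)\<^sup>2" for x using powr_nat_pos[of "norm (f x)" 2] by simp
    then show ?thesis
      by (simp add: Lp_norm_eq[OF assms] ennreal_powr_def integrable_iff_bounded less_top)
  qed
  then show ?thesis unfolding L2_space_def torus_L2_def using m p by auto
qed

lemma le3_Lp_norm:
  fixes f :: "plane \<Rightarrow> complex"
  assumes "L > 0" and [measurable]: "f \<in> borel_measurable borel"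
  shows "le3 L f (Lp_norm L 3 f)"
proof -
  define X where "X = (\<integral>\<^sup>+x. ennreal (norm (f x) ^ 3) \<partial>torus_measure L)"
  have "norm (f x) powr 3 = norm (f x) ^ 3" for x using powr_nat_pos[of "norm (f x)" 3] by simp
  then have N: "Lp_norm L 3 f = ennreal_powr X (1 / 3)"
    by (simp add: Lp_norm_eq[OF assms(1)] X_def)
  have "X \<le> (ennreal_powr X (1 / 3)) ^ 3"
  proof (cases X)
    case (real r)
    have "(r powr (1 / 3)) ^ 3 = (r powr (1 / 3)) powr real 3"
      by (rule powr_nat_pos[symmetric]) auto
    also have "\<dots> = r" using real by (simp add: powr_powr)
    finally show ?thesis using real by (simp add: ennreal_powr_def ennreal_power)
  qed (simp add: ennreal_powr_def power3_eq_cube ennreal_mult_top)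
  then show ?thesis unfolding le3_def N X_def by (simp add: ennreal_power)
qed

lemma Lp_norm_cplx: "Lp_norm L p (cplx f) = Lp_norm L p f"
  by (simp add: Lp_norm_def)

lemma fourier_coeff_eq:
  assumes "L > 0" and [measurable]: "f \<in> borel_measurable borel"
  shows "fourier_coeff L f k = fcoef L (cplx f) k"
  unfolding fourier_coeff_def fcoef_def by (rule torus_avg_eq[OF assms(1)]) measurable

lemma integrable_mult_cis:
  assumes "integrable (torus_measure L) f"
  shows "integrable (torus_measure L) (\<lambda>x. f x * cis (- (k \<bullet> x)))"
  by (rule Bochner_Integration.integrable_bound[OF assms]) (use assms in \<open>auto simp: norm_mult\<close>)

lemma fcoef_cnj: "fcoef L (\<lambda>x. cnj (f x)) k = cnj (fcoef L f (- k))"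
proof -
  have "cnj (f x) * cis (- (k \<bullet> x)) = cnj (f x * cis (- (- k \<bullet> x)))" for x by (simp add: cis_cnj)
  then show ?thesis unfolding fcoef_def by (simp only: Bochner_Integration.integral_cnj)
qed

lemma fcoef_cplx_uminus: "fcoef L (cplx f) (- k) = cnj (fcoef L (cplx f) k)"
  using fcoef_cnj[of L "cplx f" "- k"] by simp

text \<open>Bessel's inequality makes the new coefficients square summable, so Riesz-Fischer
  provides a complex function. Its real part has the coefficients
  \<open>(c k + cnj (c (- k))) / 2\<close>, and the symmetry of the symbol together with the reality
  of \<open>f\<close> makes the two terms equal.\<close>

lemma fourier_multiplier_exists:
  assumes L: "L > 0" and f: "f \<in> L2_space L"
    and m: "\<And>k. k \<in> freq_lattice L \<Longrightarrow> norm (m k) \<le> C" and sym: "\<And>k. m (- k) = cnj (m k)"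
  shows "fourier_multiplier L m f \<in> L2_space L"
    "\<And>k. k \<in> freq_lattice L \<Longrightarrow> fourier_coeff L (fourier_multiplier L m f) k = m k * fourier_coeff L f k"
proof -
  have f2: "torus_L2 L (cplx f)" using f L2_space_iff[OF L] by simp
  have [measurable]: "f \<in> borel_measurable borel" using f by (simp add: L2_space_def)
  define c where "c k = m k * fcoef L (cplx f) k" for k
  have "(\<Sum>k\<in>F. (norm (c k))\<^sup>2) \<le> C\<^sup>2 * sqn L (cplx f)" if F: "finite F" "F \<subseteq> freq_lattice L" for F
  proof -
    have "(\<Sum>k\<in>F. (norm (c k))\<^sup>2) \<le> (\<Sum>k\<in>F. C\<^sup>2 * (norm (fcoef L (cplx f) k))\<^sup>2)"
      unfolding c_def norm_mult power_mult_distrib using F m by (intro sum_mono mult_right_mono power_mono) auto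
    also have "\<dots> \<le> C\<^sup>2 * sqn L (cplx f)"
      unfolding sum_distrib_left[symmetric] by (intro mult_left_mono bessel(1) L F f2) auto
    finally show ?thesis .
  qed
  from riesz_fischer[OF L this] obtain h where h: "torus_L2 L h" "\<And>k. k \<in> freq_lattice L \<Longrightarrow> fcoef L h k = c k"
    by metis
  have [measurable]: "h \<in> borel_measurable borel" using h by (simp add: torus_L2_def)
  have hi: "integrable (torus_measure L) h" by (rule integrable_torus_L2[OF L h(1)])
  define r where "r x = Re (h x)" for x
  have [measurable]: "r \<in> borel_measurable borel" unfolding r_def by measurable
  have "torus_L2 L (cplx r)"
    unfolding torus_L2_def
  proof (intro conjI)
    show "torus_periodic L (cplx r)" using h(1) by (auto simp: torus_L2_def torus_periodic_def r_def)
    show "integrable (torus_measure L) (\<lambda>x. (norm (cplx r x))\<^sup>2)"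
    proof (rule Bochner_Integration.integrable_bound)
      show "integrable (torus_measure L) (\<lambda>x. (norm (h x))\<^sup>2)" using h(1) by (simp add: torus_L2_def)
      show "AE x in torus_measure L. norm ((norm (cplx r x))\<^sup>2) \<le> norm ((norm (h x))\<^sup>2)"
        using abs_Re_le_cmod by (intro AE_I2) (auto simp: r_def abs_le_square_iff[symmetric])
    qed measurable
  qed measurable
  then have r2: "r \<in> L2_space L" using L2_space_iff[OF L] by simp
  have coef: "fourier_coeff L r k = m k * fourier_coeff L f k" if k: "k \<in> freq_lattice L" for k
  proof -
    have hc: "integrable (torus_measure L) (\<lambda>x. cnj (h x))" using hi by simp
    have "fcoef L (cplx r) k = (\<integral>x. (1 / 2) * (h x * cis (- (k \<bullet> x)) + cnj (h x) * cis (- (k \<bullet> x))) \<partial>torus_measure L)"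
      unfolding fcoef_def r_def
      by (intro Bochner_Integration.integral_cong refl) (simp add: complex_add_cnj flip: distrib_right)
    also have "\<dots> = (1 / 2) * (fcoef L h k + fcoef L (\<lambda>x. cnj (h x)) k)"
      unfolding fcoef_def integral_mult_right_zero
      by (subst Bochner_Integration.integral_add[OF integrable_mult_cis[OF hi] integrable_mult_cis[OF hc]]) simp
    also have "\<dots> = (1 / 2) * (c k + cnj (c (- k)))"
      unfolding fcoef_cnj using h(2)[OF k] h(2)[of "- k"] k by simp
    also have "cnj (c (- k)) = c k" unfolding c_def by (simp add: sym fcoef_cplx_uminus)
    finally show ?thesis by (simp add: fourier_coeff_eq[OF L] c_def)
  qed
  have "\<exists>h. h \<in> L2_space L \<and> (\<forall>k\<in>freq_lattice L. fourier_coeff L h k = m k * fourier_coeff L f k)"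
    using r2 coef by blast
  from someI_ex[OF this] show "fourier_multiplier L m f \<in> L2_space L"
    "\<And>k. k \<in> freq_lattice L \<Longrightarrow> fourier_coeff L (fourier_multiplier L m f) k = m k * fourier_coeff L f k"
    unfolding fourier_multiplier_def by auto
qed

lemma norm_freq_ge:
  assumes L: "L > 0" and k: "k \<in> freq_lattice L" "k \<noteq> 0"
  shows "norm k \<ge> 2 * pi / L"
proof -
  obtain m n where kk: "k = freq L m n" using k freq_latticeE by blast
  then have mn: "m \<noteq> 0 \<or> n \<noteq> 0" using k L by (auto simp: freq_0)
  have "2 * pi / L \<le> \<bar>k $ i\<bar>" if "k $ i = 2 * pi / L * real_of_int q" "q \<noteq> 0" for i q
  proof -
    have "2 * pi / L * 1 \<le> 2 * pi / L * \<bar>real_of_int q\<bar>"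
      using that L by (intro mult_left_mono) auto
    then show ?thesis using that L by (simp add: abs_mult)
  qed
  then have "2 * pi / L \<le> \<bar>k $ 1\<bar> \<or> 2 * pi / L \<le> \<bar>k $ 2\<bar>" using mn kk by (metis freq_nth)
  then show ?thesis using component_le_norm_cart[of k 1] component_le_norm_cart[of k 2] by linarith
qed

lemma sum_inverse_squares_int:
  assumes "finite I" shows "(\<Sum>m\<in>I. 1 / (1 + (real_of_int m)\<^sup>2)) \<le> 5"
proof -
  \<comment> \<open>The subtracted \<open>4 / (N + 1)\<close> makes the induction telescope; at
    \<open>N = 0\<close> the inequality is an equality.\<close>
  have *: "(\<Sum>m\<in>{- int N..int N}. 1 / (1 + (real_of_int m)\<^sup>2)) \<le> 5 - 4 / (real N + 1)" for N
  proof (induction N)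
    case (Suc N)
    have "{- int (Suc N)..int (Suc N)} = insert (- int (Suc N)) (insert (int (Suc N)) {- int N..int N})" by auto
    then have "(\<Sum>m\<in>{- int (Suc N)..int (Suc N)}. 1 / (1 + (real_of_int m)\<^sup>2))
       = 2 / (1 + (real N + 1)\<^sup>2) + (\<Sum>m\<in>{- int N..int N}. 1 / (1 + (real_of_int m)\<^sup>2))"
      by (simp add: power2_eq_square algebra_simps)
    also have "\<dots> \<le> 2 / (1 + (real N + 1)\<^sup>2) + (5 - 4 / (real N + 1))" using Suc by simp
    also have "2 / (1 + (real N + 1)\<^sup>2) \<le> 4 / ((real N + 1) * (real N + 2))"
    proof -
      have "(real N + 1) * (real N + 2) \<le> 2 * (1 + (real N + 1)\<^sup>2)"
        by (simp add: power2_eq_square algebra_simps)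
      then have "4 / (2 * (1 + (real N + 1)\<^sup>2)) \<le> 4 / ((real N + 1) * (real N + 2))"
        by (intro divide_left_mono) (auto intro!: mult_pos_pos simp: add_pos_nonneg)
      moreover have "4 / (2 * z) = 2 / z" for z :: real by simp
      ultimately show ?thesis by (simp only:)
    qed
    also have "4 / ((real N + 1) * (real N + 2)) = 4 / (real N + 1) - 4 / (real (Suc N) + 1)"
      by (simp add: field_simps)
    finally show ?case by simp
  qed simp
  obtain N :: nat where N: "\<And>m. m \<in> I \<Longrightarrow> \<bar>m\<bar> \<le> int N"
  proof -
    have "finite ((\<lambda>m. nat \<bar>m\<bar>) ` I)" using assms by simp
    then obtain N where "\<forall>x\<in>(\<lambda>m. nat \<bar>m\<bar>) ` I. x \<le> N" using finite_nat_set_iff_bounded_le by blast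
    then show ?thesis by (intro that[of N]) force
  qed
  have "(\<Sum>m\<in>I. 1 / (1 + (real_of_int m)\<^sup>2)) \<le> (\<Sum>m\<in>{- int N..int N}. 1 / (1 + (real_of_int m)\<^sup>2))"
    using N by (intro sum_mono2) (auto simp: abs_le_iff, force+)
  also have "\<dots> \<le> 5" using *[of N] by (smt (verit) divide_nonneg_nonneg of_nat_0_le_iff)
  finally show ?thesis .
qed

text \<open>Each term is split by \<open>x * y \<le> x^2 + y^2\<close> into an \<open>H^1\<close>
  term and \<open>1 / (|k|^2 * (1 + |k|^2))\<close>, which is summable in two dimensions. The
  Jackson means of the potential are thereby bounded uniformly; the bound depends on
  \<open>f\<close> and \<open>L\<close> and serves only for dominated convergence.\<close>

lemma potential_coeffs_summable:
  assumes L: "L > 0" and f: "f \<in> Hs_space L 1"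
  obtains P where "\<And>F. finite F \<Longrightarrow> F \<subseteq> freq_lattice L - {0} \<Longrightarrow> (\<Sum>k\<in>F. norm (fourier_coeff L f k) / norm k) \<le> P"
proof -
  define u where "u k = (1 + (norm k)\<^sup>2) * (norm (fourier_coeff L f k))\<^sup>2" for k
  define X where "X = (\<Sum>\<^sub>\<infinity>k\<in>freq_lattice L. ennreal ((1 + (norm k)\<^sup>2) powr 1 * (cmod (fourier_coeff L f k))\<^sup>2))"
  have "X \<noteq> \<infinity>" using f by (auto simp: Hs_space_def Hs_norm_def ennreal_powr_def X_def)
  then obtain B where B: "X = ennreal B" "B \<ge> 0" by (cases X) auto
  have Fu: "sum u F \<le> B" if F: "finite F" "F \<subseteq> freq_lattice L" for F
  proof -
    have "ennreal (sum u F) = (\<Sum>k\<in>F. ennreal (u k))" by (intro sum_ennreal[symmetric]) (simp add: u_def)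
    also have "\<dots> = (\<Sum>k\<in>F. ennreal ((1 + (norm k)\<^sup>2) powr 1 * (cmod (fourier_coeff L f k))\<^sup>2))"
      by (intro sum.cong refl) (simp add: u_def add_nonneg_nonneg)
    also have "\<dots> \<le> X" unfolding X_def
      by (subst nonneg_infsum_complete) (use F in \<open>auto intro!: SUP_upper\<close>)
    finally show ?thesis using B by simp
  qed
  \<comment> \<open>The fourth power converts lattice units into squared norms, and 4 comes from
    \<open>(1 + m^2) * (1 + n^2) \<le> 4 * q^2\<close> with \<open>q = m^2 + n^2 \<ge> 1\<close>.
    The double sum then splits into a product.\<close>
  define a where "a = (L / (2 * pi)) ^ 4 * 4"
  have a: "a > 0" using L by (simp add: a_def)
  define v where "v k = 1 / ((norm k)\<^sup>2 * (1 + (norm k)\<^sup>2))" for k :: plane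
  have v: "v (freq L m n) \<le> a * (1 / (1 + (real_of_int m)\<^sup>2) * (1 / (1 + (real_of_int n)\<^sup>2)))" if mn: "m \<noteq> 0 \<or> n \<noteq> 0" for m n
  proof -
    define q where "q = (real_of_int m)\<^sup>2 + (real_of_int n)\<^sup>2"
    have "1 \<le> m\<^sup>2 + n\<^sup>2" using mn by (metis add_nonneg_nonneg int_one_le_iff_zero_less le_less sum_power2_eq_zero_iff zero_le_power2)
    then have q: "q \<ge> 1" unfolding q_def by (metis of_int_add of_int_1_le_iff of_int_power)
    have nk: "(norm (freq L m n))\<^sup>2 = (2 * pi / L)\<^sup>2 * q"
      unfolding norm2_sq q_def by (simp add: power_mult_distrib power_divide distrib_left)
    define N where "N = (norm (freq L m n))\<^sup>2"
    have N: "N > 0" using q L unfolding N_def nk by simp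
    have "4 * q\<^sup>2 \<ge> (1 + (real_of_int m)\<^sup>2) * (1 + (real_of_int n)\<^sup>2)"
    proof -
      have "(real_of_int m)\<^sup>2 * (real_of_int n)\<^sup>2 \<le> q\<^sup>2"
        unfolding q_def power2_sum by simp
      moreover have "q \<le> q\<^sup>2" "1 \<le> q\<^sup>2" using q by (auto simp: power2_eq_square mult_le_cancel_right1 intro: order_trans[of 1 q])
      ultimately show ?thesis by (simp add: algebra_simps q_def[symmetric]) (simp add: q_def algebra_simps)
    qed
    then have "1 / (4 * q\<^sup>2) \<le> 1 / ((1 + (real_of_int m)\<^sup>2) * (1 + (real_of_int n)\<^sup>2))"
    proof (intro divide_left_mono mult_pos_pos)
      show "0 < q\<^sup>2" using q by simp
    qed (auto intro: add_pos_nonneg)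
    then have "a * (1 / (4 * q\<^sup>2)) \<le> a * (1 / (1 + (real_of_int m)\<^sup>2) * (1 / (1 + (real_of_int n)\<^sup>2)))"
      using a by (intro mult_left_mono) auto
    moreover have "v (freq L m n) \<le> 1 / N\<^sup>2"
      unfolding v_def N_def[symmetric] using N by (intro divide_left_mono) (auto simp: power2_eq_square)
    moreover have "1 / N\<^sup>2 = a * (1 / (4 * q\<^sup>2))"
      unfolding N_def nk a_def using L q by (simp add: power_mult_distrib power_divide field_simps flip: power_mult)
    ultimately show ?thesis by linarith
  qed
  have Fv: "sum v F \<le> a * 25" if F: "finite F" "F \<subseteq> freq_lattice L - {0}" for F
  proof -
    define g where "g p = freq L (fst p) (snd p)" for p
    have inj: "inj g" using L by (auto simp: inj_def g_def freq_inj prod_eq_iff)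
    define Q where "Q = g -` F"
    have "F \<subseteq> range g"
    proof
      fix k assume "k \<in> F"
      then obtain m n where "k = freq L m n" using F freq_latticeE by blast
      then show "k \<in> range g" by (auto simp: g_def image_iff)
    qed
    then have Q: "finite Q" "g ` Q = F"
      unfolding Q_def image_vimage_eq using F(1) inj by (auto intro: finite_vimageI)
    define I where "I = fst ` Q" define J where "J = snd ` Q"
    have IJ: "finite I" "finite J" "Q \<subseteq> I \<times> J" using Q by (auto simp: I_def J_def intro: rev_image_eqI)
    have "sum v F = (\<Sum>p\<in>Q. v (g p))"
      unfolding Q(2)[symmetric] using inj by (subst sum.reindex) (auto intro: inj_on_subset)
    also have "\<dots> \<le> (\<Sum>p\<in>Q. a * (1 / (1 + (real_of_int (fst p))\<^sup>2) * (1 / (1 + (real_of_int (snd p))\<^sup>2))))"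
    proof (rule sum_mono)
      fix p assume "p \<in> Q"
      then have "g p \<in> F" using Q by auto
      then have "fst p \<noteq> 0 \<or> snd p \<noteq> 0" using F L by (auto simp: g_def freq_0)
      then show "v (g p) \<le> a * (1 / (1 + (real_of_int (fst p))\<^sup>2) * (1 / (1 + (real_of_int (snd p))\<^sup>2)))"
        unfolding g_def by (rule v)
    qed
    also have "\<dots> \<le> (\<Sum>p\<in>I \<times> J. a * (1 / (1 + (real_of_int (fst p))\<^sup>2) * (1 / (1 + (real_of_int (snd p))\<^sup>2))))"
      using IJ a by (intro sum_mono2) (auto intro!: mult_nonneg_nonneg)
    also have "\<dots> = a * ((\<Sum>m\<in>I. 1 / (1 + (real_of_int m)\<^sup>2)) * (\<Sum>n\<in>J. 1 / (1 + (real_of_int n)\<^sup>2)))"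
      unfolding sum_product sum.cartesian_product by (simp add: sum_distrib_left case_prod_unfold)
    also have "\<dots> \<le> a * (5 * 5)"
      using a by (intro mult_left_mono mult_mono sum_inverse_squares_int IJ sum_nonneg) auto
    finally show ?thesis by simp
  qed
  show ?thesis
  proof (rule that)
    fix F assume F: "finite F" "F \<subseteq> freq_lattice L - {0}"
    have "(\<Sum>k\<in>F. norm (fourier_coeff L f k) / norm k) \<le> (\<Sum>k\<in>F. u k + v k)"
    proof (rule sum_mono)
      fix k assume "k \<in> F"
      then have k: "norm k > 0" using F by auto
      define p where "p = sqrt (1 + (norm k)\<^sup>2)"
      have p: "p > 0" "p\<^sup>2 = 1 + (norm k)\<^sup>2" by (auto simp: p_def add_pos_nonneg)
      have "norm (fourier_coeff L f k) / norm k = (p * norm (fourier_coeff L f k)) * (1 / (norm k * p))"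
        using p by simp
      also have "\<dots> \<le> (p * norm (fourier_coeff L f k))\<^sup>2 + (1 / (norm k * p))\<^sup>2"
        using sum_squares_bound[of "p * norm (fourier_coeff L f k)" "1 / (norm k * p)"] p k
          mult_nonneg_nonneg[of "p * norm (fourier_coeff L f k)" "1 / (norm k * p)"]
        unfolding mult.assoc[of 2] by (smt (verit) divide_nonneg_nonneg mult_nonneg_nonneg norm_ge_zero)
      also have "\<dots> = u k + v k"
        unfolding u_def v_def power_mult_distrib power_divide p(2) by (simp add: mult.commute)
      finally show "norm (fourier_coeff L f k) / norm k \<le> u k + v k" .
    qed
    also have "\<dots> \<le> B + a * 25" unfolding sum.distrib using F by (intro add_mono Fu Fv) auto
    finally show "(\<Sum>k\<in>F. norm (fourier_coeff L f k) / norm k) \<le> B + a * 25" .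
  qed
qed

subsection \<open>The estimate for a single field\<close>

text \<open>On a probability space mean-square convergence implies convergence in mean, which is
  almost sure along a subsequence.\<close>

lemma jackson_mean_AE_subseq:
  assumes L: "L > 0" and f: "torus_L2 L f" and g: "\<And>M. torus_L2 L (g M)"
    and lim: "(\<lambda>M. sqn L (\<lambda>x. f x - g M x)) \<longlonglongrightarrow> 0"
  obtains r :: "nat \<Rightarrow> nat" where "strict_mono r" "AE x in torus_measure L. (\<lambda>n. g (r n) x) \<longlonglongrightarrow> f x"
proof -
  have d: "torus_L2 L (\<lambda>x. f x - g M x)" for M by (rule torus_L2_diff(1)[OF f g])
  have "(\<lambda>M. \<integral>x. norm (f x - g M x) \<partial>torus_measure L) \<longlonglongrightarrow> 0"
  proof (rule Lim_null_comparison[OF always_eventually])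
    show "(\<lambda>M. sqrt (sqn L (\<lambda>x. f x - g M x))) \<longlonglongrightarrow> 0" using tendsto_real_sqrt[OF lim] by simp
    show "\<forall>M. norm (\<integral>x. norm (f x - g M x) \<partial>torus_measure L) \<le> sqrt (sqn L (\<lambda>x. f x - g M x))"
      using integral_norm_le_sqn[OF L d] by simp
  qed
  then obtain r :: "nat \<Rightarrow> nat" where r: "strict_mono r" "AE x in torus_measure L. (\<lambda>n. f x - g (r n) x) \<longlonglongrightarrow> 0"
    using tendsto_L1_AE_subseq[of "torus_measure L" "\<lambda>M x. f x - g M x"] integrable_torus_L2[OF L d] by blast
  show ?thesis
  proof (rule that[OF r(1)])
    show "AE x in torus_measure L. (\<lambda>n. g (r n) x) \<longlonglongrightarrow> f x"
      using r(2)
    proof eventually_elim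
      case (elim x)
      then show ?case using tendsto_diff[OF tendsto_const[of "f x"] elim] by simp
    qed
  qed
qed

text \<open>Mean-square convergence of three factors does not give convergence of their product.
  Here the middle factor is also bounded by \<open>2 * P\<close> and converges almost everywhere
  along a subsequence, so dominated convergence handles it, and the Cauchy-Schwarz inequality
  handles the outer factors.\<close>

lemma trilinear_limit:
  assumes L: "L > 0" and f: "torus_L2 L f" and p: "torus_L2 L p" and u: "torus_L2 L u"
    and P: "\<And>M x. M \<ge> 2 \<Longrightarrow> norm (jackson_mean L M p x) \<le> P"
    and Q: "\<And>M. M \<ge> 2 \<Longrightarrow> norm (\<integral>x. jackson_mean L M f x * (jackson_mean L M p (x + y) - jackson_mean L M p (x - y)) * jackson_mean L M u x \<partial>torus_measure L) \<le> Q"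
  shows "integrable (torus_measure L) (\<lambda>x. f x * (p (x + y) - p (x - y)) * u x)"
    "norm (\<integral>x. f x * (p (x + y) - p (x - y)) * u x \<partial>torus_measure L) \<le> Q"
proof -
  let ?T = "torus_measure L"
  define d where "d x = p (x + y) - p (x - y)" for x
  \<comment> \<open>The index is shifted by 2 because the kernel estimates are available from
    \<open>M = 2\<close> on.\<close>
  define fM where "fM M = jackson_mean L (M + 2) f" for M
  define uM where "uM M = jackson_mean L (M + 2) u" for M
  define dM where "dM M x = jackson_mean L (M + 2) p (x + y) - jackson_mean L (M + 2) p (x - y)" for M x
  have P0: "P \<ge> 0" using P[of 2 0] norm_ge_zero order_trans by blast
  have fM: "torus_L2 L (fM M)" and uM: "torus_L2 L (uM M)" for M
    unfolding fM_def uM_def by (simp_all add: torus_L2_jackson_mean L)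
  have diff_shift: "torus_L2 L (\<lambda>x. q (x + y) - q (x - y))" "sqn L (\<lambda>x. q (x + y) - q (x - y)) \<le> 4 * sqn L q"
    if "torus_L2 L q" for q
    using torus_L2_diff[OF torus_L2_shift(1)[OF L that, of y] torus_L2_shift(1)[OF L that, of "- y"]]
      torus_L2_shift(2)[OF L that, of y] torus_L2_shift(2)[OF L that, of "- y"] by simp_all
  have d: "torus_L2 L d" and dM: "torus_L2 L (dM M)" for M
    unfolding d_def dM_def by (intro diff_shift torus_L2_jackson_mean p L)+
  have [measurable]: "f \<in> borel_measurable borel" "u \<in> borel_measurable borel" "d \<in> borel_measurable borel"
     "fM M \<in> borel_measurable borel" "uM M \<in> borel_measurable borel" "dM M \<in> borel_measurable borel" for M
    using f u d fM uM dM by (auto simp: torus_L2_def)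
  have dMb: "norm (dM M x) \<le> 2 * P" for M x
    unfolding dM_def
    using norm_triangle_ineq4[of "jackson_mean L (M + 2) p (x + y)" "jackson_mean L (M + 2) p (x - y)"]
      P[of "M + 2" "x + y"] P[of "M + 2" "x - y"] by simp
  have lim: "(\<lambda>M. sqn L (\<lambda>x. q x - jackson_mean L (M + 2) q x)) \<longlonglongrightarrow> 0" if "torus_L2 L q" for q
    using LIMSEQ_ignore_initial_segment[OF jackson_mean_tendsto[OF L that], of 2] by simp
  have "(\<lambda>M. sqn L (\<lambda>x. d x - dM M x)) \<longlonglongrightarrow> 0"
  proof (rule Lim_null_comparison[OF always_eventually])
    show "(\<lambda>M. 4 * sqn L (\<lambda>x. p x - jackson_mean L (M + 2) p x)) \<longlonglongrightarrow> 0"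
      using tendsto_mult_right_zero[OF lim[OF p]] by simp
    show "\<forall>M. norm (sqn L (\<lambda>x. d x - dM M x)) \<le> 4 * sqn L (\<lambda>x. p x - jackson_mean L (M + 2) p x)"
      using diff_shift(2)[OF torus_L2_diff(1)[OF p torus_L2_jackson_mean[OF L]]]
      by (simp add: d_def dM_def algebra_simps sqn_nonneg)
  qed
  from jackson_mean_AE_subseq[OF L d dM this] obtain r
    where r: "strict_mono r" "AE x in ?T. (\<lambda>n. dM (r n) x) \<longlonglongrightarrow> d x" by auto
  \<comment> \<open>The limit inherits the bound almost everywhere, so the product is integrable
    although \<open>f\<close> and \<open>u\<close> are only square integrable.\<close>
  have db: "AE x in ?T. norm (d x) \<le> 2 * P"
    using r(2) by eventually_elim (rule LIMSEQ_le_const2[OF tendsto_norm], auto intro: dMb)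
  have fu: "integrable ?T (\<lambda>x. f x * u x)" by (rule integrable_mult_torus_L2[OF f u])
  have fud: "integrable ?T (\<lambda>x. of_real (2 * P) * (f x * u x))" using fu by simp
  have bnd: "norm (f x * v * u x) \<le> norm (of_real (2 * P) * (f x * u x))" if "norm v \<le> 2 * P" for v x
  proof -
    have "norm (f x * v * u x) = norm v * (norm (f x) * norm (u x))" by (simp add: norm_mult mult_ac)
    also have "\<dots> \<le> (2 * P) * (norm (f x) * norm (u x))" by (intro mult_right_mono that) auto
    finally show ?thesis using P0 by (simp add: norm_mult)
  qed
  have i0: "integrable ?T (\<lambda>x. f x * d x * u x)"
  proof (rule Bochner_Integration.integrable_bound[OF fud])
    show "AE x in ?T. norm (f x * d x * u x) \<le> norm (of_real (2 * P) * (f x * u x))"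
      using db by eventually_elim (rule bnd)
  qed measurable
  then show "integrable ?T (\<lambda>x. f x * (p (x + y) - p (x - y)) * u x)" by (simp add: d_def)
  have i1: "integrable ?T (\<lambda>x. f x * dM M x * u x)" for M
  proof (rule Bochner_Integration.integrable_bound[OF fud])
    show "AE x in ?T. norm (f x * dM M x * u x) \<le> norm (of_real (2 * P) * (f x * u x))"
      by (intro AE_I2 bnd dMb)
  qed measurable
  have lim1: "(\<lambda>n. \<integral>x. f x * dM (r n) x * u x \<partial>?T) \<longlonglongrightarrow> (\<integral>x. f x * d x * u x \<partial>?T)"
  proof (rule integral_dominated_convergence[where w="\<lambda>x. norm (of_real (2 * P) * (f x * u x))"])
    show "AE x in ?T. (\<lambda>n. f x * dM (r n) x * u x) \<longlonglongrightarrow> f x * d x * u x"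
      using r(2) by eventually_elim (intro tendsto_intros)
    show "AE x in ?T. norm (f x * dM (r n) x * u x) \<le> norm (of_real (2 * P) * (f x * u x))" for n
      by (intro AE_I2 bnd dMb)
  qed (use fud in auto)
  have i2: "integrable ?T (\<lambda>x. fM M x * dM M x * uM M x)" for M
  proof (rule Bochner_Integration.integrable_bound)
    show "integrable ?T (\<lambda>x. of_real (2 * P) * (fM M x * uM M x))"
      using integrable_mult_torus_L2[OF fM uM] by simp
    show "AE x in ?T. norm (fM M x * dM M x * uM M x) \<le> norm (of_real (2 * P) * (fM M x * uM M x))"
    proof (rule AE_I2)
      fix x
      have "norm (fM M x * dM M x * uM M x) = norm (dM M x) * (norm (fM M x) * norm (uM M x))" by (simp add: norm_mult mult_ac)
      also have "\<dots> \<le> (2 * P) * (norm (fM M x) * norm (uM M x))" by (intro mult_right_mono dMb) auto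
      finally show "norm (fM M x * dM M x * uM M x) \<le> norm (of_real (2 * P) * (fM M x * uM M x))"
        using P0 by (simp add: norm_mult)
    qed
  qed measurable
  \<comment> \<open>The error of replacing the outer factors by their means, with the middle factor
    estimated by its supremum. The means of \<open>u\<close> enter through the norm of
    \<open>u\<close>, which they do not exceed.\<close>
  define e where "e M = 2 * P * (sqrt (sqn L f * sqn L (\<lambda>x. u x - uM M x)) + sqrt (sqn L (\<lambda>x. f x - fM M x) * sqn L u))" for M
  have e: "norm ((\<integral>x. f x * dM M x * u x \<partial>?T) - (\<integral>x. fM M x * dM M x * uM M x \<partial>?T)) \<le> e M" for M
  proof -
    have cs: "(\<integral>x. norm (a x * b x) \<partial>?T) \<le> sqrt (sqn L a * sqn L b)" if "torus_L2 L a" "torus_L2 L b" for a b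
      using torus_cauchy_schwarz[OF that] by (intro real_le_rsqrt)
    have du: "torus_L2 L (\<lambda>x. u x - uM M x)" and df: "torus_L2 L (\<lambda>x. f x - fM M x)"
      by (intro torus_L2_diff f u fM uM)+
    note ia = integrable_mult_torus_L2[OF f du] and ib = integrable_mult_torus_L2[OF df uM[of M]]
    have "(\<integral>x. f x * dM M x * u x \<partial>?T) - (\<integral>x. fM M x * dM M x * uM M x \<partial>?T)
        = (\<integral>x. dM M x * (f x * (u x - uM M x) + (f x - fM M x) * uM M x) \<partial>?T)"
      unfolding Bochner_Integration.integral_diff[OF i1 i2, symmetric]
      by (intro Bochner_Integration.integral_cong refl) (simp add: algebra_simps)
    also have "norm \<dots> \<le> (\<integral>x. 2 * P * (norm (f x * (u x - uM M x)) + norm ((f x - fM M x) * uM M x)) \<partial>?T)"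
    proof (rule order_trans[OF integral_norm_bound integral_mono])
      show "integrable ?T (\<lambda>x. norm (dM M x * (f x * (u x - uM M x) + (f x - fM M x) * uM M x)))"
      proof -
        have "dM M x * (f x * (u x - uM M x) + (f x - fM M x) * uM M x) = f x * dM M x * u x - fM M x * dM M x * uM M x" for x
          by (simp add: algebra_simps)
        then show ?thesis using i1[of M] i2[of M] by simp
      qed
      show "integrable ?T (\<lambda>x. 2 * P * (norm (f x * (u x - uM M x)) + norm ((f x - fM M x) * uM M x)))"
        using ia ib by (intro integrable_mult_right Bochner_Integration.integrable_add integrable_norm)
      fix x
      show "norm (dM M x * (f x * (u x - uM M x) + (f x - fM M x) * uM M x))
         \<le> 2 * P * (norm (f x * (u x - uM M x)) + norm ((f x - fM M x) * uM M x))"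
        unfolding norm_mult[of "dM M x"] by (intro mult_mono dMb norm_triangle_ineq) (use P0 in auto)
    qed
    also have "\<dots> = 2 * P * ((\<integral>x. norm (f x * (u x - uM M x)) \<partial>?T) + (\<integral>x. norm ((f x - fM M x) * uM M x) \<partial>?T))"
      unfolding integral_mult_right_zero Bochner_Integration.integral_add[OF integrable_norm[OF ia] integrable_norm[OF ib]] ..
    also have "\<dots> \<le> e M"
      unfolding e_def
    proof (intro mult_left_mono add_mono)
      show "(\<integral>x. norm (f x * (u x - uM M x)) \<partial>?T) \<le> sqrt (sqn L f * sqn L (\<lambda>x. u x - uM M x))"
        by (rule cs[OF f du])
      have "(\<integral>x. norm ((f x - fM M x) * uM M x) \<partial>?T) \<le> sqrt (sqn L (\<lambda>x. f x - fM M x) * sqn L (uM M))"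
        by (rule cs[OF df uM])
      also have "\<dots> \<le> sqrt (sqn L (\<lambda>x. f x - fM M x) * sqn L u)"
        unfolding uM_def by (intro real_sqrt_le_mono mult_left_mono sqn_jackson_mean_le L u sqn_nonneg) simp
      finally show "(\<integral>x. norm ((f x - fM M x) * uM M x) \<partial>?T) \<le> sqrt (sqn L (\<lambda>x. f x - fM M x) * sqn L u)" .
    qed (use P0 in auto)
    finally show ?thesis .
  qed
  have "e \<longlonglongrightarrow> 2 * P * (sqrt (sqn L f * 0) + sqrt (0 * sqn L u))"
    unfolding e_def fM_def uM_def by (intro tendsto_intros lim f u)
  then have e0: "(\<lambda>n. e (r n)) \<longlonglongrightarrow> 0" using LIMSEQ_subseq_LIMSEQ[OF _ r(1)] by (fastforce simp: comp_def)
  have "norm (\<integral>x. f x * d x * u x \<partial>?T) \<le> Q + 0"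
  proof (rule LIMSEQ_le[OF tendsto_norm[OF lim1] tendsto_add[OF tendsto_const e0]], intro exI allI impI)
    fix n
    have "norm (\<integral>x. fM (r n) x * dM (r n) x * uM (r n) x \<partial>?T) \<le> Q"
      using Q[of "r n + 2"] by (simp add: fM_def dM_def uM_def)
    then show "norm (\<integral>x. f x * dM (r n) x * u x \<partial>?T) \<le> Q + e (r n)"
      using e[of "r n"] norm_triangle_ineq2[of "\<integral>x. f x * dM (r n) x * u x \<partial>?T" "\<integral>x. fM (r n) x * dM (r n) x * uM (r n) x \<partial>?T"]
      by linarith
  qed
  then show "norm (\<integral>x. f x * (p (x + y) - p (x - y)) * u x \<partial>?T) \<le> Q" by (simp add: d_def)
qed

lemma finite_freq_ball:
  assumes L: "L > 0" shows "finite {k \<in> freq_lattice L. norm k \<le> R}"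
proof (rule finite_subset)
  define N where "N = \<lceil>R * L / (2 * pi)\<rceil>"
  show "{k \<in> freq_lattice L. norm k \<le> R} \<subseteq> (\<lambda>(m, n). freq L m n) ` ({- N..N} \<times> {- N..N})"
  proof
    fix k assume k: "k \<in> {k \<in> freq_lattice L. norm k \<le> R}"
    then obtain m n where kk: "k = freq L m n" using freq_latticeE by blast
    have "\<bar>q\<bar> \<le> N" if "\<bar>2 * pi / L * real_of_int q\<bar> \<le> R" for q
    proof -
      have "\<bar>real_of_int q\<bar> \<le> R * L / (2 * pi)" using that L by (simp add: abs_mult field_simps)
      then show ?thesis unfolding N_def by linarith
    qed
    then have "\<bar>m\<bar> \<le> N" "\<bar>n\<bar> \<le> N"
      using k component_le_norm_cart[of k 1] component_le_norm_cart[of k 2] by (auto simp: kk intro: order_trans)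
    then show "k \<in> (\<lambda>(m, n). freq L m n) ` ({- N..N} \<times> {- N..N})"
      unfolding kk by (intro image_eqI[of _ _ "(m, n)"]) auto
  qed
qed simp

text \<open>The cutoff vanishes above \<open>b\<close>, so the infinite sum over frequencies is
  finite. The set \<open>G\<close> depends only on the cutoff, which is why the last conclusion
  concerns an arbitrary \<open>c\<close>; it is used for the coefficients of a Jackson mean.\<close>

lemma dyadic_block_trig:
  assumes \<phi>: "dyadic_partition \<phi> a b" and L: "L > 0" and [measurable]: "f \<in> borel_measurable borel"
  obtains G where "finite G" "G \<subseteq> freq_lattice L - {0}"
    "dyadic_block \<phi> L j f = trig G (block_coeff \<phi> j (fcoef L (cplx f)))"
    "\<And>k. k \<in> freq_lattice L - {0} - G \<Longrightarrow> block_coeff \<phi> j c k = 0"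
proof -
  define G where "G = {k \<in> freq_lattice L - {0}. norm k \<le> b * 2 powi j}"
  have zero: "\<phi> (2 powi (- j) * norm k) = 0" if "k \<in> freq_lattice L - {0} - G" for k
  proof -
    have "norm k > b * 2 powi j" using that by (auto simp: G_def)
    then have "2 powi (- j) * norm k > b" by (simp add: power_int_minus field_simps)
    then show ?thesis using \<phi> by (auto simp: dyadic_partition_def)
  qed
  show ?thesis
  proof (rule that)
    show G: "finite G" unfolding G_def by (rule finite_subset[OF _ finite_freq_ball[OF L, of "b * 2 powi j"]]) auto
    show "G \<subseteq> freq_lattice L - {0}" by (auto simp: G_def)
    show "block_coeff \<phi> j c k = 0" if "k \<in> freq_lattice L - {0} - G" for k
      using zero[OF that] by (simp add: block_coeff_def)
    show "dyadic_block \<phi> L j f = trig G (block_coeff \<phi> j (fcoef L (cplx f)))"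
    proof
      fix x
      have "dyadic_block \<phi> L j f x = (\<Sum>\<^sub>\<infinity>k\<in>G. block_coeff \<phi> j (fcoef L (cplx f)) k * cis (k \<bullet> x))"
        unfolding dyadic_block_def
        by (rule infsum_cong_neutral) (auto simp: zero G_def block_coeff_def fourier_coeff_eq[OF L])
      then show "dyadic_block \<phi> L j f x = trig G (block_coeff \<phi> j (fcoef L (cplx f))) x"
        using G by (simp add: trig_def)
    qed
  qed
qed

text \<open>The constant \<open>2 * K^2 * (1 + C)^2\<close>, where \<open>K\<close> is that of
  \<open>trilinear_bound\<close> for \<open>\<kappa> = s / 4\<close> and \<open>C\<close> that of
  \<open>heat_decay\<close>.\<close>

definition flux_const :: "real \<Rightarrow> real \<Rightarrow> real" where
  "flux_const a s = 2 * (3 * (1 / (1 - s / 4) + 1 / (s / 4)))\<^sup>2 *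
     (1 + sqrt ((18 / a) powr (s / 2) * (1 + 2 / (1 - 2 powr (- (s / 2))))))\<^sup>2"

text \<open>Damping commutes with the dyadic blocks and with the potential and Riesz symbols. The
  three means are thus built from one coefficient family \<open>c\<close>, and the polynomial
  estimate applies with constants independent of \<open>M\<close>.\<close>

lemma jackson_trilinear_bound:
  assumes \<phi>: "dyadic_partition \<phi> a b" and s: "0 < s" "s < 1" and L: "L > 0"
    and f: "f \<in> L2_space L" and mean: "fcoef L (cplx f) 0 = 0"
    and A: "A > 0" "le3 L (cplx f) (ennreal A)" and B: "B \<ge> 0"
    and blocks: "\<And>j. j \<le> 0 \<Longrightarrow> Lp_norm L 3 (dyadic_block \<phi> L j f) \<le> ennreal (2 powr (s * real_of_int j) * B)"
    and l: "norm y = l" "l \<ge> 1" and M: "M \<ge> 2"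
    and p: "\<And>k. k \<in> freq_lattice L \<Longrightarrow> fcoef L p k = of_real (1 / norm k) * fcoef L (cplx f) k"
    and u: "\<And>k. k \<in> freq_lattice L \<Longrightarrow> fcoef L u k = \<i> * of_real (k $ i / norm k) * fcoef L (cplx f) k"
  shows "norm (\<integral>x. jackson_mean L M (cplx f) x * (jackson_mean L M p (x + y) - jackson_mean L M p (x - y)) * jackson_mean L M u x \<partial>torus_measure L)
    \<le> flux_const a s * (A\<^sup>2 * (A + B)) * l powr (1 - s / 4)"
proof -
  have [measurable]: "f \<in> borel_measurable borel" using f by (simp add: L2_space_def)
  have f2: "torus_L2 L (cplx f)" using f L2_space_iff[OF L] by simp
  have fp: "torus_periodic L (cplx f)" using f2 by (simp add: torus_L2_def)
  define F where "F = jackson_freqs L M - {0}"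
  have F: "finite F" "F \<subseteq> freq_lattice L - {0}" unfolding F_def using jackson_freqs_lattice by auto
  \<comment> \<open>The gap estimates need frequencies away from 0; the zero mode disappears because
    the field has mean zero.\<close>
  have drop0: "trig (jackson_freqs L M) c = trig F c" if "c 0 = 0" for c
    unfolding trig_def[abs_def] F_def using that by (intro ext sum.mono_neutral_right) auto
  define c where "c k = of_real (jackson_coeff L M k) * fcoef L (cplx f) k" for k
  have c0: "c 0 = 0" by (simp add: c_def mean)
  have jf: "jackson_mean L M (cplx f) = trig F c"
    unfolding jackson_mean_def c_def[symmetric] by (rule drop0[of c, OF c0])
  have jp: "jackson_mean L M p = trig F (\<lambda>k. c k * of_real (1 / norm k))"
  proof -
    have "jackson_mean L M p = trig (jackson_freqs L M) (\<lambda>k. c k * of_real (1 / norm k))"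
      unfolding jackson_mean_def 
    proof (rule trig_cong)
      fix k assume "k \<in> jackson_freqs L M"
      then have "k \<in> freq_lattice L" using jackson_freqs_lattice by auto
      from p[OF this] show "of_real (jackson_coeff L M k) * fcoef L p k = c k * of_real (1 / norm k)"
        by (simp add: c_def)
    qed
    then show ?thesis using drop0[of "\<lambda>k. c k * of_real (1 / norm k)"] c0 by simp
  qed
  have ju: "jackson_mean L M u = trig F (\<lambda>k. c k * (\<i> * of_real (k $ i / norm k)))"
  proof -
    have "jackson_mean L M u = trig (jackson_freqs L M) (\<lambda>k. c k * (\<i> * of_real (k $ i / norm k)))"
      unfolding jackson_mean_def 
    proof (rule trig_cong)
      fix k assume "k \<in> jackson_freqs L M"
      then have "k \<in> freq_lattice L" using jackson_freqs_lattice by auto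
      from u[OF this] show "of_real (jackson_coeff L M k) * fcoef L u k = c k * (\<i> * of_real (k $ i / norm k))"
        by (simp add: c_def)
    qed
    then show ?thesis using drop0[of "\<lambda>k. c k * (\<i> * of_real (k $ i / norm k))"] c0 by simp
  qed
  have hA: "le3 L (trig F c) (ennreal A)"
    unfolding jf[symmetric] by (rule le3_jackson_mean[OF L M integrable_torus_L2[OF L f2] fp A(2)])
  \<comment> \<open>A block of the mean is the mean of the block, so averaging does not increase its
    cubic norm.\<close>
  have hB: "le3 L (trig F (block_coeff \<phi> j c)) (ennreal (2 powr (s * real_of_int j) * B))" if j: "j \<le> 0" for j
  proof -
    obtain G where G: "finite G" "G \<subseteq> freq_lattice L - {0}"
      and blk: "dyadic_block \<phi> L j f = trig G (block_coeff \<phi> j (fcoef L (cplx f)))"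
      and out: "\<And>k. k \<in> freq_lattice L - {0} - G \<Longrightarrow> block_coeff \<phi> j c k = 0"
      using dyadic_block_trig[OF \<phi> L, of f j c] by (metis \<open>f \<in> borel_measurable borel\<close>)
    have GL: "G \<subseteq> freq_lattice L" using G by auto
    let ?D = "dyadic_block \<phi> L j f"
    have D: "le3 L ?D (ennreal (2 powr (s * real_of_int j) * B))"
      by (rule le3_mono[OF le3_Lp_norm blocks[OF j]]) (use L in \<open>simp_all add: blk\<close>)
    have "le3 L (jackson_mean L M ?D) (ennreal (2 powr (s * real_of_int j) * B))"
      by (rule le3_jackson_mean[OF L M _ _ D]) (use L GL in \<open>simp_all add: blk trig_periodic\<close>)
    also have "jackson_mean L M ?D = trig (jackson_freqs L M) (\<lambda>k. if k = 0 then 0 else block_coeff \<phi> j c k)"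
      unfolding jackson_mean_def
    proof (rule trig_cong)
      fix k assume "k \<in> jackson_freqs L M"
      then have k: "k \<in> freq_lattice L" using jackson_freqs_lattice by auto
      show "of_real (jackson_coeff L M k) * fcoef L ?D k = (if k = 0 then 0 else block_coeff \<phi> j c k)"
        unfolding blk fcoef_trig[OF L G(1) GL k]
        using out[of k] k G(2) by (auto simp: block_coeff_def c_def)
    qed
    also have "\<dots> = trig F (\<lambda>k. if k = 0 then 0 else block_coeff \<phi> j c k)" by (rule drop0) simp
    also have "\<dots> = trig F (block_coeff \<phi> j c)" by (intro trig_cong) (auto simp: F_def)
    finally show ?thesis .
  qed
  define C where "C = sqrt ((18 / a) powr (s / 2) * (1 + 2 / (1 - 2 powr (- (s / 2)))))"
  have "1 + 2 / (1 - 2 powr (- (s / 2))) \<ge> 0" using s by (simp add: powr_less_one less_imp_le)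
  then have C: "C \<ge> 0" by (simp add: C_def)
  \<comment> \<open>The summand 1 beside \<open>C\<close> ensures \<open>A \<le> X\<close>, which
    lets \<open>trilinear_bound\<close> state both of its regimes with the same constant.\<close>
  define X where "X = (1 + C) * sqrt (A * (A + B))"
  have AX: "A \<le> X"
  proof -
    have "A \<le> sqrt (A * (A + B))" using A B by (intro real_le_rsqrt) (simp add: power2_eq_square mult_left_mono)
    also have "\<dots> = 1 * sqrt (A * (A + B))" by simp
    also have "\<dots> \<le> X" unfolding X_def using C A B by (intro mult_right_mono) auto
    finally show ?thesis .
  qed
  have decay: "le3 L (trig F (\<lambda>k. c k * heat \<tau> k)) (ennreal (X * \<tau> powr (- (s / 4))))" if \<tau>: "\<tau> > 0" for \<tau>
  proof (rule le3_mono)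
    show "le3 L (trig F (\<lambda>k. c k * heat \<tau> k)) (ennreal (C * sqrt (A * (A + B)) * \<tau> powr (- (s / 4))))"
      by (rule heat_decay[OF \<phi> s L F A(1) B hA hB \<tau> C_def])
    show "ennreal (C * sqrt (A * (A + B)) * \<tau> powr (- (s / 4))) \<le> ennreal (X * \<tau> powr (- (s / 4)))"
      unfolding X_def using A B by (intro ennreal_leI mult_right_mono) auto
  qed
  have "norm (\<integral>x. trig F c x * (trig F (\<lambda>k. c k * of_real (1 / norm k)) (x + y) - trig F (\<lambda>k. c k * of_real (1 / norm k)) (x - y))
       * trig F (\<lambda>k. c k * (\<i> * of_real (k $ i / norm k))) x \<partial>torus_measure L)
     \<le> 2 * (3 * (1 / (1 - s / 4) + 1 / (s / 4)))\<^sup>2 * A * X\<^sup>2 * l powr (1 - s / 4)"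
    by (rule trilinear_bound[OF L F _ _ _ AX hA decay refl l]) (use s A in auto)
  also have "A * X\<^sup>2 = (1 + C)\<^sup>2 * (A\<^sup>2 * (A + B))"
    using A B by (simp add: X_def power_mult_distrib power2_eq_square[of A])
  then have "2 * (3 * (1 / (1 - s / 4) + 1 / (s / 4)))\<^sup>2 * A * X\<^sup>2 = flux_const a s * (A\<^sup>2 * (A + B))"
    unfolding flux_const_def C_def[symmetric] by (simp only: mult.assoc)
  finally show ?thesis unfolding jf jp ju .
qed

text \<open>The estimate is stated in extended reals so that fields with an infinite norm or
  seminorm are included. The approximation by Jackson means takes place at each fixed field, before
  any expectation.\<close>

lemma field_flux_bound:
  assumes \<phi>: "dyadic_partition \<phi> a b" and s: "0 < s" "s < 1" and L: "L \<ge> 1"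
    and f: "f \<in> Hs_space L 1" and mean: "torus_avg L f = 0" and l: "l \<ge> 1" and n: "norm n = 1"
  shows "ennreal \<bar>torus_avg L (\<lambda>x. f x * (Lam L (- 1) f (x + l *\<^sub>R n) - Lam L (- 1) f (x - l *\<^sub>R n)) * (velocity L f x \<bullet> n))\<bar>
    \<le> ennreal (2 * flux_const a s * l powr (1 - s / 4)) * ((Lp_norm L 3 f)\<^sup>2 * (Lp_norm L 3 f + besov_low \<phi> L s f))"
proof -
  let ?T = "torus_measure L"
  have L0: "L > 0" using L by simp
  have f2: "f \<in> L2_space L" using f by (simp add: Hs_space_def)
  have fm [measurable]: "f \<in> borel_measurable borel" using f2 by (simp add: L2_space_def)
  have fc: "fourier_coeff L f k = fcoef L (cplx f) k" for k by (rule fourier_coeff_eq[OF L0 fm])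
  have f0: "fcoef L (cplx f) 0 = 0"
  proof -
    have "fcoef L (cplx f) 0 = of_real (\<integral>x. f x \<partial>?T)" by (simp add: fcoef_def)
    then show ?thesis using mean torus_avg_eq[OF L0 fm] by simp
  qed
  define p where "p = Lam L (- 1) f"
  have p2: "p \<in> L2_space L" and pc: "\<And>k. k \<in> freq_lattice L \<Longrightarrow> fourier_coeff L p k = of_real (norm k powr (- 1)) * fourier_coeff L f k"
  proof -
    \<comment> \<open>The lowest nonzero frequency bounds the symbol on this torus, and at 0 its
      value is 0. The bound grows with \<open>L\<close>, but it only guarantees that the potential
      exists.\<close>
    have "norm (complex_of_real (norm k powr (- 1))) \<le> L / (2 * pi)" if "k \<in> freq_lattice L" for k
    proof (cases "k = 0")
      case False
      have "1 / norm k \<le> 1 / (2 * pi / L)" using norm_freq_ge[OF L0 that False] L0 False by (intro divide_left_mono) auto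
      then show ?thesis using False by (simp add: powr_minus_divide norm_divide)
    qed (use L0 in simp)
    note * = fourier_multiplier_exists[OF L0 f2 this]
    show "p \<in> L2_space L" unfolding p_def Lam_def by (rule *(1)) auto
    show "fourier_coeff L p k = of_real (norm k powr (- 1)) * fourier_coeff L f k" if "k \<in> freq_lattice L" for k
      unfolding p_def Lam_def by (rule *(2)) (use that in auto)
  qed
  define u where "u i = riesz L i f" for i
  have u2: "u i \<in> L2_space L" and uc: "\<And>k. k \<in> freq_lattice L \<Longrightarrow> fourier_coeff L (u i) k = \<i> * of_real (k $ i / norm k) * fourier_coeff L f k" for i
  proof -
    have "norm (\<i> * complex_of_real (k $ i / norm k)) \<le> 1" for k :: plane
      using component_le_norm_cart[of k i] by (cases "k = 0") (auto simp: norm_mult norm_divide divide_le_eq_1)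
    note * = fourier_multiplier_exists[OF L0 f2 this]
    show "u i \<in> L2_space L" unfolding u_def riesz_def by (rule *(1)) auto
    show "fourier_coeff L (u i) k = \<i> * of_real (k $ i / norm k) * fourier_coeff L f k" if "k \<in> freq_lattice L" for k
      unfolding u_def riesz_def by (rule *(2)) (use that in auto)
  qed
  have pm [measurable]: "p \<in> borel_measurable borel" and um [measurable]: "u i \<in> borel_measurable borel" for i
    using p2 u2 by (simp_all add: L2_space_def)
  have pc': "fcoef L (cplx p) k = of_real (1 / norm k) * fcoef L (cplx f) k" if "k \<in> freq_lattice L" for k
    using pc[OF that] by (simp add: fc fourier_coeff_eq[OF L0 pm] powr_minus_divide)
  have uc': "fcoef L (cplx (u i)) k = \<i> * of_real (k $ i / norm k) * fcoef L (cplx f) k" if "k \<in> freq_lattice L" for k i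
    using uc[OF that] by (simp add: fc fourier_coeff_eq[OF L0 um])
  obtain P where P: "\<And>F. finite F \<Longrightarrow> F \<subseteq> freq_lattice L - {0} \<Longrightarrow> (\<Sum>k\<in>F. norm (fourier_coeff L f k) / norm k) \<le> P"
    using potential_coeffs_summable[OF L0 f] by blast
  have Pb: "norm (jackson_mean L M (cplx p) x) \<le> P" if M: "M \<ge> 2" for M x
  proof -
    let ?F = "jackson_freqs L M"
    have "norm (jackson_mean L M (cplx p) x) \<le> (\<Sum>k\<in>?F. norm (of_real (jackson_coeff L M k) * fcoef L (cplx p) k))"
      unfolding jackson_mean_def by (rule trig_bound)
    also have "\<dots> \<le> (\<Sum>k\<in>?F. norm (fourier_coeff L f k) / norm k)"
    proof (rule sum_mono)
      fix k assume "k \<in> ?F"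
      then have k: "k \<in> freq_lattice L" using jackson_freqs_lattice by auto
      have "norm (of_real (jackson_coeff L M k) * fcoef L (cplx p) k) \<le> 1 * norm (fcoef L (cplx p) k)"
        unfolding norm_mult using jackson_coeff_abs_le[OF L0 M k] by (intro mult_right_mono) auto
      then show "norm (of_real (jackson_coeff L M k) * fcoef L (cplx p) k) \<le> norm (fourier_coeff L f k) / norm k"
        by (simp add: pc'[OF k] fc norm_mult norm_divide)
    qed
    also have "\<dots> = (\<Sum>k\<in>?F - {0}. norm (fourier_coeff L f k) / norm k)"
      by (intro sum.mono_neutral_right) auto
    also have "\<dots> \<le> P" using jackson_freqs_lattice by (intro P) auto
    finally show ?thesis .
  qed
  define I where "I = (\<integral>x. f x * (p (x + l *\<^sub>R n) - p (x - l *\<^sub>R n)) * (velocity L f x \<bullet> n) \<partial>?T)"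
  have vel: "velocity L f x \<bullet> n = - u 2 x * n $ 1 + u 1 x * n $ 2" for x
    by (simp add: velocity_def inner2 u_def vector_2)
  have avg: "torus_avg L (\<lambda>x. f x * (Lam L (- 1) f (x + l *\<^sub>R n) - Lam L (- 1) f (x - l *\<^sub>R n)) * (velocity L f x \<bullet> n)) = I"
    unfolding I_def p_def[symmetric] vel by (rule torus_avg_eq[OF L0]) measurable
  define A where "A = Lp_norm L 3 f"
  define B where "B = besov_low \<phi> L s f"
  have leA: "le3 L (cplx f) A" unfolding A_def Lp_norm_cplx[symmetric] by (rule le3_Lp_norm[OF L0]) measurable
  have fcst: "flux_const a s > 0"
  proof -
    have "1 - 2 powr (- (s / 2)) \<ge> 0" using s by (simp add: powr_less_one less_imp_le)
    define K where "K = 3 * (1 / (1 - s / 4) + 1 / (s / 4))"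
    define C where "C = sqrt ((18 / a) powr (s / 2) * (1 + 2 / (1 - 2 powr (- (s / 2)))))"
    have "K > 0" unfolding K_def using s by (simp add: add_pos_pos)
    moreover have "C \<ge> 0" unfolding C_def using \<open>1 - 2 powr (- (s / 2)) \<ge> 0\<close> by simp
    ultimately show ?thesis
      unfolding flux_const_def K_def[symmetric] C_def[symmetric] by (intro mult_pos_pos zero_less_power) auto
  qed
  have "ennreal \<bar>I\<bar> \<le> ennreal (2 * flux_const a s * l powr (1 - s / 4)) * (A\<^sup>2 * (A + B))"
  proof -
    \<comment> \<open>If \<open>A = 0\<close> the right-hand side is 0 even for infinite
      \<open>B\<close>, so the flux has to vanish; it does because the field is 0 almost everywhere.
      If \<open>A\<close> is nonzero, an infinite norm makes the right-hand side infinite.\<close>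
    consider "A = 0" | "A \<noteq> 0" "A = top \<or> B = top" | r q where "A = ennreal r" "r > 0" "B = ennreal q" "q \<ge> 0"
    proof -
      have "A = 0 \<or> (A \<noteq> 0 \<and> (A = top \<or> B = top)) \<or> (\<exists>r q. A = ennreal r \<and> r > 0 \<and> B = ennreal q \<and> q \<ge> 0)"
        by (cases A; cases B) (auto simp: ennreal_eq_0_iff less_le)
      then show ?thesis using that by blast
    qed
    then show ?thesis
    proof cases
      case 1
      then have "(\<integral>\<^sup>+x. ennreal (norm (cplx f x)) ^ 3 \<partial>?T) = 0" using leA by (simp add: le3_def)
      then have "AE x in ?T. ennreal (norm (cplx f x)) ^ 3 = 0" by (subst (asm) nn_integral_0_iff_AE) auto
      then have "AE x in ?T. f x = 0" by eventually_elim simp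
      then have "I = (\<integral>x. 0 \<partial>?T)"
        unfolding I_def vel by (intro integral_cong_AE) (auto elim: eventually_mono)
      then show ?thesis by simp
    next
      case 2
      have "A\<^sup>2 * (A + B) = top" using 2 by (auto simp: power2_eq_square ennreal_mult_top ennreal_top_mult)
      then show ?thesis using fcst l by (simp add: ennreal_mult_top)
    next
      case (3 r q)
      have blocks: "Lp_norm L 3 (dyadic_block \<phi> L j f) \<le> ennreal (2 powr (s * real_of_int j) * q)" if "j \<le> 0" for j
      proof -
        have "ennreal (2 powr (- s * real_of_int j)) * Lp_norm L 3 (dyadic_block \<phi> L j f) \<le> B"
          unfolding B_def besov_low_def by (rule SUP_upper) (use that in auto)
        then have "ennreal (2 powr (s * real_of_int j)) * (ennreal (2 powr (- s * real_of_int j)) * Lp_norm L 3 (dyadic_block \<phi> L j f))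
           \<le> ennreal (2 powr (s * real_of_int j)) * B" by (intro mult_left_mono) auto
        also have "ennreal (2 powr (s * real_of_int j)) * (ennreal (2 powr (- s * real_of_int j)) * Lp_norm L 3 (dyadic_block \<phi> L j f))
           = Lp_norm L 3 (dyadic_block \<phi> L j f)"
          unfolding mult.assoc[symmetric] by (subst ennreal_mult[symmetric]) (simp_all flip: powr_add)
        finally show ?thesis using 3 by (simp add: ennreal_mult)
      qed
      define Q where "Q = flux_const a s * (r\<^sup>2 * (r + q)) * l powr (1 - s / 4)"
      have f2': "torus_L2 L (cplx f)" "torus_L2 L (cplx p)" "torus_L2 L (cplx (u i))" for i
        using f2 p2 u2 L2_space_iff[OF L0] by auto
      have Qb: "norm (\<integral>x. jackson_mean L M (cplx f) x * (jackson_mean L M (cplx p) (x + l *\<^sub>R n) - jackson_mean L M (cplx p) (x - l *\<^sub>R n))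
          * jackson_mean L M (cplx (u i)) x \<partial>?T) \<le> Q" if "M \<ge> 2" for M i
        unfolding Q_def
        by (rule jackson_trilinear_bound[OF \<phi> s L0 f2 f0 _ _ _ blocks]) (use 3 leA n l that pc' uc' in auto)
      have lim: "integrable ?T (\<lambda>x. cplx f x * (cplx p (x + l *\<^sub>R n) - cplx p (x - l *\<^sub>R n)) * cplx (u i) x)"
        "norm (\<integral>x. cplx f x * (cplx p (x + l *\<^sub>R n) - cplx p (x - l *\<^sub>R n)) * cplx (u i) x \<partial>?T) \<le> Q" for i
        using trilinear_limit[OF L0 f2' Pb Qb] by auto
      define w where "w i x = f x * (p (x + l *\<^sub>R n) - p (x - l *\<^sub>R n)) * u i x" for i x
      have cw: "cplx f x * (cplx p (x + l *\<^sub>R n) - cplx p (x - l *\<^sub>R n)) * cplx (u i) x = of_real (w i x)" for i x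
        by (simp add: w_def)
      have wi: "integrable ?T (w i)" for i using lim(1)[of i] unfolding cw by (simp add: complex_of_real_integrable_eq)
      have wb: "\<bar>\<integral>x. w i x \<partial>?T\<bar> \<le> Q" for i using lim(2)[of i] unfolding cw by simp
      have "I = (\<integral>x. - n $ 1 * w 2 x + n $ 2 * w 1 x \<partial>?T)"
        unfolding I_def vel by (intro Bochner_Integration.integral_cong refl) (simp add: w_def algebra_simps)
      also have "\<dots> = - n $ 1 * (\<integral>x. w 2 x \<partial>?T) + n $ 2 * (\<integral>x. w 1 x \<partial>?T)" using wi by simp
      finally have "\<bar>I\<bar> \<le> \<bar>n $ 1\<bar> * \<bar>\<integral>x. w 2 x \<partial>?T\<bar> + \<bar>n $ 2\<bar> * \<bar>\<integral>x. w 1 x \<partial>?T\<bar>"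
        by (simp add: abs_mult[symmetric])
      \<comment> \<open>The velocity has two Riesz components, each multiplied by a coordinate of a
        unit vector; this is the factor 2 in the claim.\<close>
      also have "\<dots> \<le> 1 * Q + 1 * Q"
        using component_le_norm_cart[of n 1] component_le_norm_cart[of n 2] n wb
        by (intro add_mono mult_mono) auto
      finally have "ennreal \<bar>I\<bar> \<le> ennreal (2 * flux_const a s * l powr (1 - s / 4) * (r\<^sup>2 * (r + q)))"
        by (intro ennreal_leI) (simp add: Q_def mult_ac)
      also have "\<dots> = ennreal (2 * flux_const a s * l powr (1 - s / 4)) * (A\<^sup>2 * (A + B))"
        using 3 fcst by (subst ennreal_mult) (auto simp: ennreal_mult ennreal_power)
      finally show ?thesis .
    qed
  qed
  then show ?thesis unfolding avg A_def B_def .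
qed

subsection \<open>Averages over the circle and over the probability space\<close>

lemma circle_avg_le:
  assumes "\<And>n. norm n = 1 \<Longrightarrow> ennreal \<bar>g n\<bar> \<le> B"
  shows "ennreal \<bar>circle_avg g\<bar> \<le> B"
proof (cases B)
  case (real r)
  have nv: "norm (vector [cos t, sin t] :: plane) = 1" for t
    using norm2_sq[of "vector [cos t, sin t]"] by (simp add: vector_2 power2_eq_1_iff) (smt (verit) norm_ge_zero)
  have "ennreal \<bar>\<integral>t. indicator {0..2 * pi} t *\<^sub>R g (vector [cos t, sin t]) \<partial>lborel\<bar>
      \<le> (\<integral>\<^sup>+t. ennreal (norm (indicator {0..2 * pi} t *\<^sub>R g (vector [cos t, sin t]))) \<partial>lborel)"
    using norm_integral_le_nn[of lborel "\<lambda>t. indicator {0..2 * pi} t *\<^sub>R g (vector [cos t, sin t])"] by simp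
  also have "\<dots> \<le> (\<integral>\<^sup>+t. ennreal r * indicator {0..2 * pi} t \<partial>lborel)"
    using assms[OF nv] real by (intro nn_integral_mono) (auto split: split_indicator)
  also have "\<dots> = ennreal r * ennreal (2 * pi)" by (subst nn_integral_cmult_indicator) auto
  also have "\<dots> = ennreal (r * (2 * pi))" using real by (simp add: ennreal_mult)
  finally have "\<bar>\<integral>t. indicator {0..2 * pi} t *\<^sub>R g (vector [cos t, sin t]) \<partial>lborel\<bar> \<le> r * (2 * pi)"
    using real by (subst (asm) ennreal_le_iff) auto
  then have "\<bar>circle_avg g\<bar> \<le> r"
    unfolding circle_avg_def set_lebesgue_integral_def by (simp add: abs_divide pos_divide_le_eq)
  then show ?thesis using real by (simp add: ennreal_leI)
qed simp

text \<open>The integrand need not be measurable: \<open>\<integral>\<^sup>+\<close> is then a lower integral.\<close>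

lemma nn_integral_cmult_le:
  assumes c: "c > 0"
  shows "(\<integral>\<^sup>+x. ennreal c * W x \<partial>M) \<le> ennreal c * (\<integral>\<^sup>+x. W x \<partial>M)"
  unfolding nn_integral_def[of M "\<lambda>x. ennreal c * W x"]
proof (rule SUP_least)
  fix g assume "g \<in> {g. simple_function M g \<and> g \<le> (\<lambda>x. ennreal c * W x)}"
  then have g: "simple_function M g" "\<And>x. g x \<le> ennreal c * W x" by (auto simp: le_fun_def)
  have inv: "ennreal (1 / c) * (ennreal c * z) = z" for z
    unfolding mult.assoc[symmetric] using c by (subst ennreal_mult[symmetric]) auto
  define h where "h x = ennreal (1 / c) * g x" for x
  have h: "simple_function M h" unfolding h_def using g(1) by auto
  have hW: "h x \<le> W x" for x
    using mult_left_mono[OF g(2)[of x], of "ennreal (1 / c)"] by (simp add: h_def inv)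
  have "integral\<^sup>S M g = (\<integral>\<^sup>+x. g x \<partial>M)" by (rule nn_integral_eq_simple_integral[OF g(1), symmetric])
  also have "\<dots> = (\<integral>\<^sup>+x. ennreal c * h x \<partial>M)"
    using inv by (intro nn_integral_cong) (simp add: h_def mult.left_commute[of "ennreal c"])
  also have "\<dots> = ennreal c * (\<integral>\<^sup>+x. h x \<partial>M)"
    by (rule nn_integral_cmult[OF borel_measurable_simple_function[OF h]])
  also have "\<dots> \<le> ennreal c * (\<integral>\<^sup>+x. W x \<partial>M)" by (intro mult_left_mono nn_integral_mono hW) auto
  finally show "integral\<^sup>S M g \<le> ennreal c * (\<integral>\<^sup>+x. W x \<partial>M)" .
qed

lemma S_H_bound:
  assumes \<phi>: "dyadic_partition \<phi> a b" and s: "0 < s" "s < 1" and L: "L \<ge> 1"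
    and f: "AE \<omega> in M. f \<omega> \<in> Hs_space L 1 \<and> torus_avg L (f \<omega>) = 0" and l: "l \<ge> 1"
    and E: "(\<integral>\<^sup>+\<omega>. (Lp_norm L 3 (f \<omega>))\<^sup>2 * (Lp_norm L 3 (f \<omega>) + besov_low \<phi> L s (f \<omega>)) \<partial>M) \<le> ennreal e" and e: "e \<ge> 0"
  shows "\<bar>S_H M L f l / l\<bar> \<le> 2 * \<bar>flux_const a s\<bar> * e * l powr (- (s / 4)) + 2 * e * l powr (- (s / 4))"
proof -
  let ?W = "\<lambda>\<omega>. (Lp_norm L 3 (f \<omega>))\<^sup>2 * (Lp_norm L 3 (f \<omega>) + besov_low \<phi> L s (f \<omega>))"
  \<comment> \<open>The absolute value and the added 1 make \<open>c\<close> positive, as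
    \<open>nn_integral_cmult_le\<close> demands; the 1 is the origin of the second summand in the
    claim.\<close>
  define c where "c = 2 * (\<bar>flux_const a s\<bar> + 1) * l powr (1 - s / 4)"
  have c: "c > 0" using l by (simp add: c_def)
  have le_c: "2 * flux_const a s * l powr (1 - s / 4) \<le> c" unfolding c_def by (intro mult_right_mono) auto
  have "ennreal \<bar>S_H M L f l\<bar> \<le> (\<integral>\<^sup>+\<omega>. ennreal c * ?W \<omega> \<partial>M)"
  proof -
    define g where "g \<omega> = circle_avg (\<lambda>n. torus_avg L (\<lambda>x. f \<omega> x * (Lam L (- 1) (f \<omega>) (x + l *\<^sub>R n) - Lam L (- 1) (f \<omega>) (x - l *\<^sub>R n)) *
        (velocity L (f \<omega>) x \<bullet> n)))" for \<omega>
    have "S_H M L f l = integral\<^sup>L M g" unfolding S_H_def g_def ..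
    then have "ennreal \<bar>S_H M L f l\<bar> \<le> (\<integral>\<^sup>+\<omega>. ennreal \<bar>g \<omega>\<bar> \<partial>M)"
      using norm_integral_le_nn[of M g] by simp
    also have "\<dots> \<le> (\<integral>\<^sup>+\<omega>. ennreal c * ?W \<omega> \<partial>M)"
    proof (rule nn_integral_mono_AE)
      show "AE \<omega> in M. ennreal \<bar>g \<omega>\<bar> \<le> ennreal c * ?W \<omega>"
        using f
      proof eventually_elim
        case (elim \<omega>)
        show ?case unfolding g_def
        proof (rule circle_avg_le)
          fix n :: plane assume n: "norm n = 1"
          have "ennreal (2 * flux_const a s * l powr (1 - s / 4)) * ?W \<omega> \<le> ennreal c * ?W \<omega>"
            using le_c by (intro mult_right_mono ennreal_leI) auto
          then show "ennreal \<bar>torus_avg L (\<lambda>x. f \<omega> x * (Lam L (- 1) (f \<omega>) (x + l *\<^sub>R n) - Lam L (- 1) (f \<omega>) (x - l *\<^sub>R n)) *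
            (velocity L (f \<omega>) x \<bullet> n))\<bar> \<le> ennreal c * ?W \<omega>"
            using field_flux_bound[OF \<phi> s L _ _ l n, of "f \<omega>"] elim by (auto intro: order_trans)
        qed
      qed
    qed
    finally show ?thesis .
  qed
  also have "\<dots> \<le> ennreal c * (\<integral>\<^sup>+\<omega>. ?W \<omega> \<partial>M)" by (rule nn_integral_cmult_le[OF c])
  also have "\<dots> \<le> ennreal c * ennreal e" by (intro mult_left_mono E) auto
  also have "\<dots> = ennreal (c * e)" using c e by (simp add: ennreal_mult)
  finally have "\<bar>S_H M L f l\<bar> \<le> c * e" using c e by (subst (asm) ennreal_le_iff) auto
  then have "\<bar>S_H M L f l / l\<bar> \<le> c * e / l" using l by (simp add: abs_divide divide_right_mono)
  also have "c * e / l = 2 * \<bar>flux_const a s\<bar> * e * l powr (- (s / 4)) + 2 * e * l powr (- (s / 4))"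
  proof -
    have "l powr (1 - s / 4) = l * l powr (- (s / 4))" using l by (simp add: powr_diff powr_minus_divide)
    then show ?thesis using l by (simp add: c_def field_simps)
  qed
  finally show ?thesis .
qed

section \<open>The limit of vanishing viscosity and damping\<close>

lemma eventually_zero_lim_pos: "\<forall>\<^sub>F x in zero_lim. fst x > 0 \<and> snd x > 0"
  unfolding zero_lim_def
  by (rule eventually_prodI[where P="\<lambda>x. x > 0" and Q="\<lambda>x. x > 0"]) (auto simp: eventually_at_right_less)

lemma zero_lim_neq_bot: "zero_lim \<noteq> bot"
  unfolding zero_lim_def by (simp add: prod_filter_eq_bot)

theorem theorem2p10:
  fixes M :: "'w measure" and F :: "real \<Rightarrow> 'w measure"
    and W :: "nat \<Rightarrow> real \<Rightarrow> 'w \<Rightarrow> real"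
    and g :: "real \<Rightarrow> nat \<Rightarrow> plane \<Rightarrow> real"
    and \<phi> :: "real \<Rightarrow> real"
    and \<gamma> s t :: real
    and L :: "real \<Rightarrow> real \<Rightarrow> real"
    and \<theta> :: "real \<Rightarrow> real \<Rightarrow> real \<Rightarrow> 'w \<Rightarrow> plane \<Rightarrow> real"
  assumes "prob_space M"
    and "usual_filtration M F"
    and "iid_brownian_motions M F W"
    and "admissible_forcing g"
    and "dyadic_cutoff \<phi>"
    and "\<gamma> \<ge> 0"
    and "\<And>\<nu> \<alpha>. \<nu> > 0 \<Longrightarrow> \<alpha> > 0 \<Longrightarrow> L \<nu> \<alpha> \<ge> 1"
    and "filterlim (\<lambda>(\<nu>, \<alpha>). L \<nu> \<alpha>) at_top zero_lim"
    and "\<And>\<nu> \<alpha>. \<nu> > 0 \<Longrightarrow> \<alpha> > 0 \<Longrightarrow>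
           stationary_strong_solution M F W (g (L \<nu> \<alpha>)) (L \<nu> \<alpha>) \<nu> \<alpha> \<gamma> (\<theta> \<nu> \<alpha>)"
    and "t \<ge> 0"
    and "0 < s" "s < 1"
    and "(SUP (\<nu>, \<alpha>)\<in>{0<..} \<times> {0<..}.
            \<integral>\<^sup>+\<omega>. (Lp_norm (L \<nu> \<alpha>) 3 (\<theta> \<nu> \<alpha> t \<omega>))\<^sup>2 *
                  (Lp_norm (L \<nu> \<alpha>) 3 (\<theta> \<nu> \<alpha> t \<omega>) + besov_low \<phi> (L \<nu> \<alpha>) s (\<theta> \<nu> \<alpha> t \<omega>)) \<partial>M) < \<infinity>"
  shows "((\<lambda>l\<^sub>I. Limsup zero_lim (\<lambda>(\<nu>, \<alpha>).
            SUP l\<in>{l\<^sub>I..<L \<nu> \<alpha>}. ennreal \<bar>S_H M (L \<nu> \<alpha>) (\<theta> \<nu> \<alpha> t) l / l\<bar>)) \<longlongrightarrow> 0) at_top \<and>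
         \<not> (\<exists>(c::real) (l\<^sub>\<alpha> :: real \<Rightarrow> real \<Rightarrow> real).
            c \<noteq> 0 \<and>
            filterlim (\<lambda>(\<nu>, \<alpha>). l\<^sub>\<alpha> \<nu> \<alpha>) at_top zero_lim \<and>
            ((\<lambda>(\<nu>, \<alpha>). l\<^sub>\<alpha> \<nu> \<alpha> / L \<nu> \<alpha>) \<longlongrightarrow> 0) zero_lim \<and>
            ((\<lambda>l\<^sub>I. Limsup zero_lim (\<lambda>(\<nu>, \<alpha>).
               SUP l\<in>{l\<^sub>I..l\<^sub>\<alpha> \<nu> \<alpha>}. ennreal \<bar>S_H M (L \<nu> \<alpha>) (\<theta> \<nu> \<alpha> t) l / l - c\<bar>)) \<longlongrightarrow> 0) at_top)"
proof -
  note A = assms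
  obtain a b where \<phi>: "dyadic_partition \<phi> a b"
    using A(5) unfolding dyadic_cutoff_def dyadic_partition_def by blast
  define E where "E = (SUP (\<nu>, \<alpha>)\<in>{0<..} \<times> {0<..}.
            \<integral>\<^sup>+\<omega>. (Lp_norm (L \<nu> \<alpha>) 3 (\<theta> \<nu> \<alpha> t \<omega>))\<^sup>2 *
                  (Lp_norm (L \<nu> \<alpha>) 3 (\<theta> \<nu> \<alpha> t \<omega>) + besov_low \<phi> (L \<nu> \<alpha>) s (\<theta> \<nu> \<alpha> t \<omega>)) \<partial>M)"
  have "E < top" using A(13) by (simp add: E_def)
  then obtain e where e: "E = ennreal e" "e \<ge> 0" by (cases E) auto
  define C where "C = 2 * \<bar>flux_const a s\<bar> * e + 2 * e"
  have C: "C \<ge> 0" using e by (simp add: C_def)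
  have bound: "\<bar>S_H M (L \<nu> \<alpha>) (\<theta> \<nu> \<alpha> t) l / l\<bar> \<le> C * l powr (- (s / 4))"
    if pos: "\<nu> > 0" "\<alpha> > 0" and l: "l \<ge> 1" for \<nu> \<alpha> l
  proof -
    have sol: "AE \<omega> in M. \<forall>t\<ge>0. torus_avg (L \<nu> \<alpha>) (\<theta> \<nu> \<alpha> t \<omega>) = 0" "AE \<omega> in M. path_regular (L \<nu> \<alpha>) (\<lambda>t. \<theta> \<nu> \<alpha> t \<omega>)"
      using A(9)[OF pos] by (auto simp: stationary_strong_solution_def)
    have "AE \<omega> in M. \<theta> \<nu> \<alpha> t \<omega> \<in> Hs_space (L \<nu> \<alpha>) 1 \<and> torus_avg (L \<nu> \<alpha>) (\<theta> \<nu> \<alpha> t \<omega>) = 0"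
      using sol by eventually_elim (use \<open>t \<ge> 0\<close> in \<open>auto simp: path_regular_def\<close>)
    moreover have "(\<integral>\<^sup>+\<omega>. (Lp_norm (L \<nu> \<alpha>) 3 (\<theta> \<nu> \<alpha> t \<omega>))\<^sup>2 *
                  (Lp_norm (L \<nu> \<alpha>) 3 (\<theta> \<nu> \<alpha> t \<omega>) + besov_low \<phi> (L \<nu> \<alpha>) s (\<theta> \<nu> \<alpha> t \<omega>)) \<partial>M) \<le> ennreal e"
      unfolding e(1)[symmetric] E_def by (rule SUP_upper2[of "(\<nu>, \<alpha>)"]) (use pos in auto)
    ultimately have "\<bar>S_H M (L \<nu> \<alpha>) (\<theta> \<nu> \<alpha> t) l / l\<bar> \<le> 2 * \<bar>flux_const a s\<bar> * e * l powr (- (s / 4)) + 2 * e * l powr (- (s / 4))"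
      by (rule S_H_bound[OF \<phi> \<open>0 < s\<close> \<open>s < 1\<close> A(7)[OF pos] _ l _ e(2)])
    then show ?thesis by (simp add: C_def distrib_right)
  qed
  let ?U = "\<lambda>l\<^sub>I. Limsup zero_lim (\<lambda>(\<nu>, \<alpha>). SUP l\<in>{l\<^sub>I..<L \<nu> \<alpha>}. ennreal \<bar>S_H M (L \<nu> \<alpha>) (\<theta> \<nu> \<alpha> t) l / l\<bar>)"
  \<comment> \<open>The bound decreases in \<open>l\<close>, so the supremum over a range is
    controlled by its left endpoint, uniformly in the upper end \<open>L \<nu> \<alpha>\<close>; an
    empty range contributes 0.\<close>
  have U: "?U l\<^sub>I \<le> ennreal (C * l\<^sub>I powr (- (s / 4)))" if "l\<^sub>I \<ge> 1" for l\<^sub>I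
  proof (rule Limsup_bounded)
    show "\<forall>\<^sub>F x in zero_lim. (case x of (\<nu>, \<alpha>) \<Rightarrow> SUP l\<in>{l\<^sub>I..<L \<nu> \<alpha>}. ennreal \<bar>S_H M (L \<nu> \<alpha>) (\<theta> \<nu> \<alpha> t) l / l\<bar>) \<le> ennreal (C * l\<^sub>I powr (- (s / 4)))"
      using eventually_zero_lim_pos
    proof eventually_elim
      case (elim x)
      obtain \<nu> \<alpha> where x: "x = (\<nu>, \<alpha>)" by (cases x)
      have "(SUP l\<in>{l\<^sub>I..<L \<nu> \<alpha>}. ennreal \<bar>S_H M (L \<nu> \<alpha>) (\<theta> \<nu> \<alpha> t) l / l\<bar>) \<le> ennreal (C * l\<^sub>I powr (- (s / 4)))"
      proof (rule SUP_least)
        fix l assume "l \<in> {l\<^sub>I..<L \<nu> \<alpha>}"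
        then have l: "l\<^sub>I \<le> l" "1 \<le> l" using that by auto
        have "\<bar>S_H M (L \<nu> \<alpha>) (\<theta> \<nu> \<alpha> t) l / l\<bar> \<le> C * l powr (- (s / 4))" using elim x l by (intro bound) auto
        also have "\<dots> \<le> C * l\<^sub>I powr (- (s / 4))"
          using C l that \<open>0 < s\<close> by (intro mult_left_mono powr_mono2') auto
        finally show "ennreal \<bar>S_H M (L \<nu> \<alpha>) (\<theta> \<nu> \<alpha> t) l / l\<bar> \<le> ennreal (C * l\<^sub>I powr (- (s / 4)))" by (rule ennreal_leI)
      qed
      then show ?case by (simp add: x)
    qed
  qed
  have "((\<lambda>l. C * l powr (- (s / 4))) \<longlongrightarrow> C * 0) at_top"
    by (intro tendsto_mult tendsto_const tendsto_neg_powr filterlim_ident) (use \<open>0 < s\<close> in auto)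
  then have lim: "((\<lambda>l. ennreal (C * l powr (- (s / 4)))) \<longlongrightarrow> 0) at_top"
    using tendsto_ennrealI by force
  have first: "(?U \<longlongrightarrow> 0) at_top"
  proof (rule tendsto_sandwich[OF _ _ tendsto_const lim])
    show "\<forall>\<^sub>F l in at_top. ?U l \<le> ennreal (C * l powr (- (s / 4)))"
      using eventually_ge_at_top[of "1::real"] by eventually_elim (rule U)
  qed simp
  have second: False
    if c: "c \<noteq> 0" and la: "filterlim (\<lambda>(\<nu>, \<alpha>). l\<^sub>\<alpha> \<nu> \<alpha>) at_top zero_lim"
      and ratio: "((\<lambda>(\<nu>, \<alpha>). l\<^sub>\<alpha> \<nu> \<alpha> / L \<nu> \<alpha>) \<longlongrightarrow> 0) zero_lim"
      and flux: "((\<lambda>l\<^sub>I. Limsup zero_lim (\<lambda>(\<nu>, \<alpha>).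
               SUP l\<in>{l\<^sub>I..l\<^sub>\<alpha> \<nu> \<alpha>}. ennreal \<bar>S_H M (L \<nu> \<alpha>) (\<theta> \<nu> \<alpha> t) l / l - c\<bar>)) \<longlongrightarrow> 0) at_top"
    for c :: real and l\<^sub>\<alpha> :: "real \<Rightarrow> real \<Rightarrow> real"
  proof -
    \<comment> \<open>At the threshold \<open>|c| / 2\<close> the normalised flux cannot be close to
      both 0 and \<open>c\<close>.\<close>
    have h: "0 < ennreal (\<bar>c\<bar> / 2)" using c by simp
    have "\<forall>\<^sub>F l\<^sub>I in at_top. ?U l\<^sub>I < ennreal (\<bar>c\<bar> / 2) \<and> Limsup zero_lim (\<lambda>(\<nu>, \<alpha>).
               SUP l\<in>{l\<^sub>I..l\<^sub>\<alpha> \<nu> \<alpha>}. ennreal \<bar>S_H M (L \<nu> \<alpha>) (\<theta> \<nu> \<alpha> t) l / l - c\<bar>) < ennreal (\<bar>c\<bar> / 2)"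
      using order_tendstoD(2)[OF first h] order_tendstoD(2)[OF flux h] by eventually_elim simp
    from eventually_happens'[OF trivial_limit_at_top_linorder this] obtain l\<^sub>I where lI: "?U l\<^sub>I < ennreal (\<bar>c\<bar> / 2)"
       "Limsup zero_lim (\<lambda>(\<nu>, \<alpha>). SUP l\<in>{l\<^sub>I..l\<^sub>\<alpha> \<nu> \<alpha>}. ennreal \<bar>S_H M (L \<nu> \<alpha>) (\<theta> \<nu> \<alpha> t) l / l - c\<bar>) < ennreal (\<bar>c\<bar> / 2)"
      by (elim exE conjE)
    have "\<forall>\<^sub>F x in zero_lim. False"
      using Limsup_lessD[OF lI(1)] Limsup_lessD[OF lI(2)] eventually_zero_lim_pos
        filterlim_at_top[THEN iffD1, OF la, rule_format, of l\<^sub>I] order_tendstoD(2)[OF ratio, of 1, simplified]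
    proof eventually_elim
      case (elim x)
      obtain \<nu> \<alpha> where x: "x = (\<nu>, \<alpha>)" by (cases x)
      \<comment> \<open>Eventually \<open>l\<^sub>\<alpha>\<close> lies below the side of the torus
        and above \<open>l\<^sub>I\<close>, so the scale \<open>l\<^sub>I\<close> itself belongs to
        both ranges and the two suprema can be compared there.\<close>
      have "L \<nu> \<alpha> \<ge> 1" using elim x A(7) by auto
      then have "l\<^sub>\<alpha> \<nu> \<alpha> < L \<nu> \<alpha>" using elim x by (simp add: divide_less_eq_1)
      moreover have "l\<^sub>I \<le> l\<^sub>\<alpha> \<nu> \<alpha>" using elim x by simp
      ultimately have mem: "l\<^sub>I \<in> {l\<^sub>I..<L \<nu> \<alpha>}" "l\<^sub>I \<in> {l\<^sub>I..l\<^sub>\<alpha> \<nu> \<alpha>}" by auto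
      note sup = elim(1,2)[unfolded x case_prod_conv]
      have "ennreal \<bar>S_H M (L \<nu> \<alpha>) (\<theta> \<nu> \<alpha> t) l\<^sub>I / l\<^sub>I\<bar> < ennreal (\<bar>c\<bar> / 2)"
        by (rule le_less_trans[OF SUP_upper[OF mem(1), where f="\<lambda>l. ennreal \<bar>S_H M (L \<nu> \<alpha>) (\<theta> \<nu> \<alpha> t) l / l\<bar>"] sup(1)])
      moreover have "ennreal \<bar>S_H M (L \<nu> \<alpha>) (\<theta> \<nu> \<alpha> t) l\<^sub>I / l\<^sub>I - c\<bar> < ennreal (\<bar>c\<bar> / 2)"
        by (rule le_less_trans[OF SUP_upper[OF mem(2), where f="\<lambda>l. ennreal \<bar>S_H M (L \<nu> \<alpha>) (\<theta> \<nu> \<alpha> t) l / l - c\<bar>"] sup(2)])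
      ultimately have "\<bar>S_H M (L \<nu> \<alpha>) (\<theta> \<nu> \<alpha> t) l\<^sub>I / l\<^sub>I\<bar> < \<bar>c\<bar> / 2"
        "\<bar>S_H M (L \<nu> \<alpha>) (\<theta> \<nu> \<alpha> t) l\<^sub>I / l\<^sub>I - c\<bar> < \<bar>c\<bar> / 2"
        by (simp_all add: ennreal_less_iff)
      then show False by linarith
    qed
    then show False using zero_lim_neq_bot by (simp add: eventually_False)
  qed
  show ?thesis using first second by blast
qed

end
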